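(* Let $A$ be the monogenic extension of $K$ associated with $\alpha$ and $f$. Assume there exists $\breve\lambda\in\mathcal Z(K)$ (the center of $K$) such that $\alpha^n(\breve\lambda)=\breve\lambda$ and $\breve\lambda-\alpha^i(\breve\lambda)$ is invertible in $K$ for $1\le i<n$. Then, for all $m\ge 0$, $$\mathrm{HH}^K_0(A)=\frac{K}{[K,K]+\mathrm{Im}(\alpha-\mathrm{id})\lambda_n},$$ $$\mathrm{HH}^K_{2m+1}(A)=\frac{\{\lambda\in K:(\alpha(\lambda)-\lambda)\lambda_n\in[K,K]_{\alpha^{mn}}\}}{[K,K]_{\alpha^{(m+1)n}}+\mathrm{Im}\bigl(\sum_{\ell=0}^{n-1}\alpha^\ell\bigr)}\,x^{n-1},$$ $$\mathrm{HH}^K_{2m+2}(A)=\frac{\{\lambda\in K:\sum_{\ell=0}^{n-1}\alpha^\ell(\lambda)\in[K,K]_{\alpha^{(m+1)n}}\}}{[K,K]_{\alpha^{(m+1)n}}+\mathrm{Im}(\alpha-\mathrm{id})\lambda_n}.$$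
   Context: Setting: $k$ is a commutative ring with $1$, $K$ is an associative unital $k$-algebra (not necessarily commutative), $\alpha$ is a $k$-algebra endomorphism of $K$, and $B=K[x,\alpha]$ is the Ore extension: the algebra generated by $K$ and $x$ subject to $x\lambda=\alpha(\lambda)x$ for $\lambda\in K$. Let $f=\sum_{i=0}^n\lambda_ix^{n-i}$ with $\lambda_0=1$, $n\ge 2$, $\lambda_i\in K$, $\alpha(\lambda_i)=\lambda_i$ and $\lambda_i\lambda=\alpha^i(\lambda)\lambda_i$ for all $\lambda\in K$ and $1\le i\le n$. The monogenic extension of $K$ associated with $\alpha$ and $f$ is $A=B/\langle f\rangle$. $[K,K]_{\alpha^j}$ is the $k$-submodule of $K$ generated by all $\lambda'\alpha^j(\lambda)-\lambda\lambda'$ ($\lambda,\lambda'\in K$), and $[K,K]=[K,K]_{\alpha^0}$. $\mathrm{HH}^K_*(A)$ is the Hochschild homology of $A$ relative to $K$ with coefficients in $A$: the homology of the complex $(A\otimes_K\overline A^{\otimes_K^*}\otimes,b)$, where $\overline A=A/K$, $b$ is the canonical Hochschild boundary, and for a $K$-bimodule $N$, $N\otimes$ denotes the quotient of $N$ by the $k$-submodule generated by all $m\lambda-\lambda m$ ($m\in N,\lambda\in K$). Equalities are isomorphisms of $k$-modules; the factor $x^{n-1}$ is a formal label recording that classes are represented by elements of $Kx^{n-1}\subseteq A$. *)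

theory Defs
  imports "HOL-Algebra.UnivPoly" "HOL-Algebra.QuotRing"
begin

section \<open>Modules and algebras over a commutative ring\<close>

text \<open>The library locale \<^locale>\<open>algebra\<close> requires the algebra to be commutative.\<close>

locale assoc_algebra = module R M + M: ring M for R and M (structure) +
  assumes smult_mult_left:
      "\<lbrakk>c \<in> carrier R; x \<in> carrier M; y \<in> carrier M\<rbrakk> \<Longrightarrow>
       (c \<odot>\<^bsub>M\<^esub> x) \<otimes>\<^bsub>M\<^esub> y = c \<odot>\<^bsub>M\<^esub> (x \<otimes>\<^bsub>M\<^esub> y)"
    and smult_mult_right:
      "\<lbrakk>c \<in> carrier R; x \<in> carrier M; y \<in> carrier M\<rbrakk> \<Longrightarrow>
       x \<otimes>\<^bsub>M\<^esub> (c \<odot>\<^bsub>M\<^esub> y) = c \<odot>\<^bsub>M\<^esub> (x \<otimes>\<^bsub>M\<^esub> y)"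

definition algebra_endo ::
  "('k, 'r) ring_scheme \<Rightarrow> ('k, 'a, 'm) module_scheme \<Rightarrow> ('a \<Rightarrow> 'a) \<Rightarrow> bool" where
  "algebra_endo k K \<alpha> \<longleftrightarrow> \<alpha> \<in> ring_hom K K \<and>
     (\<forall>c\<in>carrier k. \<forall>x\<in>carrier K. \<alpha> (c \<odot>\<^bsub>K\<^esub> x) = c \<odot>\<^bsub>K\<^esub> \<alpha> x)"

definition center :: "('a, 'm) ring_scheme \<Rightarrow> 'a set" where
  "center K = {z \<in> carrier K. \<forall>y\<in>carrier K. z \<otimes>\<^bsub>K\<^esub> y = y \<otimes>\<^bsub>K\<^esub> z}"

definition span_mod ::
  "('k, 'r) ring_scheme \<Rightarrow> ('k, 'v, 'm) module_scheme \<Rightarrow> 'v set \<Rightarrow> 'v set" where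
  "span_mod k M S = \<Inter>{H. submodule H k M \<and> S \<subseteq> H}"

text \<open>The quotient \<open>S / N\<close> of submodules \<open>N \<subseteq> S\<close> of \<open>M\<close>. A module record carries
  ring multiplication and unit as fields, which play no role in a module and are left
  unspecified.\<close>

definition subquot :: "('k, 'v, 'm) module_scheme \<Rightarrow> 'v set \<Rightarrow> 'v set \<Rightarrow> ('k, 'v set) module" where
  "subquot M S N = \<lparr>
     carrier = {N +>\<^bsub>M\<^esub> s | s. s \<in> S}, mult = undefined, one = undefined,
     zero = N, add = (<+>\<^bsub>M\<^esub>),
     smult = (\<lambda>c Y. \<Union>x\<in>Y. N +>\<^bsub>M\<^esub> (c \<odot>\<^bsub>M\<^esub> x))\<rparr>"

definition module_iso ::
  "('k, 'r) ring_scheme \<Rightarrow> ('k, 'v, 'm) module_scheme \<Rightarrow> ('k, 'w, 'n) module_scheme \<Rightarrow> bool" where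
  "module_iso k M N \<longleftrightarrow> (\<exists>h. bij_betw h (carrier M) (carrier N) \<and>
     (\<forall>x\<in>carrier M. \<forall>y\<in>carrier M. h (x \<oplus>\<^bsub>M\<^esub> y) = h x \<oplus>\<^bsub>N\<^esub> h y) \<and>
     (\<forall>c\<in>carrier k. \<forall>x\<in>carrier M. h (c \<odot>\<^bsub>M\<^esub> x) = c \<odot>\<^bsub>N\<^esub> h x))"

definition free_mod :: "('k, 'r) ring_scheme \<Rightarrow> 'g set \<Rightarrow> ('k, 'g \<Rightarrow> 'k) module" where
  "free_mod k G = \<lparr>
     carrier = {u. (\<forall>g. u g \<in> carrier k) \<and> (\<forall>g. g \<notin> G \<longrightarrow> u g = \<zero>\<^bsub>k\<^esub>) \<and>
                   finite {g. u g \<noteq> \<zero>\<^bsub>k\<^esub>}},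
     mult = undefined, one = undefined,
     zero = (\<lambda>g. \<zero>\<^bsub>k\<^esub>), add = (\<lambda>u v g. u g \<oplus>\<^bsub>k\<^esub> v g),
     smult = (\<lambda>c u g. c \<otimes>\<^bsub>k\<^esub> u g)\<rparr>"

definition free_gen :: "('k, 'r) ring_scheme \<Rightarrow> 'g \<Rightarrow> ('g \<Rightarrow> 'k)" where
  "free_gen k g = (\<lambda>h. if h = g then \<one>\<^bsub>k\<^esub> else \<zero>\<^bsub>k\<^esub>)"


section \<open>Monogenic extensions\<close>

text \<open>The Ore extension \<open>K[x,\<alpha>]\<close> with relation \<open>x\<lambda> = \<alpha>(\<lambda>)x\<close>: a polynomial \<open>p\<close> stands for
  the sum of the \<open>p\<^sub>i x\<^sup>i\<close>, coefficients on the left, so that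
  \<open>(a x\<^sup>i)(b x\<^sup>j) = a \<alpha>\<^sup>i(b) x\<^sup>i\<^sup>+\<^sup>j\<close>.\<close>

definition ore_ext :: "('k, 'a, 'm) module_scheme \<Rightarrow> ('a \<Rightarrow> 'a) \<Rightarrow> ('k, nat \<Rightarrow> 'a) module" where
  "ore_ext K \<alpha> = \<lparr>
     carrier = up K,
     mult = (\<lambda>p q n. \<Oplus>\<^bsub>K\<^esub>i\<in>{..n}. p i \<otimes>\<^bsub>K\<^esub> (\<alpha> ^^ i) (q (n - i))),
     one = (\<lambda>i. if i = 0 then \<one>\<^bsub>K\<^esub> else \<zero>\<^bsub>K\<^esub>),
     zero = (\<lambda>i. \<zero>\<^bsub>K\<^esub>),
     add = (\<lambda>p q i. p i \<oplus>\<^bsub>K\<^esub> q i),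
     smult = (\<lambda>c p i. c \<odot>\<^bsub>K\<^esub> p i)\<rparr>"

definition ore_const :: "('a, 'm) ring_scheme \<Rightarrow> 'a \<Rightarrow> nat \<Rightarrow> 'a" where
  "ore_const K a = (\<lambda>i. if i = 0 then a else \<zero>\<^bsub>K\<^esub>)"

definition ore_var :: "('a, 'm) ring_scheme \<Rightarrow> nat \<Rightarrow> 'a" where
  "ore_var K = (\<lambda>i. if i = 1 then \<one>\<^bsub>K\<^esub> else \<zero>\<^bsub>K\<^esub>)"

definition monogenic_poly ::
  "('k, 'a, 'm) module_scheme \<Rightarrow> ('a \<Rightarrow> 'a) \<Rightarrow> nat \<Rightarrow> (nat \<Rightarrow> 'a) \<Rightarrow> nat \<Rightarrow> 'a" where
  "monogenic_poly K \<alpha> n l =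
     (\<Oplus>\<^bsub>ore_ext K \<alpha>\<^esub>i\<in>{..n}.
        ore_const K (l i) \<otimes>\<^bsub>ore_ext K \<alpha>\<^esub> (ore_var K [^]\<^bsub>ore_ext K \<alpha>\<^esub> (n - i)))"

text \<open>The quotient ring \<open>B Quot I\<close> together with the induced scalar multiplication.\<close>

definition quot_algebra :: "('k, 'b, 'm) module_scheme \<Rightarrow> 'b set \<Rightarrow> ('k, 'b set) module" where
  "quot_algebra B I = \<lparr>
     carrier = carrier (B Quot I), mult = mult (B Quot I), one = one (B Quot I),
     zero = zero (B Quot I), add = add (B Quot I),
     smult = (\<lambda>c Y. \<Union>x\<in>Y. I +>\<^bsub>B\<^esub> (c \<odot>\<^bsub>B\<^esub> x))\<rparr>"

definition monogenic_ideal ::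
  "('k, 'a, 'm) module_scheme \<Rightarrow> ('a \<Rightarrow> 'a) \<Rightarrow> nat \<Rightarrow> (nat \<Rightarrow> 'a) \<Rightarrow> (nat \<Rightarrow> 'a) set" where
  "monogenic_ideal K \<alpha> n l = Idl\<^bsub>ore_ext K \<alpha>\<^esub> {monogenic_poly K \<alpha> n l}"

definition monogenic_ext ::
  "('k, 'a, 'm) module_scheme \<Rightarrow> ('a \<Rightarrow> 'a) \<Rightarrow> nat \<Rightarrow> (nat \<Rightarrow> 'a) \<Rightarrow> ('k, (nat \<Rightarrow> 'a) set) module" where
  "monogenic_ext K \<alpha> n l = quot_algebra (ore_ext K \<alpha>) (monogenic_ideal K \<alpha> n l)"

definition monogenic_const ::
  "('k, 'a, 'm) module_scheme \<Rightarrow> ('a \<Rightarrow> 'a) \<Rightarrow> nat \<Rightarrow> (nat \<Rightarrow> 'a) \<Rightarrow> 'a \<Rightarrow> (nat \<Rightarrow> 'a) set" where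
  "monogenic_const K \<alpha> n l a = monogenic_ideal K \<alpha> n l +>\<^bsub>ore_ext K \<alpha>\<^esub> ore_const K a"

definition monogenic_var ::
  "('k, 'a, 'm) module_scheme \<Rightarrow> ('a \<Rightarrow> 'a) \<Rightarrow> nat \<Rightarrow> (nat \<Rightarrow> 'a) \<Rightarrow> (nat \<Rightarrow> 'a) set" where
  "monogenic_var K \<alpha> n l = monogenic_ideal K \<alpha> n l +>\<^bsub>ore_ext K \<alpha>\<^esub> ore_var K"

text \<open>The element \<open>a x\<^sup>n\<^sup>-\<^sup>1\<close> of the monogenic extension.\<close>

definition monogenic_top ::
  "('k, 'a, 'm) module_scheme \<Rightarrow> ('a \<Rightarrow> 'a) \<Rightarrow> nat \<Rightarrow> (nat \<Rightarrow> 'a) \<Rightarrow> 'a \<Rightarrow> (nat \<Rightarrow> 'a) set" where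
  "monogenic_top K \<alpha> n l a = (let A = monogenic_ext K \<alpha> n l in
     monogenic_const K \<alpha> n l a \<otimes>\<^bsub>A\<^esub> (monogenic_var K \<alpha> n l [^]\<^bsub>A\<^esub> (n - 1)))"

definition norm_sum :: "('a, 'm) ring_scheme \<Rightarrow> ('a \<Rightarrow> 'a) \<Rightarrow> nat \<Rightarrow> 'a \<Rightarrow> 'a" where
  "norm_sum K \<alpha> n a = (\<Oplus>\<^bsub>K\<^esub>j\<in>{..<n}. (\<alpha> ^^ j) a)"

definition diff_mult :: "('a, 'm) ring_scheme \<Rightarrow> ('a \<Rightarrow> 'a) \<Rightarrow> 'a \<Rightarrow> 'a \<Rightarrow> 'a" where
  "diff_mult K \<alpha> c a = (\<alpha> a \<ominus>\<^bsub>K\<^esub> a) \<otimes>\<^bsub>K\<^esub> c"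

definition twisted_comm ::
  "('k, 'r) ring_scheme \<Rightarrow> ('k, 'a, 'm) module_scheme \<Rightarrow> ('a \<Rightarrow> 'a) \<Rightarrow> nat \<Rightarrow> 'a set" where
  "twisted_comm k K \<alpha> j = span_mod k K
     {(b \<otimes>\<^bsub>K\<^esub> (\<alpha> ^^ j) a) \<ominus>\<^bsub>K\<^esub> (a \<otimes>\<^bsub>K\<^esub> b) | a b. a \<in> carrier K \<and> b \<in> carrier K}"


section \<open>Relative Hochschild homology\<close>

text \<open>Throughout, \<open>A\<close> is a \<open>k\<close>-algebra, viewed as a \<open>K\<close>-bimodule through an algebra
  homomorphism \<open>\<iota> : K \<rightarrow> A\<close>, and \<open>A / \<iota>(K)\<close> is its quotient bimodule. The \<open>k\<close>-module
  \<open>A \<otimes>\<^sub>K (A/K) \<otimes>\<^sub>K \<dots> \<otimes>\<^sub>K (A/K) \<otimes>\<close> with \<open>r\<close> factors \<open>A/K\<close> is presented as the free \<open>k\<close>-module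
  on the set \<open>A \<times> (A/K)\<^sup>r\<close> modulo multilinearity over \<open>k\<close>, balancing over \<open>K\<close> between
  neighbouring factors and balancing between the last and the first factor. The last one
  is the passage from a bimodule \<open>N\<close> to its quotient by all \<open>m\<lambda> - \<lambda>m\<close>.\<close>

definition tuples :: "('c, 'm) ring_scheme \<Rightarrow> nat \<Rightarrow> 'c list set" where
  "tuples A r = {xs. set xs \<subseteq> carrier A \<and> length xs = Suc r}"

definition reduce ::
  "('a, 'm) ring_scheme \<Rightarrow> ('c, 'n) ring_scheme \<Rightarrow> ('a \<Rightarrow> 'c) \<Rightarrow> 'c list \<Rightarrow> 'c \<times> 'c set list" where
  "reduce K A \<iota> xs = (hd xs, map (\<lambda>a. (\<iota> ` carrier K) +>\<^bsub>A\<^esub> a) (tl xs))"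

abbreviation hoch_free ::
  "('k, 'r) ring_scheme \<Rightarrow> ('a, 'm) ring_scheme \<Rightarrow> ('c, 'n) ring_scheme \<Rightarrow> ('a \<Rightarrow> 'c) \<Rightarrow> nat \<Rightarrow>
   ('k, 'c \<times> 'c set list \<Rightarrow> 'k) module" where
  "hoch_free k K A \<iota> r \<equiv> free_mod k (reduce K A \<iota> ` tuples A r)"

abbreviation tens ::
  "('k, 'r) ring_scheme \<Rightarrow> ('a, 'm) ring_scheme \<Rightarrow> ('c, 'n) ring_scheme \<Rightarrow> ('a \<Rightarrow> 'c) \<Rightarrow>
   'c list \<Rightarrow> ('c \<times> 'c set list \<Rightarrow> 'k)" where
  "tens k K A \<iota> xs \<equiv> free_gen k (reduce K A \<iota> xs)"

text \<open>In the last set the neighbour of position \<open>i\<close> is taken cyclically; for \<open>r = 0\<close> it is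
  position \<open>0\<close> itself and the relation reads \<open>a\<lambda> - \<lambda>a\<close>.\<close>

definition hoch_rels ::
  "('k, 'r) ring_scheme \<Rightarrow> ('a, 'm) ring_scheme \<Rightarrow> ('k, 'c, 'n) module_scheme \<Rightarrow> ('a \<Rightarrow> 'c) \<Rightarrow> nat \<Rightarrow>
   ('c \<times> 'c set list \<Rightarrow> 'k) set" where
  "hoch_rels k K A \<iota> r = (let F = hoch_free k K A \<iota> r; t = tens k K A \<iota> in
     {t (xs[i := a \<oplus>\<^bsub>A\<^esub> b]) \<ominus>\<^bsub>F\<^esub> (t (xs[i := a]) \<oplus>\<^bsub>F\<^esub> t (xs[i := b])) | xs i a b.
        xs \<in> tuples A r \<and> i \<le> r \<and> a \<in> carrier A \<and> b \<in> carrier A}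
     \<union> {t (xs[i := c \<odot>\<^bsub>A\<^esub> a]) \<ominus>\<^bsub>F\<^esub> (c \<odot>\<^bsub>F\<^esub> t (xs[i := a])) | xs i a c.
        xs \<in> tuples A r \<and> i \<le> r \<and> a \<in> carrier A \<and> c \<in> carrier k}
     \<union> {t (xs[i := xs ! i \<otimes>\<^bsub>A\<^esub> \<iota> y]) \<ominus>\<^bsub>F\<^esub> t (xs[j := \<iota> y \<otimes>\<^bsub>A\<^esub> xs ! j]) | xs i j y.
        xs \<in> tuples A r \<and> i \<le> r \<and> j = Suc i mod Suc r \<and> y \<in> carrier K})"

definition hoch_null ::
  "('k, 'r) ring_scheme \<Rightarrow> ('a, 'm) ring_scheme \<Rightarrow> ('k, 'c, 'n) module_scheme \<Rightarrow> ('a \<Rightarrow> 'c) \<Rightarrow> nat \<Rightarrow>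
   ('c \<times> 'c set list \<Rightarrow> 'k) set" where
  "hoch_null k K A \<iota> r = span_mod k (hoch_free k K A \<iota> r) (hoch_rels k K A \<iota> r)"

definition hoch_chain ::
  "('k, 'r) ring_scheme \<Rightarrow> ('a, 'm) ring_scheme \<Rightarrow> ('k, 'c, 'n) module_scheme \<Rightarrow> ('a \<Rightarrow> 'c) \<Rightarrow> nat \<Rightarrow>
   ('k, ('c \<times> 'c set list \<Rightarrow> 'k) set) module" where
  "hoch_chain k K A \<iota> r =
     subquot (hoch_free k K A \<iota> r) (carrier (hoch_free k K A \<iota> r)) (hoch_null k K A \<iota> r)"

text \<open>\<open>(a\<^sub>0,\<dots>,a\<^sub>r) \<mapsto> (a\<^sub>0,\<dots>,a\<^sub>i a\<^sub>i\<^sub>+\<^sub>1,\<dots>,a\<^sub>r)\<close> for \<open>i < r\<close>, and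
  \<open>(a\<^sub>0,\<dots>,a\<^sub>r) \<mapsto> (a\<^sub>r a\<^sub>0,a\<^sub>1,\<dots>,a\<^sub>r\<^sub>-\<^sub>1)\<close> for \<open>i = r\<close>; used for \<open>r \<ge> 1\<close>.\<close>

definition hoch_face :: "('c, 'n) ring_scheme \<Rightarrow> nat \<Rightarrow> nat \<Rightarrow> 'c list \<Rightarrow> 'c list" where
  "hoch_face A r i xs =
     (if i < r then take i xs @ [xs ! i \<otimes>\<^bsub>A\<^esub> xs ! Suc i] @ drop (i + 2) xs
      else (last xs \<otimes>\<^bsub>A\<^esub> hd xs) # butlast (tl xs))"

definition hoch_bdry_tuple ::
  "('k, 'r) ring_scheme \<Rightarrow> ('a, 'm) ring_scheme \<Rightarrow> ('k, 'c, 'n) module_scheme \<Rightarrow> ('a \<Rightarrow> 'c) \<Rightarrow> nat \<Rightarrow>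
   'c list \<Rightarrow> ('c \<times> 'c set list \<Rightarrow> 'k)" where
  "hoch_bdry_tuple k K A \<iota> r xs = (\<Oplus>\<^bsub>hoch_free k K A \<iota> (r - 1)\<^esub>i\<in>{..r}.
     ((\<ominus>\<^bsub>k\<^esub> \<one>\<^bsub>k\<^esub>) [^]\<^bsub>k\<^esub> i) \<odot>\<^bsub>hoch_free k K A \<iota> (r - 1)\<^esub> tens k K A \<iota> (hoch_face A r i xs))"

text \<open>The boundary lifted to free modules. It chooses a tuple of representatives in \<open>A\<close> for
  each generator in \<open>A \<times> (A/K)\<^sup>r\<close>; modulo \<^const>\<open>hoch_null\<close> the value does not depend on
  that choice, although the individual faces do.\<close>

definition hoch_bdry_free ::
  "('k, 'r) ring_scheme \<Rightarrow> ('a, 'm) ring_scheme \<Rightarrow> ('k, 'c, 'n) module_scheme \<Rightarrow> ('a \<Rightarrow> 'c) \<Rightarrow> nat \<Rightarrow>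
   ('c \<times> 'c set list \<Rightarrow> 'k) \<Rightarrow> ('c \<times> 'c set list \<Rightarrow> 'k)" where
  "hoch_bdry_free k K A \<iota> r u = (\<Oplus>\<^bsub>hoch_free k K A \<iota> (r - 1)\<^esub>g\<in>{g. u g \<noteq> \<zero>\<^bsub>k\<^esub>}.
     u g \<odot>\<^bsub>hoch_free k K A \<iota> (r - 1)\<^esub>
       hoch_bdry_tuple k K A \<iota> r (SOME xs. xs \<in> tuples A r \<and> reduce K A \<iota> xs = g))"

text \<open>\<open>b : C\<^sub>r \<rightarrow> C\<^sub>r\<^sub>-\<^sub>1\<close> for \<open>r \<ge> 1\<close>.\<close>

definition hoch_bdry ::
  "('k, 'r) ring_scheme \<Rightarrow> ('a, 'm) ring_scheme \<Rightarrow> ('k, 'c, 'n) module_scheme \<Rightarrow> ('a \<Rightarrow> 'c) \<Rightarrow> nat \<Rightarrow>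
   ('c \<times> 'c set list \<Rightarrow> 'k) set \<Rightarrow> ('c \<times> 'c set list \<Rightarrow> 'k) set" where
  "hoch_bdry k K A \<iota> r Y =
     (\<Union>u\<in>Y. hoch_null k K A \<iota> (r - 1) +>\<^bsub>hoch_free k K A \<iota> (r - 1)\<^esub> hoch_bdry_free k K A \<iota> r u)"

definition hoch_cycles ::
  "('k, 'r) ring_scheme \<Rightarrow> ('a, 'm) ring_scheme \<Rightarrow> ('k, 'c, 'n) module_scheme \<Rightarrow> ('a \<Rightarrow> 'c) \<Rightarrow> nat \<Rightarrow>
   ('c \<times> 'c set list \<Rightarrow> 'k) set set" where
  "hoch_cycles k K A \<iota> r =
     (if r = 0 then carrier (hoch_chain k K A \<iota> 0)
      else {Y \<in> carrier (hoch_chain k K A \<iota> r).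
              hoch_bdry k K A \<iota> r Y = \<zero>\<^bsub>hoch_chain k K A \<iota> (r - 1)\<^esub>})"

definition hoch_homology ::
  "('k, 'r) ring_scheme \<Rightarrow> ('a, 'm) ring_scheme \<Rightarrow> ('k, 'c, 'n) module_scheme \<Rightarrow> ('a \<Rightarrow> 'c) \<Rightarrow> nat \<Rightarrow>
   ('k, ('c \<times> 'c set list \<Rightarrow> 'k) set set) module" where
  "hoch_homology k K A \<iota> r =
     subquot (hoch_chain k K A \<iota> r) (hoch_cycles k K A \<iota> r)
       (hoch_bdry k K A \<iota> (Suc r) ` carrier (hoch_chain k K A \<iota> (Suc r)))"

abbreviation HH_monogenic ::
  "('k, 'r) ring_scheme \<Rightarrow> ('k, 'a, 'm) module_scheme \<Rightarrow> ('a \<Rightarrow> 'a) \<Rightarrow> nat \<Rightarrow> (nat \<Rightarrow> 'a) \<Rightarrow> nat \<Rightarrow>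
   ('k, ((nat \<Rightarrow> 'a) set \<times> (nat \<Rightarrow> 'a) set set list \<Rightarrow> 'k) set set) module" where
  "HH_monogenic k K \<alpha> n l r \<equiv>
     hoch_homology k K (monogenic_ext K \<alpha> n l) (monogenic_const K \<alpha> n l) r"

end

theory Submission
  imports Defs "HOL.Modules" "HOL-Algebra.Free_Abelian_Groups"
begin

text \<open>Comparing \<open>\<lambda>\<^sub>i u = \<alpha>\<^sup>i(u) \<lambda>\<^sub>i\<close> with the centrality of \<open>u\<close> shows that
  \<open>u - \<alpha>\<^sup>i(u)\<close> annihilates \<open>\<lambda>\<^sub>i\<close>; as it is a unit for \<open>0 < i < n\<close>, all middle coefficients of \<open>f\<close>
  vanish (\<open>l_middle\<close>). So \<open>A = K[x,\<alpha>]/(x\<^sup>n - c)\<close> with \<open>c = -\<lambda>\<^sub>n\<close>, an \<open>\<alpha>\<close>-invariant element with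
  \<open>c a = \<alpha>\<^sup>n(a) c\<close>, and \<open>A\<close> is free over \<open>K\<close> on \<open>1, x, \<dots>, x\<^sup>n\<^sup>-\<^sup>1\<close>. The same unit gives
  \<open>K = [K,K]\<^bsub>\<alpha>\<^sup>T\<^esub>\<close> whenever \<open>n\<close> does not divide \<open>T\<close> (\<open>TC_top\<close>).

  Moving all coefficients to the front, a Hochschild chain is a sum of symbols
  \<open>\<langle>a; e; w\<^sub>1, \<dots>, w\<^sub>r\<rangle> = a x\<^sup>e \<otimes> x\<^bsup>w\<^sub>1\<^esup> \<otimes> \<dots> \<otimes> x\<^bsup>w\<^sub>r\<^esup>\<close>. Carrying a scalar once around the
  cyclic tensor product twists it by \<open>\<alpha>\<^sup>T\<close>, where \<open>T = e + w\<^sub>1 + \<dots> + w\<^sub>r\<close> is the weight; hence the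
  chain module of degree \<open>r\<close> is the direct sum of the groups \<open>K/[K,K]\<^bsub>\<alpha>\<^sup>T\<^esub>\<close> over all symbols with
  \<open>0 \<le> e < n\<close> and \<open>0 < w\<^sub>i < n\<close>. Only weights divisible by \<open>n\<close> survive.

  On symbols the complex is periodic. Write \<open>X\<^sub>s\<close> for multiplication of the first factor by \<open>x\<^sup>s\<close>
  and \<open>P\<^sub>w\<close> for the insertion of a factor \<open>x\<^sup>w\<close> behind it. The map \<open>F\<close> that sends \<open>y\<close> to the sum
  of all \<open>X\<^bsub>n-1-j\<^esub> P\<^sub>1 P\<^sub>j y\<close>, \<open>0 < j < n\<close>, raises the degree by two and the weight by \<open>n\<close>. It has
  a left inverse \<open>P\<close>, commutes with the boundary in positive degrees (\<open>D_F\<close>), and \<open>F P\<close> is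
  homotopic to the identity in degrees at least two (\<open>homotopy\<close>). Thus cycles and boundaries in degree
  \<open>r + 2m\<close> are those in degree \<open>r\<close> with all weights raised by \<open>m n\<close>, and only low degrees remain.
  There the surviving classes are represented by \<open>\<langle>a; 0\<rangle>\<close> and \<open>\<langle>a; n-1; 1\<rangle>\<close>. The boundary of
  \<open>\<langle>a; n-1; 1\<rangle>\<close> is \<open>\<langle>ac - \<alpha>(a)c; 0\<rangle>\<close>, that of \<open>F\<langle>a; 0\<rangle>\<close> is
  \<open>\<langle>a + \<alpha>(a) + \<dots> + \<alpha>\<^sup>n\<^sup>-\<^sup>1(a); n-1; 1\<rangle>\<close>; these two maps produce the three quotients.

  The argument is carried out in an abstract complex of symbols (locale \<open>cyclic_complex\<close>). An additive
  map \<open>phi\<close> from symbols onto Hochschild chains commutes with the boundaries (\<open>phi_D\<close>), is surjective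
  (\<open>phi_surj\<close>), and kills exactly the relations between symbols (\<open>phi_eq_zero_iff\<close>), so that the
  result carries over.\<close>


section \<open>Chains of symbols\<close>

type_synonym 'a formal_sum = "'a \<Rightarrow>\<^sub>0 int"

text \<open>A triple \<open>(a, e, W)\<close> stands for the symbol \<open>\<langle>a; e; W\<rangle>\<close>.\<close>

type_synonym 'a chain = "('a \<times> nat \<times> nat list) \<Rightarrow>\<^sub>0 int"

lemma frag_all_induct [case_names zero of diff]:
  assumes "P 0" "\<And>x. P (frag_of x)" "\<And>a b. P a \<Longrightarrow> P b \<Longrightarrow> P (a - b)"
  shows "P (z :: 'b formal_sum)"
  by (rule frag_induction[where S = UNIV]) (use assms in auto)

lemma additive_frag_extend: "Modules.additive (frag_extend f)"
  by unfold_locales (rule frag_extend_add)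

text \<open>The elementary operations on formal sums of scalars and of symbols; in the notation of the
  introduction \<open>shift s\<close> is \<open>X\<^sub>s\<close> and \<open>insert_pow w\<close> is \<open>P\<^sub>w\<close>.\<close>

definition push :: "('a \<Rightarrow> 'a) \<Rightarrow> 'a formal_sum \<Rightarrow> 'a formal_sum" where
  "push g = frag_extend (\<lambda>a. frag_of (g a))"

definition place :: "nat \<Rightarrow> nat list \<Rightarrow> 'a formal_sum \<Rightarrow> 'a chain" where
  "place e W = frag_extend (\<lambda>a. frag_of (a, e, W))"

definition shift :: "nat \<Rightarrow> 'a chain \<Rightarrow> 'a chain" where
  "shift s = frag_extend (\<lambda>(a, e, W). frag_of (a, e + s, W))"

definition insert_pow :: "nat \<Rightarrow> 'a chain \<Rightarrow> 'a chain" where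
  "insert_pow w = frag_extend (\<lambda>(a, e, W). frag_of (a, e, w # W))"

definition map_coef :: "('a \<Rightarrow> 'a) \<Rightarrow> 'a chain \<Rightarrow> 'a chain" where
  "map_coef g = frag_extend (\<lambda>(a, e, W). frag_of (g a, e, W))"

interpretation push: Modules.additive "push g" for g
  unfolding push_def by (rule additive_frag_extend)
interpretation place: Modules.additive "place e W" for e W
  unfolding place_def by (rule additive_frag_extend)
interpretation shift: Modules.additive "shift s" for s
  unfolding shift_def by (rule additive_frag_extend)
interpretation insert_pow: Modules.additive "insert_pow w" for w
  unfolding insert_pow_def by (rule additive_frag_extend)
interpretation map_coef: Modules.additive "map_coef g" for g
  unfolding map_coef_def by (rule additive_frag_extend)

lemmas frag_additive =
  push.zero push.add push.diff push.minus push.sum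
  place.zero place.add place.diff place.minus place.sum
  shift.zero shift.add shift.diff shift.minus shift.sum
  insert_pow.zero insert_pow.add insert_pow.diff insert_pow.minus insert_pow.sum
  map_coef.zero map_coef.add map_coef.diff map_coef.minus map_coef.sum

declare frag_additive [simp]

lemma frag_ops_of [simp]:
  "push g (frag_of a) = frag_of (g a)"
  "place e W (frag_of a) = frag_of (a, e, W)"
  "shift s (frag_of (a, e, W)) = frag_of (a, e + s, W)"
  "insert_pow w (frag_of (a, e, W)) = frag_of (a, e, w # W)"
  "map_coef g (frag_of (a, e, W)) = frag_of (g a, e, W)"
  by (simp_all add: push_def place_def shift_def insert_pow_def map_coef_def)

lemma chain_induct [case_names zero of diff]:
  assumes "P 0" "\<And>a e W. P (frag_of (a, e, W))" "\<And>a b. P a \<Longrightarrow> P b \<Longrightarrow> P (a - b)"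
  shows "P (z :: 'a chain)"
  by (rule frag_all_induct) (use assms in auto)

lemma shift_shift [simp]: "shift s (shift t z) = shift (s + t) z"
  by (induction z rule: chain_induct) (auto simp: ac_simps)
lemma shift_0 [simp]: "shift 0 z = z"
  by (induction z rule: chain_induct) auto
lemma shift_insert_pow: "shift s (insert_pow w z) = insert_pow w (shift s z)"
  by (induction z rule: chain_induct) auto
lemma map_coef_shift: "map_coef g (shift s z) = shift s (map_coef g z)"
  by (induction z rule: chain_induct) auto
lemma map_coef_insert_pow: "map_coef g (insert_pow w z) = insert_pow w (map_coef g z)"
  by (induction z rule: chain_induct) auto
lemma shift_place [simp]: "shift s (place e W q) = place (e + s) W q"
  by (induction q rule: frag_all_induct) auto
lemma insert_pow_place [simp]: "insert_pow w (place e W q) = place e (w # W) q"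
  by (induction q rule: frag_all_induct) auto
lemma map_coef_place [simp]: "map_coef g (place e W q) = place e W (push g q)"
  by (induction q rule: frag_all_induct) auto
lemma push_push: "push g (push h q) = push (\<lambda>a. g (h a)) q"
  by (induction q rule: frag_all_induct) auto
lemma push_id [simp]: "push (\<lambda>a. a) q = q"
  by (induction q rule: frag_all_induct) auto

lemma diff_add_swap: "(a + c) - (b + d) = (a - b) + (c - d)" for a :: "'b :: ab_group_add"
  by (simp add: algebra_simps)

section \<open>The complex of symbols\<close>

text \<open>What the argument uses of \<open>K\<close>: \<open>tw s\<close> is \<open>\<alpha>\<^sup>s\<close>, \<open>mc\<close> is multiplication by \<open>c\<close>, and \<open>Q T\<close>
  consists of the formal sums of scalars with value in \<open>[K,K]\<^bsub>\<alpha>\<^sup>T\<^esub>\<close>. The law \<open>Q_rot\<close> says that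
  \<open>a c\<close> and \<open>c a = \<alpha>\<^sup>n(a) c\<close> agree modulo twisted commutators, \<open>Q_top\<close> is the contribution
  of \<open>u\<close>.\<close>

locale cyclic_complex =
  fixes n :: nat and tw :: "nat \<Rightarrow> 'a \<Rightarrow> 'a" and mc :: "'a \<Rightarrow> 'a" and Q :: "nat \<Rightarrow> 'a formal_sum set"
  assumes n_ge_2: "2 \<le> n"
    and tw_0: "tw 0 a = a" and tw_tw: "tw s (tw t a) = tw (s + t) a"
    and mc_tw: "mc (tw s a) = tw s (mc a)"
    and Q_0: "0 \<in> Q T" and Q_diff: "x \<in> Q T \<Longrightarrow> y \<in> Q T \<Longrightarrow> x - y \<in> Q T"
    and Q_tw: "x \<in> Q T \<Longrightarrow> push (tw s) x \<in> Q T"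
    and Q_mc: "x \<in> Q (T + n) \<Longrightarrow> push mc x \<in> Q T"
    and Q_rot: "frag_of (mc a) - frag_of (mc (tw n a)) \<in> Q T"
    and Q_top: "\<not> n dvd T \<Longrightarrow> x \<in> Q T"
begin

text \<open>The relations between symbols: scalars matter only modulo the twisted commutators of the
  weight of the symbol, \<open>x\<^sup>n = c\<close> holds in the first and in every other factor, and \<open>x\<^sup>0\<close> vanishes
  in \<open>A/K\<close>. The weight is increased by an offset: it accounts for factors that have been split off,
  so that inserting \<open>x\<^sup>w\<close> turns relations of offset \<open>t + w\<close> into relations of offset \<open>t\<close>. Offset
  \<open>0\<close> describes the Hochschild complex.\<close>

inductive_set R :: "nat \<Rightarrow> 'a chain set" for o' :: nat where
  zero: "0 \<in> R o'"
| diff: "x \<in> R o' \<Longrightarrow> y \<in> R o' \<Longrightarrow> x - y \<in> R o'"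
| coef: "q \<in> Q (e + sum_list W + o') \<Longrightarrow> place e W q \<in> R o'"
| head: "frag_of (a, e + n, W) - frag_of (mc a, e, W) \<in> R o'"
| entry: "frag_of (a, e, U @ (w + n) # V) - frag_of (mc a, e, U @ w # V) \<in> R o'"
| null: "frag_of (a, e, U @ 0 # V) \<in> R o'"

lemma R_minus: "x \<in> R t \<Longrightarrow> - x \<in> R t"
  using R.diff[OF R.zero] by fastforce
lemma R_minus_iff [simp]: "- x \<in> R t \<longleftrightarrow> x \<in> R t"
  using R_minus by fastforce
lemma R_add: "x \<in> R t \<Longrightarrow> y \<in> R t \<Longrightarrow> x + y \<in> R t"
  using R.diff[OF _ R_minus] by fastforce
lemma R_sum: "(\<And>i. i \<in> I \<Longrightarrow> g i \<in> R t) \<Longrightarrow> sum g I \<in> R t"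
  by (induction I rule: infinite_finite_induct) (auto intro: R.zero R_add)

lemma R_shift: "x \<in> R (t + s) \<Longrightarrow> shift s x \<in> R t"
proof (induction x rule: R.induct)
  case (coef q e W)
  then show ?case by (simp add: R.coef ac_simps)
next
  case (head a e W)
  then show ?case using R.head[of a "e + s" W t] by (simp add: ac_simps)
qed (auto intro: R.intros)

lemma R_insert_pow: "x \<in> R (t + w) \<Longrightarrow> insert_pow w x \<in> R t"
proof (induction x rule: R.induct)
  case (coef q e W)
  then show ?case by (simp add: R.coef ac_simps)
next
  case (entry a e U w' V)
  then show ?case using R.entry[of a e "w # U" w' V t] by simp
next
  case (null a e U V)
  then show ?case using R.null[of a e "w # U" V t] by simp
qed (auto intro: R.intros)

definition C :: "'a chain \<Rightarrow> 'a chain" where "C = map_coef mc"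

interpretation C: Modules.additive C unfolding C_def by unfold_locales simp

lemma C_of [simp]: "C (frag_of (a, e, W)) = frag_of (mc a, e, W)" by (simp add: C_def)
lemma C_insert_pow: "C (insert_pow s z) = insert_pow s (C z)"
  by (simp add: C_def map_coef_insert_pow)

lemma R_C: "x \<in> R (t + n) \<Longrightarrow> C x \<in> R t"
proof (induction x rule: R.induct)
  case (coef q e W)
  have "q \<in> Q ((e + sum_list W + t) + n)" using coef by (simp add: ac_simps)
  from Q_mc[OF this] show ?case by (simp add: C_def R.coef ac_simps)
qed (auto simp: C_def intro: R.intros)

lemma shift_n: "shift (s + n) y - shift s (C y) \<in> R t"
proof (induction y rule: chain_induct)
  case (of a e W)
  then show ?case using R.head[of a "e + s" W t] by (simp add: ac_simps)
next
  case (diff a b)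
  from R.diff[OF diff] show ?case by (simp add: C.diff algebra_simps)
qed (simp add: R.zero C.zero)

lemma insert_pow_n: "insert_pow (w + n) y - insert_pow w (C y) \<in> R t"
proof (induction y rule: chain_induct)
  case (of a e W)
  then show ?case using R.entry[of a e "[]" w W t] by simp
next
  case (diff a b)
  from R.diff[OF diff] show ?case by (simp add: C.diff algebra_simps)
qed (simp add: R.zero C.zero)

lemma insert_pow_0: "insert_pow 0 y \<in> R t"
proof (induction y rule: chain_induct)
  case (of a e W)
  then show ?case using R.null[of a e "[]" W t] by simp
qed (auto intro: R.zero R.diff)

lemma insert_pow_n_null: "insert_pow n y \<in> R t"
  using R_add[OF insert_pow_n[of 0 y t] insert_pow_0[of "C y" t]] by simp

subsection \<open>The boundary\<close>

text \<open>All faces except the one that multiplies the first factor by the second, with their signs.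
  The last one moves \<open>x\<^sup>w\<close> around to the front, \<open>x\<^sup>w a x\<^sup>e = \<alpha>\<^sup>w(a) x\<^bsup>w+e\<^esup>\<close>.\<close>

fun inner_faces :: "'a \<Rightarrow> nat \<Rightarrow> nat list \<Rightarrow> 'a chain" where
  "inner_faces a e [] = 0"
| "inner_faces a e [w] = - frag_of (tw w a, e + w, [])"
| "inner_faces a e (w # w' # W) =
     - frag_of (a, e, (w + w') # W) - insert_pow w (inner_faces a e (w' # W))"

definition bdry0 :: "'a \<Rightarrow> nat \<Rightarrow> nat list \<Rightarrow> 'a chain" where
  "bdry0 a e W = (case W of [] \<Rightarrow> 0 | w # W' \<Rightarrow> frag_of (a, e + w, W')) + inner_faces a e W"

definition D' :: "'a chain \<Rightarrow> 'a chain" where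
  "D' = frag_extend (\<lambda>(a, e, W). inner_faces a e W)"
definition D :: "'a chain \<Rightarrow> 'a chain" where
  "D = frag_extend (\<lambda>(a, e, W). bdry0 a e W)"

interpretation D': Modules.additive D' unfolding D'_def by (rule additive_frag_extend)
interpretation D: Modules.additive D unfolding D_def by (rule additive_frag_extend)

lemma D'_of [simp]: "D' (frag_of (a, e, W)) = inner_faces a e W" by (simp add: D'_def)
lemma D_of [simp]: "D (frag_of (a, e, W)) = bdry0 a e W" by (simp add: D_def)

text \<open>This lemma and the next one are the form in which the boundary is used:
  \<open>D P\<^sub>w = X\<^sub>w + D' P\<^sub>w\<close> and \<open>D' P\<^sub>w P\<^sub>v = - P\<^bsub>w+v\<^esub> - P\<^sub>w D' P\<^sub>v\<close>.\<close>

lemma D_insert: "D (insert_pow w y) = shift w y + D' (insert_pow w y)"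
  by (induction y rule: chain_induct)
     (auto simp: D.zero D'.zero D.diff D'.diff bdry0_def algebra_simps)

lemma D'_insert_insert:
  "D' (insert_pow w (insert_pow w' y)) = - insert_pow (w + w') y - insert_pow w (D' (insert_pow w' y))"
  by (induction y rule: chain_induct)
     (auto simp: D'.zero D'.diff)

lemma shift_inner_faces: "shift s (inner_faces a e W) = inner_faces a (e + s) W"
  by (induction a e W rule: inner_faces.induct) (auto simp: shift_insert_pow ac_simps)
lemma D_shift: "D (shift s y) = shift s (D y)"
  by (induction y rule: chain_induct)
     (auto simp: D.zero D.diff bdry0_def shift_inner_faces ac_simps split: list.splits)
lemma C_inner_faces: "C (inner_faces a e W) = inner_faces (mc a) e W"
  by (induction a e W rule: inner_faces.induct) 
    (auto simp: C.zero C.minus C.diff C_insert_pow mc_tw)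

lemma place_D':
  "q \<in> Q (e + sum_list W + t) \<Longrightarrow> frag_extend (\<lambda>a. inner_faces a e W) q \<in> R t"
proof (induction W arbitrary: t)
  case (Cons w W)
  show ?case
  proof (cases W)
    case Nil
    have "frag_extend (\<lambda>a. inner_faces a e [w]) q = - place (e + w) [] (push (tw w) q)"
      by (induction q rule: frag_all_induct) (auto simp: frag_extend_diff)
    moreover have "place (e + w) [] (push (tw w) q) \<in> R t"
      using Cons.prems Nil by (auto intro!: R.coef Q_tw simp: ac_simps)
    ultimately show ?thesis using Nil by simp
  next
    case (Cons w' W')
    have "frag_extend (\<lambda>a. inner_faces a e (w # w' # W')) q =
       - place e ((w + w') # W') q - insert_pow w (frag_extend (\<lambda>a. inner_faces a e (w' # W')) q)"
      by (induction q rule: frag_all_induct) (auto simp: frag_extend_diff)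
    moreover have "frag_extend (\<lambda>a. inner_faces a e (w' # W')) q \<in> R (t + w)"
      using Cons.IH[of "t + w"] Cons.prems Cons by (simp add: ac_simps)
    moreover have "place e ((w + w') # W') q \<in> R t"
      using Cons.prems Cons by (auto intro!: R.coef simp: ac_simps)
    ultimately show ?thesis using Cons by (auto intro: R.diff R_insert_pow)
  qed
qed (auto intro: R.zero simp: frag_extend_eq_0)

text \<open>The factor \<open>c\<close> extracted from \<open>x\<^bsup>w+n\<^esup>\<close> passes through every face. If that factor is the last
  one, the face moving it to the front produces \<open>c\<close> on the other side of \<open>\<alpha>\<^sup>w(a)\<close>; this is where
  \<open>Q_rot\<close> enters.\<close>

lemma entry_D': "inner_faces a e (U @ (w + n) # V) - inner_faces (mc a) e (U @ w # V) \<in> R t"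
proof (induction U arbitrary: t)
  case Nil
  show ?case
  proof (cases V)
    case Nil
    let ?b = "tw w a"
    have tn: "tw (w + n) a = tw n ?b" by (simp add: tw_tw ac_simps)
    have 1: "frag_of (tw n ?b, (e + w) + n, []) - frag_of (mc (tw n ?b), e + w, []) \<in> R t"
      by (rule R.head)
    have "place (e + w) [] (frag_of (mc ?b) - frag_of (mc (tw n ?b))) \<in> R t"
      by (rule R.coef) (rule Q_rot)
    then have 2: "frag_of (mc ?b, e + w, []) - frag_of (mc (tw n ?b), e + w, []) \<in> R t"
      by simp
    from R.diff[OF 2 1] show ?thesis using Nil tn by (simp add: mc_tw ac_simps)
  next
    case (Cons v V')
    have 1: "frag_of (a, e, [] @ ((w + v) + n) # V') - frag_of (mc a, e, [] @ (w + v) # V') \<in> R t"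
      by (rule R.entry)
    have 2: "insert_pow (w + n) (inner_faces a e (v # V'))
      - insert_pow w (C (inner_faces a e (v # V'))) \<in> R t" by (rule insert_pow_n)
    from R_minus[OF R_add[OF 1 2]] show ?thesis using Cons
      by (simp add: C_inner_faces algebra_simps)
  qed
next
  case (Cons u U)
  show ?case
  proof (cases U)
    case Nil
    have 1: "frag_of (a, e, [] @ ((u + w) + n) # V) - frag_of (mc a, e, [] @ (u + w) # V) \<in> R t"
      by (rule R.entry)
    from R_minus[OF R_add[OF 1 R_insert_pow[OF Cons.IH[of "t + u"]]]] show ?thesis
      using Nil by (simp add: algebra_simps)
  next
    case (Cons u' U')
    have 1: "frag_of (a, e, ((u + u') # U') @ (w + n) # V)
        - frag_of (mc a, e, ((u + u') # U') @ w # V) \<in> R t" by (rule R.entry)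
    from R_minus[OF R_add[OF 1 R_insert_pow[OF Cons.IH[of "t + u"]]]] show ?thesis
      using Cons by (simp add: algebra_simps)
  qed
qed

lemma bdry0_null_head: "bdry0 a e (0 # V) \<in> R t"
proof (cases V)
  case Nil then show ?thesis by (simp add: bdry0_def tw_0 R.zero)
next
  case (Cons v V')
  then show ?thesis by (simp add: bdry0_def insert_pow_0)
qed

text \<open>The two faces merging an entry \<open>x\<^sup>0\<close> with its neighbours cancel, and all other faces retain
  that entry.\<close>

lemma inner_faces_null: "inner_faces a e (u # U @ 0 # V) \<in> R t"
proof (induction U arbitrary: t u)
  case Nil
  have "inner_faces a e (u # [] @ 0 # V) = - insert_pow u (bdry0 a e (0 # V))"
    by (simp add: bdry0_def)
  then show ?case using R_insert_pow[OF bdry0_null_head[of a e V "t + u"]] by simp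
next
  case (Cons u' U)
  from R.null[of a e "(u + u') # U" V t] R_insert_pow[OF Cons.IH[of u' "t + u"]]
  show ?case by (simp add: R.diff)
qed

lemma R_D: "x \<in> R t \<Longrightarrow> D x \<in> R t"
proof (induction x rule: R.induct)
  case (coef q e W)
  have "D (place e W q) = (case W of [] \<Rightarrow> 0 | w # W' \<Rightarrow> place (e + w) W' q)
      + frag_extend (\<lambda>a. inner_faces a e W) q"
    by (induction q rule: frag_all_induct)
       (auto simp: D.zero D.diff bdry0_def frag_extend_diff split: list.splits)
  moreover have "(case W of [] \<Rightarrow> 0 | w # W' \<Rightarrow> place (e + w) W' q) \<in> R t"
    using coef by (auto split: list.splits intro!: R.zero R.coef simp: ac_simps)
  ultimately show ?case using coef place_D' by (auto intro: R_add)
next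
  case (head a e W)
  have 1: "(case W of [] \<Rightarrow> 0 | w # W' \<Rightarrow> frag_of (a, (e + w) + n, W'))
     - (case W of [] \<Rightarrow> 0 | w # W' \<Rightarrow> frag_of (mc a, e + w, W')) \<in> R t"
    by (auto split: list.splits intro!: R.zero R.head)
  have "inner_faces a (e + n) W - inner_faces (mc a) e W \<in> R t"
    using shift_n[of 0 "inner_faces a e W" t] by (simp add: shift_inner_faces C_inner_faces)
  from R_add[OF 1 this] show ?case
    by (simp add: D.diff bdry0_def diff_add_swap add.assoc add.commute[of n] cong: list.case_cong)
next
  case (entry a e U w V)
  have 1: "(case U @ (w + n) # V of [] \<Rightarrow> 0 | w # W' \<Rightarrow> frag_of (a, e + w, W'))
     - (case U @ w # V of [] \<Rightarrow> 0 | w # W' \<Rightarrow> frag_of (mc a, e + w, W')) \<in> R t"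
    using R.head[of a "e + w" V t] R.entry[of a _ _ w V t]
    by (cases U) (simp_all add: add.assoc)
  from R_add[OF this entry_D'] show ?case
    by (simp add: D.diff bdry0_def diff_add_swap)
next
  case (null a e U V)
  show ?case
  proof (cases U)
    case Nil then show ?thesis by (simp add: bdry0_null_head)
  next
    case (Cons u U')
    with R_add[OF R.null[of a "e + u" U' V t] inner_faces_null[of a e u U' V t]]
    show ?thesis by (simp add: bdry0_def)
  qed
qed (auto simp: D.zero D.diff intro: R.zero R.diff)

subsection \<open>The boundary squares to zero\<close>

definition len :: "nat \<Rightarrow> 'a chain set" where
  "len r = {z. Poly_Mapping.keys z \<subseteq> {(a, e, W). length W = r}}"

lemma len_induct [consumes 1, case_names zero of diff]:
  assumes "z \<in> len r" "P 0" "\<And>a e W. length W = r \<Longrightarrow> P (frag_of (a, e, W))"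
    "\<And>a b. P a \<Longrightarrow> P b \<Longrightarrow> P (a - b)"
  shows "P z"
  by (rule frag_induction[where S = "{(a, e, W). length W = r}"]) (use assms in \<open>auto simp: len_def\<close>)

lemma len_0 [simp]: "0 \<in> len r" by (simp add: len_def)
lemma len_diff: "x \<in> len r \<Longrightarrow> y \<in> len r \<Longrightarrow> x - y \<in> len r"
  using keys_diff[of x y] by (auto simp: len_def)
lemma len_minus: "x \<in> len r \<Longrightarrow> - x \<in> len r"
  using len_diff[OF len_0] by fastforce
lemma len_add: "x \<in> len r \<Longrightarrow> y \<in> len r \<Longrightarrow> x + y \<in> len r"
  using len_diff[OF _ len_minus] by fastforce
lemma len_sum: "(\<And>i. i \<in> I \<Longrightarrow> g i \<in> len t) \<Longrightarrow> sum g I \<in> len t"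
  by (induction I rule: infinite_finite_induct) (auto intro: len_add)
lemma len_of [simp]: "frag_of (a, e, W) \<in> len r \<longleftrightarrow> length W = r"
  by (simp add: len_def)
lemma len_place: "length W = r \<Longrightarrow> place e W q \<in> len r"
  by (induction q rule: frag_all_induct) (auto intro: len_diff)
lemma len_shift: "z \<in> len r \<Longrightarrow> shift s z \<in> len r"
  by (induction z rule: len_induct) (auto intro: len_diff)
lemma len_insert_pow: "z \<in> len r \<Longrightarrow> insert_pow s z \<in> len (Suc r)"
  by (induction z rule: len_induct) (auto intro: len_diff)
lemma len_inner_faces: "length W = Suc r \<Longrightarrow> inner_faces a e W \<in> len r"
proof (induction W arbitrary: r)
  case (Cons w W)
  then show ?case by (cases W) (auto intro!: len_minus len_diff len_insert_pow)
qed simp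
lemma len_D: "z \<in> len (Suc r) \<Longrightarrow> D z \<in> len r"
  by (induction z rule: len_induct)
    (auto simp: D.zero D.diff bdry0_def length_Suc_conv intro!: len_diff len_add len_inner_faces)
lemma D_len_0: "z \<in> len 0 \<Longrightarrow> D z = 0"
  by (induction z rule: len_induct) (auto simp: D.zero D.diff bdry0_def)

lemma len_Suc_insert:
  assumes "z \<in> len (Suc r)"
    and "\<And>w y. y \<in> len r \<Longrightarrow> P (insert_pow w y)" "\<And>a b. P a \<Longrightarrow> P b \<Longrightarrow> P (a - b)"
  shows "P z"
  using assms(1)
proof (induction z rule: len_induct)
  case zero
  show ?case using assms(2)[of 0] by simp
next
  case (of a e W)
  then obtain w W' where "W = w # W'" "length W' = r" by (auto simp: length_Suc_conv)
  then show ?case using assms(2)[of "frag_of (a, e, W')" w] by simp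
qed (use assms(3) in auto)

text \<open>Merging \<open>x\<^sup>w\<close> into the first inserted factor: it expresses \<open>D' P\<^sub>w\<close> through \<open>D'\<close> without knowing
  the first factor of the argument.\<close>

definition merge :: "nat \<Rightarrow> 'a chain \<Rightarrow> 'a chain" where
  "merge w = frag_extend (\<lambda>(a, e, W). case W of [] \<Rightarrow> 0 | w' # W' \<Rightarrow> frag_of (a, e, (w + w') # W'))"

interpretation merge: additive "merge w" for w
  unfolding merge_def by (rule additive_frag_extend)

lemma merge_insert [simp]: "merge w (insert_pow w' y) = insert_pow (w + w') y"
  by (induction y rule: chain_induct) (auto simp: merge.zero merge.diff merge_def frag_extend_diff)

lemma D'_insert:
  assumes "y \<in> len (Suc r)"
  shows "D' (insert_pow w y) = - merge w y - insert_pow w (D' y)"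
  using assms by (rule len_Suc_insert)
    (auto simp: D'_insert_insert D'.diff merge.diff)

lemma merge_D'_insert:
  "y \<in> len (Suc r) \<Longrightarrow> merge w (D' (insert_pow w' y)) = D' (insert_pow (w + w') y)"
proof (erule len_Suc_insert)
  fix v z assume "z \<in> len r"
  show "merge w (D' (insert_pow w' (insert_pow v z))) = D' (insert_pow (w + w') (insert_pow v z))"
    by (simp add: D'_insert_insert merge.diff merge.minus add.assoc)
qed (simp add: D'.diff merge.diff)

lemma len_D': "z \<in> len (Suc r) \<Longrightarrow> D' z \<in> len r"
  by (induction z rule: len_induct)
    (auto simp: D'.zero D'.diff Suc_length_conv intro!: len_diff len_add len_inner_faces)

lemma D'_D': "y \<in> len (Suc r) \<Longrightarrow> D' (D' y) = 0"
proof (induction r arbitrary: y)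
  case 0
  have "D' x = 0" if "x \<in> len 0" for x
    using that by (induction x rule: len_induct) (auto simp: D'.zero D'.diff)
  then show ?case using len_D'[OF 0] by blast
next
  case (Suc r)
  from Suc.prems show ?case
  proof (rule len_Suc_insert)
    fix w y assume y: "y \<in> len (Suc r)"
    show "D' (D' (insert_pow w y)) = 0"
    proof (cases r)
      case 0
      with y have "y \<in> len (Suc 0)" by simp
      then show ?thesis
      proof (rule len_Suc_insert)
        fix w' y assume "y \<in> len 0"
        then show "D' (D' (insert_pow w (insert_pow w' y))) = 0"
          by (induction y rule: len_induct)
            (auto simp: D'.zero D'.diff D'.minus tw_tw ac_simps)
      qed (simp add: D'.diff)
    next
      case (Suc r')
      have 1: "D' y \<in> len (Suc r')" using len_D'[OF y] Suc by simp
      have "D' (D' (insert_pow w y)) = - D' (merge w y) - D' (insert_pow w (D' y))"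
        using D'_insert[OF y] by (simp add: D'.diff D'.minus)
      also have "D' (insert_pow w (D' y)) = - merge w (D' y) - insert_pow w (D' (D' y))"
        by (rule D'_insert[OF 1])
      also have "D' (D' y) = 0" by (rule Suc.IH[OF y])
      also have "merge w (D' y) = D' (merge w y)"
        using y
      proof (rule len_Suc_insert)
        fix v z assume "z \<in> len r"
        then show "merge w (D' (insert_pow v z)) = D' (merge w (insert_pow v z))"
          using merge_D'_insert[of z r'] Suc by simp
      qed (simp add: merge.diff D'.diff)
      finally show ?thesis by simp
    qed
  qed (simp add: D'.diff)
qed

lemma D_D: "D (D z) = 0"
proof -
  have main: "D (D y) = 0" if "y \<in> len (Suc (Suc r))" for y r
    using that
  proof (rule len_Suc_insert)
    fix w y assume y: "y \<in> len (Suc r)"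
    then have wy: "insert_pow w y \<in> len (Suc (Suc r))" by (rule len_insert_pow)
    have DM: "D (merge w y) = shift w (D y - D' y) + D' (merge w y)"
      using y
    proof (rule len_Suc_insert)
      fix v z
      show "D (merge w (insert_pow v z)) =
        shift w (D (insert_pow v z) - D' (insert_pow v z)) + D' (merge w (insert_pow v z))"
        by (simp add: D_insert)
    qed (simp add: D.diff D'.diff merge.diff)
    have "D (D' (insert_pow w y)) = - D (merge w y) - D (insert_pow w (D' y))"
      using D'_insert[OF y] by (simp add: D.diff D.minus)
    also have "\<dots> = - shift w (D y) - (D' (merge w y) + D' (insert_pow w (D' y)))"
      by (simp add: DM D_insert)
    also have "D' (merge w y) + D' (insert_pow w (D' y)) = - D' (D' (insert_pow w y))"
      using D'_insert[OF y] by (simp add: D'.diff D'.minus)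
    also have "\<dots> = 0" using D'_D'[OF wy] by simp
    finally show "D (D (insert_pow w y)) = 0" by (simp add: D_insert D.add D_shift)
  qed (simp add: D.diff)
  show ?thesis
  proof (induction z rule: chain_induct)
    case (of a e W)
    consider "length W = 0" | "length W = 1" | r where "length W = Suc (Suc r)"
      by (metis One_nat_def not0_implies_Suc)
    then show ?case
    proof cases
      case 2
      then show ?thesis by (auto simp: length_Suc_conv bdry0_def D.diff D.zero D.minus)
    next
      case 3 then show ?thesis using main[of "frag_of (a, e, W)"] by simp
    qed (auto simp: bdry0_def D.zero)
  qed (auto simp: D.zero D.diff)
qed


subsection \<open>The periodicity map, its left inverse and the homotopy\<close>

lemma map_coef_pow_R: "x \<in> R (t + k * n) \<Longrightarrow> map_coef (mc ^^ k) x \<in> R t"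
proof (induction k arbitrary: t)
  case 0
  have "map_coef (\<lambda>a. a) x = x" by (induction x rule: chain_induct) auto
  then show ?case using 0 by (simp add: id_def)
next
  case (Suc k)
  then have "x \<in> R ((t + n) + k * n)" by (simp add: ac_simps)
  then have "C (map_coef (mc ^^ k) x) \<in> R t" using Suc.IH R_C by blast
  moreover have "C (map_coef (mc ^^ k) x) = map_coef (mc ^^ Suc k) x"
    by (induction x rule: chain_induct) (auto simp: C_def)
  ultimately show ?case by (simp add: o_def)
qed

lemma map_coef_id [simp]: "map_coef id x = x"
  by (induction x rule: chain_induct) auto

text \<open>A map that is additive and vanishes on symbols without tensor factors respects the relations as
  soon as it does so for relations behind the first inserted factor and for the two relations at that
  factor. It is applied to \<open>H\<close> and, twice in a row, to \<open>P\<close>.\<close>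

lemma R_preserve:
  assumes "Modules.additive F" and "\<And>a e. F (frag_of (a, e, [])) = 0"
    and "\<And>i y. y \<in> R (t + i) \<Longrightarrow> F (insert_pow i y) \<in> R t'"
    and "\<And>a e w V. F (frag_of (a, e, (w + n) # V)) - F (frag_of (mc a, e, w # V)) \<in> R t'"
    and "\<And>a e V. F (frag_of (a, e, 0 # V)) \<in> R t'"
    and "x \<in> R t"
  shows "F x \<in> R t'"
proof -
  interpret F: Modules.additive F by fact
  show ?thesis using assms(6)
  proof (induction x rule: R.induct)
    case (coef q e W)
    show ?case
    proof (cases W)
      case Nil
      have "F (place e [] q) = 0"
        by (induction q rule: frag_all_induct) (auto simp: F.zero F.diff assms(2))
      then show ?thesis using Nil by (simp add: R.zero)
    next
      case (Cons i W')
      have "place e W' q \<in> R (t + i)" using coef Cons by (auto intro!: R.coef simp: ac_simps)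
      from assms(3)[OF this] show ?thesis using Cons by simp
    qed
  next
    case (head a e W)
    show ?case
    proof (cases W)
      case (Cons i W')
      from assms(3)[OF R.head[of a e W' "t + i"]] show ?thesis using Cons by simp
    qed (simp add: F.diff assms(2) R.zero)
  next
    case (entry a e U w V)
    show ?case
    proof (cases U)
      case (Cons i U')
      from assms(3)[OF R.entry[of a e U' w V "t + i"]] show ?thesis using Cons by simp
    qed (simp add: F.diff assms(4))
  next
    case (null a e U V)
    show ?case
    proof (cases U)
      case (Cons i U')
      from assms(3)[OF R.null[of a e U' V "t + i"]] show ?thesis using Cons by simp
    qed (simp add: assms(5))
  qed (auto simp: F.zero F.diff intro: R.zero R.diff)
qed

text \<open>The chain that splits \<open>x\<^sup>m\<close> into single factors \<open>x\<close>: as \<open>D(P\<^sub>1 P\<^sub>j y)\<close> begins with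
  \<open>X\<^sub>1 P\<^sub>j y - P\<^bsub>j+1\<^esub> y\<close>, its boundary telescopes to \<open>X\<^bsub>m-1\<^esub> P\<^sub>1 y - P\<^sub>m y\<close> up to terms in
  which only \<open>y\<close> is changed.\<close>

definition split_chain :: "nat \<Rightarrow> 'a chain \<Rightarrow> 'a chain" where
  "split_chain m y = (\<Sum>j = 1..<m. shift (m - 1 - j) (insert_pow 1 (insert_pow j y)))"

interpretation split_chain: additive "split_chain m" for m
  unfolding split_chain_def by unfold_locales (simp add: sum.distrib)

lemma split_chain_shift: "split_chain m (shift s y) = shift s (split_chain m y)"
  by (simp add: split_chain_def shift_insert_pow[symmetric] ac_simps)

lemma R_split_chain: "y \<in> R (t + m) \<Longrightarrow> split_chain m y \<in> R t"
proof -
  assume y: "y \<in> R (t + m)"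
  show ?thesis unfolding split_chain_def
  proof (rule R_sum)
    fix j assume "j \<in> {1..<m}"
    then have "t + m = t + (m - 1 - j) + 1 + j" by auto
    then show "shift (m - 1 - j) (insert_pow 1 (insert_pow j y)) \<in> R t"
      using y R_shift R_insert_pow by metis
  qed
qed

lemma len_split_chain: "y \<in> len r \<Longrightarrow> split_chain m y \<in> len (r + 2)"
  by (auto simp: split_chain_def intro!: len_sum len_shift len_insert_pow)

definition F :: "'a chain \<Rightarrow> 'a chain" where "F = split_chain n"

interpretation F: additive F
  unfolding F_def by (rule split_chain.additive_axioms)

text \<open>The homotopy splits the first inserted factor \<open>x\<^sup>i\<close>. Splitting \<open>x\<^bsup>i+n\<^esup>\<close> and splitting \<open>x\<^sup>i\<close> after
  extraction of \<open>c\<close> differ, so the exponent is reduced modulo \<open>n\<close> first; this makes the relations for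
  \<open>x\<^sup>n = c\<close> hold on the nose.\<close>

definition H :: "'a chain \<Rightarrow> 'a chain" where
  "H = frag_extend (\<lambda>(a, e, W). case W of [] \<Rightarrow> 0
     | i # W' \<Rightarrow> - split_chain (i mod n) (map_coef (mc ^^ (i div n)) (frag_of (a, e, W'))))"

interpretation H: additive H unfolding H_def by (rule additive_frag_extend)

lemma H_insert: "H (insert_pow i y) = - split_chain (i mod n) (map_coef (mc ^^ (i div n)) y)"
proof (induction y rule: chain_induct)
  case (of a e W) show ?case by (simp add: H_def)
qed (simp_all add: H.zero H.diff split_chain.zero split_chain.diff)
lemma H_insert_less: "i < n \<Longrightarrow> H (insert_pow i y) = - split_chain i y"
  by (simp add: H_insert)

lemma H_shift: "H (shift s y) = shift s (H y)"
proof (induction y rule: chain_induct)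
  case (of a e W)
  show ?case
    by (cases W) (auto simp: H_def split_chain_shift[symmetric])
qed (simp_all add: H.zero H.diff)

lemma len_H: "z \<in> len (Suc r) \<Longrightarrow> H z \<in> len (Suc (Suc r))"
proof (erule len_Suc_insert)
  fix w y assume "y \<in> len r"
  moreover from this have "map_coef g y \<in> len r" for g
    by (induction y rule: len_induct) (auto intro: len_diff)
  ultimately show "H (insert_pow w y) \<in> len (Suc (Suc r))"
    using len_split_chain by (simp add: H_insert len_minus)
qed (simp add: H.diff len_diff)

lemma R_H: "x \<in> R t \<Longrightarrow> H x \<in> R t"
proof (rule R_preserve[of H t t])
  fix i y assume "y \<in> R (t + i)"
  then have "y \<in> R ((t + i mod n) + i div n * n)" by (simp add: add.assoc)
  from R_split_chain[OF map_coef_pow_R[OF this]] show "H (insert_pow i y) \<in> R t"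
    by (simp add: H_insert)
next
  fix a e w V
  have "H (frag_of (a, e, (w + n) # V)) = H (frag_of (mc a, e, w # V))"
    using n_ge_2 by (simp add: H_def funpow_swap1)
  then show "H (frag_of (a, e, (w + n) # V)) - H (frag_of (mc a, e, w # V)) \<in> R t"
    by (simp add: R.zero)
qed (auto simp: H_def split_chain_def R.zero H.additive_axioms[unfolded H_def])

text \<open>The left inverse of \<open>F\<close> multiplies the first two inserted factors and records the carry: \<open>x\<^sup>i\<close>,
  \<open>x\<^sup>w\<close> with \<open>i, w < n\<close> are traded for \<open>x\<^bsup>i+w-n\<^esup>\<close>, or for \<open>0\<close> if there is no carry.\<close>

definition P :: "'a chain \<Rightarrow> 'a chain" where
  "P = frag_extend (\<lambda>(a, e, W). case W of i # w # W' \<Rightarrow>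
     if n \<le> i mod n + w mod n
     then frag_of ((mc ^^ (i div n + w div n)) a, e + (i mod n + w mod n - n), W') else 0 | _ \<Rightarrow> 0)"

lemma P_of [simp]:
  "P (frag_of (a, e, [])) = 0" "P (frag_of (a, e, [i])) = 0"
  "P (frag_of (a, e, i # w # W)) = (if n \<le> i mod n + w mod n
     then frag_of ((mc ^^ (i div n + w div n)) a, e + (i mod n + w mod n - n), W) else 0)"
  by (simp_all add: P_def)

interpretation P: additive P unfolding P_def by (rule additive_frag_extend)

lemma P_insert: "P (insert_pow i (insert_pow w y)) = (if n \<le> i mod n + w mod n
   then shift (i mod n + w mod n - n) (map_coef (mc ^^ (i div n + w div n)) y) else 0)"
proof (induction y rule: chain_induct)
  case (of a e W) show ?case by (simp add: P_def)
qed (auto simp add: P.zero P.diff)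

lemma P_insert_less: "i < n \<Longrightarrow> w < n \<Longrightarrow> P (insert_pow i (insert_pow w y)) =
    (if n \<le> i + w then shift (i + w - n) y else 0)"
  by (simp add: P_insert)

lemma len_P: "z \<in> len (Suc (Suc r)) \<Longrightarrow> P z \<in> len r"
  by (induction z rule: len_induct)
    (auto simp: P.zero P.diff length_Suc_conv intro!: len_diff)

lemma R_P: "x \<in> R t \<Longrightarrow> P x \<in> R (t + n)"
proof (rule R_preserve[of P t "t + n"])
  fix i y assume y: "y \<in> R (t + i)"
  show "P (insert_pow i y) \<in> R (t + n)"
  proof (rule R_preserve[of "\<lambda>y. P (insert_pow i y)", OF _ _ _ _ _ y])
    show "Modules.additive (\<lambda>y. P (insert_pow i y))"
      by unfold_locales (simp add: P.add)
    fix w z assume z: "z \<in> R (t + i + w)"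
    show "P (insert_pow i (insert_pow w z)) \<in> R (t + n)"
    proof (cases "n \<le> i mod n + w mod n")
      case True
      define s where "s = i mod n + w mod n - n"
      let ?k = "i div n + w div n"
      have 1: "i mod n + w mod n = n + s" using True by (simp add: s_def)
      have "t + i + w = t + (i mod n + w mod n) + ?k * n"
        by (simp add: add_mult_distrib)
      also have "\<dots> = ((t + n) + s) + ?k * n"
        unfolding 1 by (simp only: add.assoc)
      finally have "z \<in> R (((t + n) + s) + ?k * n)" using z by (simp only:)
      from R_shift[OF map_coef_pow_R[OF this]] True show ?thesis
        by (simp add: P_insert s_def)
    qed (simp add: P_insert R.zero)
  next
    fix a e w V
    show "P (insert_pow i (frag_of (a, e, (w + n) # V))) - P (insert_pow i (frag_of (mc a, e, w # V))) \<in> R (t + n)"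
      using n_ge_2 by (simp add: P_def funpow_swap1 R.zero)
  next
    fix a e V
    have "\<not> n \<le> i mod n" using n_ge_2 by (simp add: not_le)
    then show "P (insert_pow i (frag_of (a, e, 0 # V))) \<in> R (t + n)"
      by (simp add: P_def R.zero)
  qed (simp add: P_def)
next
  fix a e w V
  show "P (frag_of (a, e, (w + n) # V)) - P (frag_of (mc a, e, w # V)) \<in> R (t + n)"
    using n_ge_2 by (cases V) (auto simp add: P_def funpow_swap1 R.zero)
next
  fix a e V
  have "\<not> n \<le> w mod n" for w using n_ge_2 by (simp add: not_le)
  then show "P (frag_of (a, e, 0 # V)) \<in> R (t + n)"
    by (cases V) (auto simp add: P_def R.zero)
qed (auto simp: P_def R.zero P.additive_axioms[unfolded P_def])

lemma R_F: "x \<in> R (t + n) \<Longrightarrow> F x \<in> R t"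
  unfolding F_def by (rule R_split_chain)

lemma len_F: "x \<in> len r \<Longrightarrow> F x \<in> len (Suc (Suc r))"
  unfolding F_def using len_split_chain by fastforce

text \<open>Among the pairs \<open>x\<close>, \<open>x\<^sup>j\<close> occurring in \<open>F\<close> only \<open>j = n - 1\<close> has a carry, and its
  remainder is \<open>x\<^sup>0\<close>.\<close>

lemma P_F: "P (F z) = z"
proof -
  have "P (F z) = (\<Sum>j = 1..<n. P (shift (n - 1 - j) (insert_pow 1 (insert_pow j z))))"
    by (simp add: F_def split_chain_def P.sum)
  also have "\<dots> = (\<Sum>j = 1..<n. if j = n - 1 then z else 0)"
  proof (rule sum.cong)
    fix j assume j: "j \<in> {1..<n}"
    then have "P (insert_pow 1 (insert_pow j (shift (n - 1 - j) z))) = (if j = n - 1 then z else 0)"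
      using n_ge_2 by (subst P_insert_less) auto
    then show "P (shift (n - 1 - j) (insert_pow 1 (insert_pow j z))) = (if j = n - 1 then z else 0)"
      by (simp add: shift_insert_pow)
  qed simp
  also have "\<dots> = z" using n_ge_2 by (subst sum.delta) auto
  finally show ?thesis .
qed

lemma D_insert1_insert:
  "D (insert_pow (Suc 0) (insert_pow j y)) =
     insert_pow j (shift (Suc 0) y) - insert_pow (Suc j) y - insert_pow (Suc 0) (D' (insert_pow j y))"
  by (simp add: D_insert D'_insert_insert shift_insert_pow)

lemma D_split_chain:
  assumes "1 \<le> m"
  shows "D (split_chain m y) = shift (m - 1) (insert_pow 1 y) - insert_pow m y
     - (\<Sum>j = 1..<m. shift (m - 1 - j) (insert_pow 1 (D' (insert_pow j y))))"
proof -
  let ?A = "\<lambda>j. shift (m - j) (insert_pow j y)"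
  have "D (split_chain m y) = (\<Sum>j = 1..<m. (?A j - ?A (Suc j))
     - shift (m - 1 - j) (insert_pow 1 (D' (insert_pow j y))))"
    unfolding split_chain_def D.sum
  proof (rule sum.cong)
    fix j assume "j \<in> {1..<m}"
    then obtain q where "m = Suc (j + q)" using less_imp_Suc_add by auto
    then show "D (shift (m - 1 - j) (insert_pow 1 (insert_pow j y))) =
      (?A j - ?A (Suc j)) - shift (m - 1 - j) (insert_pow 1 (D' (insert_pow j y)))"
      by (simp add: D_shift D_insert1_insert shift_insert_pow[symmetric])
  qed simp
  also have "\<dots> = (\<Sum>j = 1..<m. ?A j - ?A (Suc j))
     - (\<Sum>j = 1..<m. shift (m - 1 - j) (insert_pow 1 (D' (insert_pow j y))))"
    by (rule sum_subtractf)
  also have "(\<Sum>j = 1..<m. ?A j - ?A (Suc j)) = ?A 1 - ?A m"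
    using sum_Suc_diff'[OF assms, of "\<lambda>j. - ?A j"] by simp
  finally show ?thesis by simp
qed

text \<open>The terms of \<open>D_split_chain\<close> that change \<open>y = P\<^sub>w z\<close> shift the index of the summands by \<open>w\<close>, so
  that together with the leading term they form a full range of length \<open>m\<close>.\<close>

lemma D_split_chain_insert:
  assumes "1 \<le> m"
  shows "D (split_chain m (insert_pow w y)) = - insert_pow m (insert_pow w y)
     + (\<Sum>j = w..<m + w. shift (m + w - 1 - j) (insert_pow 1 (insert_pow j y)))
     + split_chain m (D' (insert_pow w y))"
proof -
  let ?G = "\<lambda>j. shift (m + w - 1 - j) (insert_pow 1 (insert_pow j y))"
  have "(\<Sum>j = 1..<m. shift (m - 1 - j) (insert_pow 1 (D' (insert_pow j (insert_pow w y)))))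
    = - (\<Sum>j = 1..<m. ?G (j + w)) - split_chain m (D' (insert_pow w y))"
    by (simp add: D'_insert_insert split_chain_def sum_negf sum.distrib sum_subtractf)
  also have "(\<Sum>j = 1..<m. ?G (j + w)) = (\<Sum>j = 1 + w..<m + w. ?G j)"
    by (rule sum.shift_bounds_nat_ivl[symmetric])
  also have "\<dots> = (\<Sum>j = w..<m + w. ?G j) - ?G w"
    using assms by (simp add: sum.atLeast_Suc_lessThan)
  finally show ?thesis using assms
    by (simp add: D_split_chain algebra_simps del: One_nat_def)
qed

text \<open>A splitting sum continued beyond the index \<open>n\<close> starts anew with \<open>c\<close> extracted: the summand of
  index \<open>n\<close> vanishes, since \<open>x\<^sup>n = c\<close> lies in \<open>K\<close>.\<close>

lemma wrap_around:
  "(\<Sum>j = n..<n + s. shift (n + s - 1 - j) (insert_pow 1 (insert_pow j y)))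
      - split_chain s (C y) \<in> R t"
proof (cases s)
  case 0
  then show ?thesis by (simp add: split_chain_def R.zero)
next
  case (Suc s')
  let ?G = "\<lambda>j. shift (n + s - 1 - j) (insert_pow 1 (insert_pow j y))"
  have "(\<Sum>j = n..<n + s. ?G j) = ?G n + (\<Sum>j = 1 + n..<s + n. ?G j)"
    using Suc by (simp add: sum.atLeast_Suc_lessThan add.commute[of n])
  also have "(\<Sum>j = 1 + n..<s + n. ?G j) = (\<Sum>j = 1..<s. ?G (j + n))"
    by (rule sum.shift_bounds_nat_ivl)
  finally have "(\<Sum>j = n..<n + s. ?G j) - split_chain s (C y) =
     ?G n + (\<Sum>j = 1..<s. shift (s - 1 - j) (insert_pow 1
               (insert_pow (j + n) y - insert_pow j (C y))))"
    by (simp add: split_chain_def sum_subtractf)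
  moreover have "?G n \<in> R t"
    by (intro R_shift R_insert_pow insert_pow_n_null)
  moreover have "(\<Sum>j = 1..<s. shift (s - 1 - j) (insert_pow 1
               (insert_pow (j + n) y - insert_pow j (C y)))) \<in> R t"
    by (intro R_sum R_shift R_insert_pow insert_pow_n)
  ultimately show ?thesis by (simp add: R_add)
qed

text \<open>With \<open>G\<^sub>j = X\<^bsub>i+w-1-j\<^esub> P\<^sub>1 P\<^sub>j y\<close> one finds \<open>D H z + H D z = z - \<Sum>\<^bsub>0<j<i+w\<^esub> G\<^sub>j - H(P\<^bsub>i+w\<^esub> y)\<close>.
  Without a carry the last two terms cancel. With a carry, \<open>i + w = n + s\<close>, the summands with
  \<open>j < n\<close> form \<open>F P z\<close> and those with \<open>j \<ge> n\<close> cancel against \<open>H(P\<^bsub>n+s\<^esub> y)\<close> by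
  \<open>wrap_around\<close>.\<close>

lemma homotopy_basic:
  fixes y :: "'a chain"
  assumes "1 \<le> i" "i < n" "1 \<le> w" "w < n"
  defines "z \<equiv> insert_pow i (insert_pow w y)"
  shows "D (H z) + H (D z) - (z - F (P z)) \<in> R t"
proof -
  let ?G = "\<lambda>j. shift (i + w - 1 - j) (insert_pow 1 (insert_pow j y))"
  have DH: "D (H z) = z - (\<Sum>j = w..<i + w. ?G j) - split_chain i (D' (insert_pow w y))"
    using assms by (simp add: H_insert_less D_split_chain_insert D.minus)
  have E: "H (shift i (insert_pow w y)) = - (\<Sum>j = 1..<w. ?G j)"
  proof -
    have "H (shift i (insert_pow w y)) = - shift i (split_chain w y)"
      using assms by (simp add: H_shift H_insert_less)
    also have "shift i (split_chain w y) = (\<Sum>j = 1..<w. ?G j)"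
      unfolding split_chain_def shift.sum
      by (rule sum.cong) (auto simp del: One_nat_def)
    finally show ?thesis .
  qed
  have "D z = shift i (insert_pow w y) - insert_pow (i + w) y - insert_pow i (D' (insert_pow w y))"
    unfolding z_def by (simp add: D_insert D'_insert_insert)
  then have HD: "H (D z) = - (\<Sum>j = 1..<w. ?G j) - H (insert_pow (i + w) y)
       + split_chain i (D' (insert_pow w y))"
    using assms(2) by (simp add: H.diff E H_insert_less)
  have sum: "(\<Sum>j = 1..<w. ?G j) + (\<Sum>j = w..<i + w. ?G j) = (\<Sum>j = 1..<i + w. ?G j)"
    using assms by (intro sum.atLeastLessThan_concat) auto
  have eq: "D (H z) + H (D z) = z - (\<Sum>j = 1..<i + w. ?G j) - H (insert_pow (i + w) y)"
    unfolding DH HD sum[symmetric] by (simp add: algebra_simps)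
  show ?thesis
  proof (cases "i + w < n")
    case True
    then have "P z = 0" using assms by (simp add: P_insert_less)
    moreover have "H (insert_pow (i + w) y) = - (\<Sum>j = 1..<i + w. ?G j)"
      using True by (simp add: H_insert_less split_chain_def)
    ultimately show ?thesis using eq by (simp add: F.zero R.zero)
  next
    case False
    define s where "s = i + w - n"
    have s: "i + w = n + s" "s < n" using False assms by (auto simp: s_def)
    have Pz: "P z = shift s y" using assms s by (simp add: P_insert_less)
    have FP: "F (P z) = (\<Sum>j = 1..<n. ?G j)"
      unfolding Pz F_def split_chain_shift unfolding split_chain_def shift.sum s
      by (rule sum.cong) (auto simp: add.commute simp del: One_nat_def)
    have HH: "H (insert_pow (i + w) y) = - split_chain s (C y)"
      unfolding s(1) using s(2) by (simp add: H_insert C_def)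
    have W: "(\<Sum>j = n..<i + w. ?G j) - split_chain s (C y) \<in> R t"
      using wrap_around[of s y t] by (simp only: s(1))
    have sum': "(\<Sum>j = 1..<i + w. ?G j) = (\<Sum>j = 1..<n. ?G j) + (\<Sum>j = n..<i + w. ?G j)"
      using n_ge_2 False by (intro sum.atLeastLessThan_concat[symmetric]) auto
    have "D (H z) + H (D z) - (z - F (P z)) = - ((\<Sum>j = n..<i + w. ?G j) - split_chain s (C y))"
      unfolding eq FP HH sum' by (simp add: algebra_simps)
    then show ?thesis using R_minus[OF W] by (simp only:)
  qed
qed


lemma insert_pow_mod:
  "insert_pow w y - insert_pow (w mod n) (map_coef (mc ^^ (w div n)) y) \<in> R t"
proof -
  have "insert_pow (m + k * n) y - insert_pow m (map_coef (mc ^^ k) y) \<in> R t" for m k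
  proof (induction k arbitrary: m)
    case (Suc k)
    have "C (map_coef (mc ^^ k) y) = map_coef (mc ^^ Suc k) y"
      by (induction y rule: chain_induct) (auto simp: C_def)
    then have "insert_pow (m + n) (map_coef (mc ^^ k) y) - insert_pow m (map_coef (mc ^^ Suc k) y) \<in> R t"
      using insert_pow_n[of m "map_coef (mc ^^ k) y" t] by (simp only:)
    from R_add[OF Suc.IH[of "m + n"] this] show ?case by (simp add: ac_simps o_def)
  qed (simp add: R.zero)
  from this[of "w mod n" "w div n"] show ?thesis by simp
qed

lemma shift_mod:
  "shift w y - shift (w mod n) (map_coef (mc ^^ (w div n)) y) \<in> R t"
proof -
  have "shift (m + k * n) y - shift m (map_coef (mc ^^ k) y) \<in> R t" for m k
  proof (induction k arbitrary: m)
    case (Suc k)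
    have "C (map_coef (mc ^^ k) y) = map_coef (mc ^^ Suc k) y"
      by (induction y rule: chain_induct) (auto simp: C_def)
    then have "shift (m + n) (map_coef (mc ^^ k) y) - shift m (map_coef (mc ^^ Suc k) y) \<in> R t"
      using shift_n[of m "map_coef (mc ^^ k) y" t] by (simp only:)
    from R_add[OF Suc.IH[of "m + n"] this] show ?case by (simp add: ac_simps o_def)
  qed (simp add: R.zero)
  from this[of "w mod n" "w div n"] show ?thesis by simp
qed

lemma R_diff_iff: "x - y \<in> R t \<Longrightarrow> x \<in> R t \<longleftrightarrow> y \<in> R t"
  using R.diff[of x t "x - y"] R_add[of "x - y" t y] by auto

text \<open>Modulo the relations both exponents may be reduced modulo \<open>n\<close>, and a zero exponent makes the
  symbol trivial; this leaves the situation of \<open>homotopy_basic\<close>.\<close>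

lemma homotopy:
  assumes "z \<in> len (Suc (Suc r))"
  shows "D (H z) + H (D z) - (z - F (P z)) \<in> R t"
proof -
  define E where "E z = D (H z) + H (D z) - (z - F (P z))" for z
  have E_diff: "E (x - y) = E x - E y" for x y
    by (simp add: E_def D.diff H.diff P.diff F.diff)
  have E_R: "E x \<in> R t" if "x \<in> R t" for x
    unfolding E_def using that by (intro R.diff R_add R_D R_H R_F R_P)
  have E_cong: "E y \<in> R t \<Longrightarrow> E x \<in> R t" if "x - y \<in> R t" for x y
    using E_R[OF that] R_diff_iff by (simp add: E_diff)
  have "E z \<in> R t" using assms
  proof (rule len_Suc_insert)
    fix i u assume "u \<in> len (Suc r)"
    then show "E (insert_pow i u) \<in> R t"
    proof (rule len_Suc_insert)
      fix w y assume "y \<in> len r"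
      define y' where "y' = map_coef (mc ^^ (i div n)) (map_coef (mc ^^ (w div n)) y)"
      have 1: "insert_pow i (insert_pow w y) - insert_pow i (insert_pow (w mod n)
          (map_coef (mc ^^ (w div n)) y)) \<in> R t"
        using R_insert_pow[OF insert_pow_mod[of w y "t + i"]] by simp
      have 2: "insert_pow i (insert_pow (w mod n) (map_coef (mc ^^ (w div n)) y))
         - insert_pow (i mod n) (insert_pow (w mod n) y') \<in> R t"
        using insert_pow_mod[of i "insert_pow (w mod n) (map_coef (mc ^^ (w div n)) y)" t]
        by (simp add: y'_def map_coef_insert_pow)
      from R_add[OF 1 2]
      have 3: "insert_pow i (insert_pow w y) - insert_pow (i mod n) (insert_pow (w mod n) y') \<in> R t"
        by simp
      have "E (insert_pow (i mod n) (insert_pow (w mod n) y')) \<in> R t"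
      proof (cases "i mod n = 0 \<or> w mod n = 0")
        case True
        then have "insert_pow (i mod n) (insert_pow (w mod n) y') \<in> R t"
          using insert_pow_0 R_insert_pow by metis
        then show ?thesis by (rule E_R)
      next
        case False
        then show ?thesis unfolding E_def
          using n_ge_2 by (intro homotopy_basic) auto
      qed
      with 3 show "E (insert_pow i (insert_pow w y)) \<in> R t" by (rule E_cong)
    qed (simp add: insert_pow.diff E_diff R.diff)
  qed (simp add: E_diff R.diff)
  then show ?thesis by (simp add: E_def)
qed

text \<open>Up to a common term and a relation, both sides are sums of \<open>G\<^sub>j = X\<^bsub>n+w-1-j\<^esub> P\<^sub>1 P\<^sub>j y\<close>, over \<open>w \<le> j < n + w\<close> and over
  \<open>0 < j < n\<close>. The two differ by the part beyond \<open>n\<close> against the part before \<open>w\<close>, and each of these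
  is the splitting of \<open>x\<^sup>w\<close> with \<open>c\<close> extracted.\<close>

lemma D_F_basic:
  "D (F (insert_pow w y)) - F (D (insert_pow w y)) \<in> R t"
proof -
  let ?G = "\<lambda>j. shift (n + w - 1 - j) (insert_pow 1 (insert_pow j y))"
  have DF: "D (F (insert_pow w y)) = - insert_pow n (insert_pow w y)
     + (\<Sum>j = w..<n + w. ?G j) + split_chain n (D' (insert_pow w y))"
    unfolding F_def using n_ge_2 by (simp add: D_split_chain_insert)
  have FX: "F (shift w y) = (\<Sum>j = 1..<n. ?G j)"
    unfolding F_def split_chain_shift unfolding split_chain_def shift.sum
    by (rule sum.cong) (auto simp: add.commute simp del: One_nat_def)
  have FD: "F (D (insert_pow w y)) = (\<Sum>j = 1..<n. ?G j) + split_chain n (D' (insert_pow w y))"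
    by (simp add: D_insert F.add FX) (simp add: F_def)
  show ?thesis
  proof (cases "w = 0")
    case True
    have "insert_pow w y \<in> R (t + n)" using True insert_pow_0 by simp
    then have "F (insert_pow w y) \<in> R t" "F (D (insert_pow w y)) \<in> R t"
      by (auto intro: R_F R_D)
    then show ?thesis by (intro R.diff R_D)
  next
    case False
    have 1: "(\<Sum>j = 1..<w. ?G j) + (\<Sum>j = w..<n + w. ?G j) = (\<Sum>j = 1..<n + w. ?G j)"
      using False by (intro sum.atLeastLessThan_concat) auto
    have 2: "(\<Sum>j = 1..<n. ?G j) + (\<Sum>j = n..<n + w. ?G j) = (\<Sum>j = 1..<n + w. ?G j)"
      using n_ge_2 by (intro sum.atLeastLessThan_concat) auto
    have 3: "split_chain w (C y) - (\<Sum>j = 1..<w. ?G j) \<in> R t"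
    proof -
      have "split_chain w (C y) - (\<Sum>j = 1..<w. ?G j)
         = (\<Sum>j = 1..<w. - (shift ((w - 1 - j) + n) (insert_pow 1 (insert_pow j y))
               - shift (w - 1 - j) (C (insert_pow 1 (insert_pow j y)))))"
        unfolding split_chain_def sum_subtractf[symmetric]
        by (rule sum.cong) (auto simp: C_insert_pow add.commute simp del: One_nat_def)
      also have "\<dots> \<in> R t" by (intro R_sum R_minus shift_n)
      finally show ?thesis .
    qed
    have "D (F (insert_pow w y)) - F (D (insert_pow w y)) = - insert_pow n (insert_pow w y)
      + ((\<Sum>j = w..<n + w. ?G j) - (\<Sum>j = 1..<n. ?G j))"
      unfolding DF FD by simp
    also have "(\<Sum>j = w..<n + w. ?G j) - (\<Sum>j = 1..<n. ?G j)
      = (\<Sum>j = n..<n + w. ?G j) - (\<Sum>j = 1..<w. ?G j)"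
      using 1 2 by (simp add: algebra_simps del: One_nat_def)
    also have "\<dots> = ((\<Sum>j = n..<n + w. ?G j) - split_chain w (C y))
        + (split_chain w (C y) - (\<Sum>j = 1..<w. ?G j))" by simp
    finally show ?thesis
      using R_add[OF R_minus[OF insert_pow_n_null] R_add[OF wrap_around[of w y t] 3]] by simp
  qed
qed

lemma D_F: "z \<in> len (Suc r) \<Longrightarrow> D (F z) - F (D z) \<in> R t"
proof (erule len_Suc_insert)
  fix a b assume "D (F a) - F (D a) \<in> R t" "D (F b) - F (D b) \<in> R t"
  from R.diff[OF this] show "D (F (a - b)) - F (D (a - b)) \<in> R t"
    by (simp add: D.diff F.diff algebra_simps)
qed (rule D_F_basic)

definition norm_push :: "nat \<Rightarrow> 'a formal_sum \<Rightarrow> 'a formal_sum" where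
  "norm_push m q = (\<Sum>j < m. push (tw j) q)"

text \<open>In lowest degree the terms that change \<open>y\<close> move \<open>x\<^sup>j\<close> around to the front; they contribute the
  twisted copies \<open>\<alpha>\<^sup>j(a)\<close>, and a norm appears.\<close>

lemma D_split_place:
  assumes "1 \<le> m"
  shows "D (split_chain m (place e [] q)) = place (e + m - 1) [1] (norm_push m q) - place e [m] q"
proof -
  have D': "D' (place e [j] q) = - place (e + j) [] (push (tw j) q)" for j
    by (induction q rule: frag_all_induct) (auto simp: D'.zero D'.diff)
  have "(\<Sum>j = 1..<m. shift (m - 1 - j) (insert_pow 1 (D' (insert_pow j (place e [] q)))))
     = - (\<Sum>j = 1..<m. place (e + m - 1) [1] (push (tw j) q))"
    unfolding sum_negf[symmetric] by (rule sum.cong) (auto simp: D' simp del: One_nat_def)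
  moreover have "norm_push m q = q + (\<Sum>j = 1..<m. push (tw j) q)"
  proof -
    have "tw 0 = (\<lambda>a. a)" using tw_0 by auto
    then show ?thesis using assms
      by (simp add: norm_push_def sum.atLeast_Suc_lessThan atLeast0LessThan[symmetric])
  qed
  ultimately show ?thesis using assms by (simp add: D_split_chain)
qed

lemma D_F_place: "D (F (place e [] q)) - place (e + n - 1) [1] (norm_push n q) \<in> R t"
proof -
  have "insert_pow n (place e [] q) \<in> R t" by (rule insert_pow_n_null)
  then show ?thesis using n_ge_2 unfolding F_def by (subst D_split_place) auto
qed

lemma D_place1: "D (place (n - 1) [1] q) - place 0 [] (push mc q - push (\<lambda>a. mc (tw 1 a)) q) \<in> R t"
proof -
  have "D (place (n - 1) [1] q) = place n [] (q - push (tw 1) q)"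
    using n_ge_2
    by (induction q rule: frag_all_induct) (auto simp: D.zero D.diff bdry0_def algebra_simps)
  moreover have "shift (0 + n) (place 0 [] (q - push (tw 1) q)) - shift 0 (C (place 0 [] (q - push (tw 1) q))) \<in> R t"
    by (rule shift_n)
  ultimately show ?thesis by (simp add: C_def push_push)
qed

subsection \<open>Coordinates\<close>

text \<open>Every symbol is congruent to one with \<open>e < n\<close> and all \<open>w\<^sub>i < n\<close>; \<open>coord e W\<close> collects the
  scalars that arrive at the reduced symbol \<open>\<langle>_; e; W\<rangle>\<close>.\<close>

definition coord :: "nat \<Rightarrow> nat list \<Rightarrow> 'a chain \<Rightarrow> 'a formal_sum" where
  "coord e0 W0 = frag_extend (\<lambda>(a, e, W). if e mod n = e0 \<and> map (\<lambda>w. w mod n) W = W0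
     then frag_of ((mc ^^ (e div n + (\<Sum>w\<leftarrow>W. w div n))) a) else 0)"

interpretation coord: additive "coord e W" for e W
  unfolding coord_def by (rule additive_frag_extend)

lemma coord_of: "coord e0 W0 (frag_of (a, e, W)) = (if e mod n = e0 \<and> map (\<lambda>w. w mod n) W = W0
     then frag_of ((mc ^^ (e div n + (\<Sum>w\<leftarrow>W. w div n))) a) else 0)"
  by (simp add: coord_def)

lemma coord_place: "coord e0 W0 (place e W q) = (if e mod n = e0 \<and> map (\<lambda>w. w mod n) W = W0
     then push (mc ^^ (e div n + (\<Sum>w\<leftarrow>W. w div n))) q else 0)"
  by (induction q rule: frag_all_induct) (auto simp: coord.zero coord.diff coord_of)

lemma Q_mc_pow: "q \<in> Q (T + k * n) \<Longrightarrow> push (mc ^^ k) q \<in> Q T"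
proof (induction k arbitrary: T)
  case (Suc k)
  then have "q \<in> Q ((T + n) + k * n)" by (simp add: ac_simps)
  from Q_mc[OF Suc.IH[OF this]] show ?case by (simp add: push_push)
qed (simp add: id_def)

lemma sum_list_mod: "sum_list W = sum_list (map (\<lambda>w. w mod n) W) + (\<Sum>w\<leftarrow>W. w div n) * n"
proof (induction W)
  case (Cons w W)
  have "w = w mod n + w div n * n" by simp
  with Cons show ?case by (simp add: algebra_simps)
qed simp

text \<open>Coordinates turn relations into twisted commutators of the corresponding weight, because every
  extraction of \<open>c\<close> lowers the weight by \<open>n\<close>. Together with \<open>chain_expansion\<close> this decides membership
  in \<open>R t\<close>.\<close>

lemma coord_R:
  assumes "x \<in> R t" "0 \<notin> set W0"
  shows "coord e0 W0 x \<in> Q (e0 + sum_list W0 + t)"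
  using assms(1)
proof (induction x rule: R.induct)
  case (coef q e W)
  have "e = e mod n + e div n * n" by simp
  then have "e + sum_list W + t = (e mod n + sum_list (map (\<lambda>w. w mod n) W) + t)
      + (e div n + (\<Sum>w\<leftarrow>W. w div n)) * n"
    using sum_list_mod[of W] by (simp add: algebra_simps)
  with coef have "q \<in> Q ((e mod n + sum_list (map (\<lambda>w. w mod n) W) + t)
      + (e div n + (\<Sum>w\<leftarrow>W. w div n)) * n)" by simp
  from Q_mc_pow[OF this] show ?case by (auto simp: coord_place Q_0)
next
  case (head a e W)
  then show ?case using n_ge_2 by (auto simp: coord.diff coord_of funpow_swap1 Q_0)
next
  case (entry a e U w V)
  then show ?case using n_ge_2 by (auto simp: coord.diff coord_of funpow_swap1 Q_0)
next
  case (null a e U V)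
  then show ?case using assms(2) by (auto simp: coord_of Q_0)
qed (auto simp: coord.zero coord.diff Q_0 Q_diff)

definition reduced_symbols :: "nat \<Rightarrow> (nat \<times> nat list) set" where
  "reduced_symbols r = {..<n} \<times> {W. set W \<subseteq> {1..<n} \<and> length W = r}"

lemma finite_reduced_symbols: "finite (reduced_symbols r)"
  unfolding reduced_symbols_def by (intro finite_cartesian_product finite_lists_length_eq) auto

lemma place_mod: "place e W q - place (e mod n) (map (\<lambda>w. w mod n) W)
     (push (mc ^^ (e div n + (\<Sum>w\<leftarrow>W. w div n))) q) \<in> R t"
proof -
  have 1: "place e W q - place e (map (\<lambda>w. w mod n) W) (push (mc ^^ (\<Sum>w\<leftarrow>W. w div n)) q) \<in> R t" for t
  proof (induction W arbitrary: t)
    case (Cons w W)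
    let ?W = "map (\<lambda>w. w mod n) W" and ?q = "push (mc ^^ (\<Sum>w\<leftarrow>W. w div n)) q"
    from R_add[OF R_insert_pow[OF Cons.IH[of "t + w"]] insert_pow_mod[of w "place e ?W ?q" t]]
    show ?case by (simp add: push_push funpow_add o_def)
  qed (simp add: R.zero id_def)
  let ?W = "map (\<lambda>w. w mod n) W" and ?q = "push (mc ^^ (\<Sum>w\<leftarrow>W. w div n)) q"
  from R_add[OF 1 shift_mod[of e "place 0 ?W ?q" t]]
  show ?thesis by (simp add: push_push funpow_add o_def)
qed

lemma chain_expansion:
  assumes "z \<in> len r"
  shows "z - (\<Sum>(e, W)\<in>reduced_symbols r. place e W (coord e W z)) \<in> R t"
  using assms
proof (induction z rule: len_induct)
  case (of a e W)
  let ?W = "map (\<lambda>w. w mod n) W" and ?a = "(mc ^^ (e div n + (\<Sum>w\<leftarrow>W. w div n))) a"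
  have 1: "frag_of (a, e, W) - frag_of (?a, e mod n, ?W) \<in> R t"
    using place_mod[of e W "frag_of a" t] by simp
  have 2: "(\<Sum>(e', W')\<in>reduced_symbols r. place e' W' (coord e' W' (frag_of (a, e, W)))) =
    (\<Sum>p\<in>reduced_symbols r. if p = (e mod n, ?W) then frag_of (?a, e mod n, ?W) else 0)"
  proof (rule sum.cong)
    fix p
    show "(case p of (e', W') \<Rightarrow> place e' W' (coord e' W' (frag_of (a, e, W)))) =
      (if p = (e mod n, ?W) then frag_of (?a, e mod n, ?W) else 0)"
      by (cases p) (auto simp: coord_of)
  qed simp
  show ?case
  proof (cases "0 \<in> set ?W")
    case True
    then obtain U V where "?W = U @ 0 # V" by (meson split_list)
    then have "frag_of (?a, e mod n, ?W) \<in> R t" by (simp only: R.null)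
    moreover have "(e mod n, ?W) \<notin> reduced_symbols r" using True by (auto simp: reduced_symbols_def)
    ultimately show ?thesis unfolding 2 using R_diff_iff[OF 1] by (simp add: sum.delta' finite_reduced_symbols)
  next
    case False
    then have "(e mod n, ?W) \<in> reduced_symbols r" using of n_ge_2 by (auto simp: reduced_symbols_def not_le Suc_le_eq intro: gr0I)
    then show ?thesis unfolding 2 using 1 by (simp add: sum.delta' finite_reduced_symbols)
  qed
next
  case (diff x y)
  define S where "S z = (\<Sum>(e, W)\<in>reduced_symbols r. place e W (coord e W z))" for z
  have "S (x - y) = S x - S y"
    by (simp add: S_def coord.diff split_def sum_subtractf)
  then have "x - y - S (x - y) = (x - S x) - (y - S y)" by (simp add: algebra_simps)
  moreover have "(x - S x) - (y - S y) \<in> R t" using R.diff[OF diff] unfolding S_def .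
  ultimately have "x - y - S (x - y) \<in> R t" by (simp only:)
  then show ?case unfolding S_def .
qed (simp add: R.zero coord.zero)

lemma R_if_coords:
  assumes "z \<in> len r" "\<And>e W. (e, W) \<in> reduced_symbols r \<Longrightarrow> coord e W z \<in> Q (e + sum_list W + t)"
  shows "z \<in> R t"
  using R_diff_iff[OF chain_expansion[OF assms(1), of t]] assms(2)
  by (auto intro!: R_sum R.coef)

text \<open>On a reduced symbol no further collapse takes place: the summand of weight \<open>T\<close> is exactly
  \<open>K/[K,K]\<^bsub>\<alpha>\<^sup>T\<^esub>\<close>.\<close>

lemma place_in_R_iff:
  assumes "(e, W) \<in> reduced_symbols r"
  shows "place e W q \<in> R t \<longleftrightarrow> q \<in> Q (e + sum_list W + t)"
proof
  have W: "map (\<lambda>w. w mod n) W = W" "(\<Sum>w\<leftarrow>W. w div n) = 0" "e < n" "0 \<notin> set W"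
    using assms by (auto simp: reduced_symbols_def intro!: map_idI)
  have "coord e W (place e W q) = push (mc ^^ (e div n + (\<Sum>w\<leftarrow>W. w div n))) q"
    by (simp add: coord_place W(1,3))
  also have "\<dots> = q" unfolding W(2) using W(3) by (simp add: id_def)
  finally have "coord e W (place e W q) = q" .
  then show "q \<in> Q (e + sum_list W + t)" if "place e W q \<in> R t"
    using coord_R[OF that, of W e] W by simp
qed (rule R.coef)

lemma place_0_in_R_iff: "place 0 [] q \<in> R t \<longleftrightarrow> q \<in> Q t"
  using place_in_R_iff[of 0 "[]" 0] n_ge_2 by (simp add: reduced_symbols_def)
lemma place_1_in_R_iff: "place (n - 1) [1] q \<in> R t \<longleftrightarrow> q \<in> Q (t + n)"
  using place_in_R_iff[of "n - 1" "[1]" 1] n_ge_2 by (simp add: reduced_symbols_def ac_simps)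

subsection \<open>Periodicity of cycles and boundaries\<close>

definition Cyc :: "nat \<Rightarrow> nat \<Rightarrow> 'a chain set" where
  "Cyc t r = {z \<in> len r. D z \<in> R t}"
definition Bd :: "nat \<Rightarrow> nat \<Rightarrow> 'a chain set" where
  "Bd t r = {z \<in> len r. \<exists>y \<in> len (Suc r). z - D y \<in> R t}"

lemma Bd_R: "z \<in> len r \<Longrightarrow> z \<in> R t \<Longrightarrow> z \<in> Bd t r"
  by (auto simp: Bd_def D.zero intro!: bexI[of _ 0])
lemma Bd_D: "y \<in> len (Suc r) \<Longrightarrow> D y \<in> Bd t r"
  by (auto simp: Bd_def R.zero len_D intro!: bexI[of _ y])
lemma Bd_diff: "x \<in> Bd t r \<Longrightarrow> y \<in> Bd t r \<Longrightarrow> x - y \<in> Bd t r"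
proof -
  assume "x \<in> Bd t r" "y \<in> Bd t r"
  then obtain u v where "x \<in> len r" "y \<in> len r" "u \<in> len (Suc r)" "v \<in> len (Suc r)"
      "x - D u \<in> R t" "y - D v \<in> R t" by (auto simp: Bd_def)
  moreover from this have "(x - y) - D (u - v) \<in> R t"
    using R.diff[of "x - D u" t "y - D v"] by (simp add: D.diff algebra_simps)
  ultimately show ?thesis unfolding Bd_def by (blast intro: len_diff)
qed
lemma Bd_add: "x \<in> Bd t r \<Longrightarrow> y \<in> Bd t r \<Longrightarrow> x + y \<in> Bd t r"
  using Bd_diff[of x t r "0 - y"] Bd_diff[of 0 t r y] Bd_R[of 0 r t] by (simp add: R.zero)
lemma D_Bd: "x \<in> Bd t r \<Longrightarrow> D x \<in> R t"
  unfolding Bd_def using R_D by (force simp: D.diff D_D)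

text \<open>Applying \<open>D\<close> to the homotopy formula for \<open>z\<close> and comparing with the formula for \<open>D z\<close> gives
  \<open>D F P z = F P D z\<close>; since \<open>F\<close> commutes with \<open>D\<close>, this is \<open>F\<close> of the claim, and \<open>P\<close> cancels
  \<open>F\<close>.\<close>

lemma P_D: "z \<in> len (Suc (Suc (Suc r))) \<Longrightarrow> P (D z) - D (P z) \<in> R (t + n)"
proof -
  assume z: "z \<in> len (Suc (Suc (Suc r)))"
  have 1: "D (D (H z) + H (D z) - (z - F (P z))) \<in> R t"
    by (intro R_D homotopy[OF z])
  have 2: "D (H (D z)) + H (D (D z)) - (D z - F (P (D z))) \<in> R t"
    by (rule homotopy[OF len_D[OF z]])
  have "D (F (P z)) - F (P (D z)) \<in> R t"
    using R.diff[OF 1 2] by (simp add: D.add D.diff D_D H.zero)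
  moreover have "D (F (P z)) - F (D (P z)) \<in> R t"
    by (rule D_F[OF len_P[OF z]])
  ultimately have "F (P (D z) - D (P z)) \<in> R t"
    using R.diff by (fastforce simp: F.diff)
  from R_P[OF this] show ?thesis by (simp add: P_F)
qed

lemma Cyc_F_iff:
  assumes "z \<in> len (Suc r)"
  shows "F z \<in> Cyc t (Suc (Suc (Suc r))) \<longleftrightarrow> z \<in> Cyc (t + n) (Suc r)"
proof -
  have "D (F z) \<in> R t \<longleftrightarrow> F (D z) \<in> R t" by (rule R_diff_iff[OF D_F[OF assms]])
  also have "\<dots> \<longleftrightarrow> D z \<in> R (t + n)" using R_F R_P[of "F (D z)"] by (auto simp: P_F)
  finally show ?thesis using assms len_F by (auto simp: Cyc_def)
qed

text \<open>One direction applies \<open>P\<close>, the other one \<open>F\<close>, to a chain with the given boundary.\<close>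

lemma Bd_F_iff:
  assumes "z \<in> len r"
  shows "F z \<in> Bd t (Suc (Suc r)) \<longleftrightarrow> z \<in> Bd (t + n) r"
proof
  assume "F z \<in> Bd t (Suc (Suc r))"
  then obtain y where y: "y \<in> len (Suc (Suc (Suc r)))" "F z - D y \<in> R t" by (auto simp: Bd_def)
  have "z - P (D y) \<in> R (t + n)" using R_P[OF y(2)] by (simp add: P.diff P_F)
  from R_add[OF this P_D[OF y(1)]] have "z - D (P y) \<in> R (t + n)" by simp
  then show "z \<in> Bd (t + n) r" using assms len_P[OF y(1)] by (auto simp: Bd_def)
next
  assume "z \<in> Bd (t + n) r"
  then obtain y where y: "y \<in> len (Suc r)" "z - D y \<in> R (t + n)" by (auto simp: Bd_def)
  have "F z - F (D y) \<in> R t" using R_F[OF y(2)] by (simp add: F.diff)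
  from R.diff[OF this D_F[OF y(1)]] have "F z - D (F y) \<in> R t" by simp
  then show "F z \<in> Bd t (Suc (Suc r))" using assms len_F y(1) by (auto simp: Bd_def)
qed

lemma Cyc_FP:
  assumes "z \<in> Cyc t (Suc (Suc r))"
  shows "z - F (P z) \<in> Bd t (Suc (Suc r))"
proof -
  have z: "z \<in> len (Suc (Suc r))" "D z \<in> R t" using assms by (auto simp: Cyc_def)
  from R.diff[OF R_H[OF z(2)] homotopy[OF z(1), of t]]
  have "(z - F (P z)) - D (H z) \<in> R t" by simp
  then show ?thesis using z by (auto simp: Bd_def intro: len_diff len_F len_P len_H)
qed

lemma Cyc_P: "z \<in> Cyc t (Suc (Suc (Suc r))) \<Longrightarrow> P z \<in> Cyc (t + n) (Suc r)"
  using R_diff_iff[OF P_D, of z r t] R_P[of "D z" t] by (simp add: Cyc_def len_P)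

text \<open>In degree \<open>0\<close> the weight is the exponent \<open>e < n\<close>, and \<open>n\<close> divides it only for \<open>e = 0\<close>.\<close>

lemma len0_place:
  assumes "z \<in> len 0" "n dvd t"
  shows "\<exists>q. z - place 0 [] q \<in> R t"
proof -
  have "(\<Sum>(e, W)\<in>reduced_symbols 0. place e W (coord e W z)) - place 0 [] (coord 0 [] z)
    = (\<Sum>(e, W)\<in>reduced_symbols 0 - {(0, [])}. place e W (coord e W z))"
    using n_ge_2 by (subst sum.remove[OF finite_reduced_symbols, of "(0, [])"]) (auto simp: reduced_symbols_def)
  also have "\<dots> \<in> R t"
  proof (rule R_sum)
    fix p assume "p \<in> reduced_symbols 0 - {(0, [])}"
    moreover obtain e W where p: "p = (e, W)" by (cases p)
    ultimately have *: "(e, W) \<in> reduced_symbols 0" "(e, W) \<noteq> (0, [])" by auto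
    then have "\<not> n dvd e" by (auto simp: reduced_symbols_def dest: dvd_imp_le)
    then have "\<not> n dvd e + sum_list W + t" using * assms by (auto simp: reduced_symbols_def dvd_add_left_iff)
    then have "place e W (coord e W z) \<in> R t" by (intro R.coef Q_top)
    then show "(case p of (e, W) \<Rightarrow> place e W (coord e W z)) \<in> R t" by (simp add: p)
  qed
  finally show ?thesis using R_add[OF chain_expansion[OF assms(1), of t]] by fastforce
qed

text \<open>In degree \<open>1\<close> the reduced symbols of weight divisible by \<open>n\<close> are \<open>\<langle>a; n-i; i\<rangle>\<close>; splitting
  \<open>x\<^sup>i\<close> exhibits each of them as homologous to a symbol \<open>\<langle>b; n-1; 1\<rangle>\<close>.\<close>

lemma len1_place:
  assumes "z \<in> len 1" "n dvd t"
  shows "\<exists>q. z - place (n - 1) [1] q \<in> Bd t 1"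
proof -
  define good where "good y \<longleftrightarrow> (\<exists>q. y - place (n - 1) [1] q \<in> Bd t 1)" for y
  have good_Bd: "good y" if "y \<in> Bd t 1" for y
    using that unfolding good_def by (intro exI[of _ 0]) simp
  have good_add: "good (x + y)" if "good x" "good y" for x y
  proof -
    from that obtain p q where "x - place (n - 1) [1] p \<in> Bd t 1" "y - place (n - 1) [1] q \<in> Bd t 1"
      by (auto simp: good_def)
    from Bd_add[OF this] show ?thesis unfolding good_def
      by (intro exI[of _ "p + q"]) (simp add: algebra_simps)
  qed
  have good_sum: "good (sum g I)" if "\<And>i. i \<in> I \<Longrightarrow> good (g i)" for g and I :: "(nat \<times> nat list) set"
    using that
  proof (induction I rule: infinite_finite_induct)
    case (insert x I)
    have "good (g x)" by (rule insert.prems) simp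
    moreover have "good (sum g I)" by (rule insert.IH) (rule insert.prems, simp)
    ultimately show ?case using insert.hyps by (simp add: good_add)
  qed (auto intro!: good_Bd Bd_R R.zero)
  have terms: "good (place e W q)" if eW: "(e, W) \<in> reduced_symbols 1" for e W q
  proof -
    from eW obtain i where i: "W = [i]" "1 \<le> i" "i < n" "e < n"
      by (auto simp: reduced_symbols_def length_Suc_conv)
    show ?thesis
    proof (cases "n dvd e + i")
      case True
      then have "n dvd (e + i) - n" by (auto intro: dvd_diff_nat)
      moreover have "n \<le> e + i" using True i by (auto intro: dvd_imp_le)
      moreover have "(e + i) - n < n" using i by linarith
      \<comment> \<open>0 < e + i < 2n is divisible by n\<close>
      ultimately have ei: "e + i = n" by (metis dvd_imp_le le_antisym not_less not_gr0 diff_is_0_eq)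
      have "D (split_chain i (place e [] q)) = place (n - 1) [1] (norm_push i q) - place e W q"
        using D_split_place[OF i(2), of e q] i ei by simp
      moreover have "D (split_chain i (place e [] q)) \<in> Bd t 1"
        using len_split_chain[of "place e [] q" 0 i] by (auto intro!: Bd_D len_place)
      ultimately have "0 - (place (n - 1) [1] (norm_push i q) - place e W q) \<in> Bd t 1"
        by (metis Bd_diff Bd_R len_0 R.zero)
      then show ?thesis unfolding good_def by (intro exI[of _ "norm_push i q"]) simp
    next
      case False
      then have "\<not> n dvd e + sum_list W + t" using i assms by (simp add: dvd_add_left_iff)
      then show ?thesis using i by (intro good_Bd Bd_R R.coef Q_top len_place) auto
    qed
  qed
  have "good (\<Sum>(e, W)\<in>reduced_symbols 1. place e W (coord e W z))"
    by (rule good_sum) (use terms in auto)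
  moreover have "good (z - (\<Sum>(e, W)\<in>reduced_symbols 1. place e W (coord e W z)))"
    by (intro good_Bd Bd_R chain_expansion len_diff len_sum)
      (use assms in \<open>auto simp: reduced_symbols_def intro!: len_place\<close>)
  ultimately show ?thesis using good_add unfolding good_def by fastforce
qed

subsection \<open>The homology of the complex of symbols\<close>

lemma len_F_pow: "z \<in> len r \<Longrightarrow> (F ^^ m) z \<in> len (r + 2 * m)"
  by (induction m) (auto dest: len_F)

lemma Cyc_F_pow:
  assumes "z \<in> len (Suc r)"
  shows "(F ^^ m) z \<in> Cyc t (Suc r + 2 * m) \<longleftrightarrow> z \<in> Cyc (t + m * n) (Suc r)"
proof (induction m arbitrary: t)
  case (Suc m)
  from Cyc_F_iff[of "(F ^^ m) z" "r + 2 * m" t] Suc[of "t + n"] len_F_pow[OF assms, of m]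
  show ?case by (simp add: ac_simps)
qed simp

lemma Bd_F_pow:
  assumes "z \<in> len r"
  shows "(F ^^ m) z \<in> Bd t (r + 2 * m) \<longleftrightarrow> z \<in> Bd (t + m * n) r"
proof (induction m arbitrary: t)
  case (Suc m)
  from Bd_F_iff[of "(F ^^ m) z" "r + 2 * m" t] Suc[of "t + n"] len_F_pow[OF assms, of m]
  show ?case by (simp add: ac_simps)
qed simp

lemma Cyc_F_pow_ex:
  assumes "z \<in> Cyc t (Suc r + 2 * m)"
  shows "\<exists>y \<in> Cyc (t + m * n) (Suc r). z - (F ^^ m) y \<in> Bd t (Suc r + 2 * m)"
  using assms
proof (induction m arbitrary: t z)
  case 0
  then show ?case by (auto intro!: bexI[of _ z] Bd_R R.zero)
next
  case (Suc m)
  then have z: "z \<in> Cyc t (Suc (Suc (Suc (r + 2 * m))))" by simp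
  from Suc.IH[of "P z" "t + n"] Cyc_P[OF z] obtain y
    where y: "y \<in> Cyc (t + n + m * n) (Suc r)" "P z - (F ^^ m) y \<in> Bd (t + n) (Suc r + 2 * m)" by auto
  have "F (P z - (F ^^ m) y) \<in> Bd t (Suc (Suc (Suc r + 2 * m)))"
    using y(2) Bd_F_iff[of "P z - (F ^^ m) y"] by (auto simp: Bd_def)
  from Bd_add[OF Cyc_FP[OF z] this[simplified]] have "z - (F ^^ Suc m) y \<in> Bd t (Suc r + 2 * Suc m)"
    by (simp add: F.diff)
  then show ?case using y(1) by (auto simp: ac_simps)
qed

theorem odd_cycle_iff:
  "(F ^^ m) (place (n - 1) [1] q) \<in> Cyc t (2 * m + 1)
     \<longleftrightarrow> push mc q - push (\<lambda>a. mc (tw 1 a)) q \<in> Q (t + m * n)"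
proof -
  have l: "place (n - 1) [1] q \<in> len (Suc 0)" by (simp add: len_place)
  have "place (n - 1) [1] q \<in> Cyc (t + m * n) (Suc 0) \<longleftrightarrow> D (place (n - 1) [1] q) \<in> R (t + m * n)"
    using l by (simp add: Cyc_def)
  also have "\<dots> \<longleftrightarrow> push mc q - push (\<lambda>a. mc (tw 1 a)) q \<in> Q (t + m * n)"
    using R_diff_iff[OF D_place1] place_0_in_R_iff by blast
  finally show ?thesis using Cyc_F_pow[OF l, of m t] by simp
qed

text \<open>By periodicity it suffices to treat degree \<open>1\<close>. A chain \<open>y\<close> of degree \<open>2\<close> whose boundary is
  \<open>\<langle>q; n-1; 1\<rangle>\<close> may be replaced by \<open>F P y\<close>, because \<open>H\<close> kills \<open>\<langle>q; n-1; 1\<rangle>\<close>: an exponent \<open>1\<close>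
  leaves nothing to split. Then \<open>P y\<close> reduces to a symbol \<open>\<langle>b; 0\<rangle>\<close>, and the boundary of
  \<open>F\<langle>b; 0\<rangle>\<close> is the norm of \<open>b\<close>.\<close>

theorem odd_boundary_iff:
  assumes "n dvd t"
  shows "(F ^^ m) (place (n - 1) [1] q) \<in> Bd t (2 * m + 1)
     \<longleftrightarrow> (\<exists>b. q - norm_push n b \<in> Q (t + (m + 1) * n))"
proof -
  define s where "s = t + m * n"
  have s: "n dvd s" using assms by (simp add: s_def)
  have l: "place (n - 1) [1] q \<in> len 1" by (simp add: len_place)
  have *: "place (n - 1) [1] q - D (F (place 0 [] b)) \<in> R s \<longleftrightarrow> q - norm_push n b \<in> Q (s + n)" for b
  proof -
    have 1: "(place (n - 1) [1] q - place (n - 1) [1] (norm_push n b))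
        - (place (n - 1) [1] q - D (F (place 0 [] b))) \<in> R s"
      using D_F_place[of 0 b s] by simp
    from R_diff_iff[OF this] show ?thesis
      using place_1_in_R_iff[of "q - norm_push n b" s] by simp
  qed
  have "place (n - 1) [1] q \<in> Bd s 1 \<longleftrightarrow> (\<exists>b. q - norm_push n b \<in> Q (s + n))"
  proof
    assume "\<exists>b. q - norm_push n b \<in> Q (s + n)"
    then obtain b where "place (n - 1) [1] q - D (F (place 0 [] b)) \<in> R s" using * by blast
    moreover have "F (place 0 [] b) \<in> len (Suc 1)" using len_F[of "place 0 [] b" 0] by (simp add: len_place)
    ultimately show "place (n - 1) [1] q \<in> Bd s 1" using l by (auto simp: Bd_def)
  next
    assume "place (n - 1) [1] q \<in> Bd s 1"
    then obtain y where y: "y \<in> len (Suc (Suc 0))" "place (n - 1) [1] q - D y \<in> R s" by (auto simp: Bd_def)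
    have "H (place (n - 1) [1] q) = 0"
      using H_insert_less[of 1 "place (n - 1) [] q"] n_ge_2 by (simp add: split_chain_def)
    \<comment> \<open>The homotopy formula for y then reads D (H y) = y - F (P y), up to relations.\<close>
    then have hd: "H (D y) \<in> R s" using R_H[OF y(2)] by (simp add: H.diff)
    have "D (D (H y) + H (D y) - (y - F (P y))) \<in> R s" by (intro R_D homotopy[OF y(1)])
    from R.diff[OF this R_D[OF hd]] have "D (F (P y)) - D y \<in> R s"
      by (simp add: D.add D.diff D_D)
    from R.diff[OF y(2) this] have 1: "place (n - 1) [1] q - D (F (P y)) \<in> R s" by simp
    obtain b where b: "P y - place 0 [] b \<in> R (s + n)"
      using len0_place[OF len_P[OF y(1)], of "s + n"] s by auto
    have "D (F (P y - place 0 [] b)) \<in> R s" by (intro R_D R_F b)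
    from R_add[OF 1 this] have "place (n - 1) [1] q - D (F (place 0 [] b)) \<in> R s"
      by (simp add: F.diff D.diff)
    then show "\<exists>b. q - norm_push n b \<in> Q (s + n)" using * by blast
  qed
  then show ?thesis using Bd_F_pow[OF l, of m t] by (simp add: s_def ac_simps)
qed

theorem odd_cycle_ex:
  assumes "n dvd t" "z \<in> Cyc t (2 * m + 1)"
  shows "\<exists>q. z - (F ^^ m) (place (n - 1) [1] q) \<in> Bd t (2 * m + 1)"
proof -
  have Fd: "(F ^^ m) (x - y) = (F ^^ m) x - (F ^^ m) y" for x y
    by (induction m) (auto simp: F.diff)
  have "z \<in> Cyc t (Suc 0 + 2 * m)" using assms(2) by simp
  from Cyc_F_pow_ex[OF this] obtain y
    where y: "y \<in> len 1" "z - (F ^^ m) y \<in> Bd t (Suc 0 + 2 * m)" by (auto simp: Cyc_def)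
  obtain q where q: "y - place (n - 1) [1] q \<in> Bd (t + m * n) 1"
    using len1_place[OF y(1), of "t + m * n"] assms(1) by auto
  have "(F ^^ m) (y - place (n - 1) [1] q) \<in> Bd t (Suc 0 + 2 * m)"
    using q Bd_F_pow[of "y - place (n - 1) [1] q" 1 m t] by (auto simp: Bd_def)
  from Bd_add[OF y(2) this] show ?thesis by (auto simp: Fd)
qed

theorem even_cycle_iff:
  "(F ^^ Suc m) (place 0 [] q) \<in> Cyc t (2 * m + 2) \<longleftrightarrow> norm_push n q \<in> Q (t + (m + 1) * n)"
proof -
  have l: "F (place 0 [] q) \<in> len (Suc (Suc 0))" by (intro len_F len_place) simp
  have "F (place 0 [] q) \<in> Cyc (t + m * n) (Suc (Suc 0)) \<longleftrightarrow> D (F (place 0 [] q)) \<in> R (t + m * n)"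
    using l by (simp add: Cyc_def)
  also have "\<dots> \<longleftrightarrow> place (n - 1) [1] (norm_push n q) \<in> R (t + m * n)"
    using R_diff_iff[OF D_F_place[of 0]] by simp
  also have "\<dots> \<longleftrightarrow> norm_push n q \<in> Q (t + (m + 1) * n)"
    using place_1_in_R_iff by (simp add: ac_simps)
  finally show ?thesis using Cyc_F_pow[OF l, of m t] by (simp add: funpow_swap1)
qed

theorem even_boundary_iff:
  assumes "n dvd t"
  shows "(F ^^ m) (place 0 [] q) \<in> Bd t (2 * m)
     \<longleftrightarrow> (\<exists>b. q - (push mc b - push (\<lambda>a. mc (tw 1 a)) b) \<in> Q (t + m * n))"
proof -
  define s where "s = t + m * n"
  have s: "n dvd s" using assms by (simp add: s_def)
  have l: "place 0 [] q \<in> len 0" by (simp add: len_place)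
  have *: "place 0 [] q - D (place (n - 1) [1] b) \<in> R s
      \<longleftrightarrow> q - (push mc b - push (\<lambda>a. mc (tw 1 a)) b) \<in> Q s" for b
  proof -
    have 1: "(place 0 [] q - place 0 [] (push mc b - push (\<lambda>a. mc (tw 1 a)) b))
        - (place 0 [] q - D (place (n - 1) [1] b)) \<in> R s"
      using D_place1[of b s] by (simp add: algebra_simps del: frag_additive)
    from R_diff_iff[OF this] show ?thesis
      using place_0_in_R_iff[of "q - (push mc b - push (\<lambda>a. mc (tw 1 a)) b)" s] by simp
  qed
  have "place 0 [] q \<in> Bd s 0 \<longleftrightarrow> (\<exists>b. q - (push mc b - push (\<lambda>a. mc (tw 1 a)) b) \<in> Q s)"
  proof
    assume "\<exists>b. q - (push mc b - push (\<lambda>a. mc (tw 1 a)) b) \<in> Q s"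
    then obtain b where "place 0 [] q - D (place (n - 1) [1] b) \<in> R s" using * by blast
    then show "place 0 [] q \<in> Bd s 0" using l by (auto simp: Bd_def intro!: len_place bexI[of _ "place (n - 1) [1] b"])
  next
    assume "place 0 [] q \<in> Bd s 0"
    then obtain y where y: "y \<in> len 1" "place 0 [] q - D y \<in> R s" by (auto simp: Bd_def)
    obtain b where b: "y - place (n - 1) [1] b \<in> Bd s 1" using len1_place[OF y(1) s] by auto
    from R_add[OF y(2) D_Bd[OF b]] have "place 0 [] q - D (place (n - 1) [1] b) \<in> R s"
      by (simp add: D.diff)
    then show "\<exists>b. q - (push mc b - push (\<lambda>a. mc (tw 1 a)) b) \<in> Q s" using * by blast
  qed
  then show ?thesis using Bd_F_pow[OF l, of m t] by (simp add: s_def)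
qed

text \<open>For \<open>m > 0\<close> the descent by \<open>Cyc_F_pow_ex\<close> stops in degree \<open>2\<close>, since \<open>F\<close>
  does not preserve cycles from degree \<open>0\<close> to degree \<open>2\<close>; the last step uses \<open>F P\<close> directly.\<close>

theorem even_cycle_ex:
  assumes "n dvd t" "z \<in> Cyc t (2 * m)"
  shows "\<exists>q. z - (F ^^ m) (place 0 [] q) \<in> Bd t (2 * m)"
proof (cases m)
  case 0
  then have z: "z \<in> len 0" using assms by (simp add: Cyc_def)
  obtain q where "z - place 0 [] q \<in> R t" using len0_place[OF z assms(1)] by auto
  then show ?thesis using 0 z by (auto intro!: Bd_R len_diff len_place exI[of _ q])
next
  case (Suc m')
  have Fd: "(F ^^ m) (x - y) = (F ^^ m) x - (F ^^ m) y" for m x y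
    by (induction m) (auto simp: F.diff)
  have "z \<in> Cyc t (Suc 1 + 2 * m')" using assms(2) Suc by simp
  from Cyc_F_pow_ex[OF this] obtain y
    where y: "y \<in> Cyc (t + m' * n) (Suc (Suc 0))" "z - (F ^^ m') y \<in> Bd t (Suc 1 + 2 * m')" by auto
  have ly: "y \<in> len (Suc (Suc 0))" using y by (simp add: Cyc_def)
  obtain q where q: "P y - place 0 [] q \<in> R (t + m' * n + n)"
    using len0_place[OF len_P[OF ly], of "t + m' * n + n"] assms(1) by auto
  have 1: "F (P y - place 0 [] q) \<in> Bd (t + m' * n) (Suc (Suc 0))"
    by (intro Bd_R len_F R_F q len_diff len_P[OF ly] len_place) simp
  have 2: "y - F (place 0 [] q) \<in> Bd (t + m' * n) (Suc (Suc 0))"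
    using Bd_add[OF Cyc_FP[OF y(1)] 1] by (simp add: F.diff)
  have "(F ^^ m') (y - F (place 0 [] q)) \<in> Bd t (Suc 1 + 2 * m')"
    using 2 Bd_F_pow[of "y - F (place 0 [] q)" "Suc (Suc 0)" m' t] by (auto simp: Bd_def)
  from Bd_add[OF y(2) this] show ?thesis
    using Suc by (auto simp: Fd funpow_swap1)
qed

end


section \<open>The Ore extension\<close>

locale twisted_algebra = assoc_algebra k K
  for k :: "('k, 'r) ring_scheme" and K :: "('k, 'a, 'm) module_scheme" (structure) +
  fixes \<alpha> :: "'a \<Rightarrow> 'a"
  assumes endo: "algebra_endo k K \<alpha>"
begin

lemma alpha_closed [simp, intro]: "a \<in> carrier K \<Longrightarrow> \<alpha> a \<in> carrier K"
  using endo by (auto simp: algebra_endo_def ring_hom_def)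
lemma alpha_hom: "\<alpha> \<in> ring_hom K K"
  using endo by (simp add: algebra_endo_def)
lemma alpha_smult: "c \<in> carrier k \<Longrightarrow> a \<in> carrier K \<Longrightarrow> \<alpha> (c \<odot> a) = c \<odot> \<alpha> a"
  using endo by (simp add: algebra_endo_def)

lemma pow_closed [simp, intro]: "a \<in> carrier K \<Longrightarrow> (\<alpha> ^^ i) a \<in> carrier K"
  by (induction i) auto
lemma pow_mult: "a \<in> carrier K \<Longrightarrow> b \<in> carrier K \<Longrightarrow>
    (\<alpha> ^^ i) (a \<otimes> b) = (\<alpha> ^^ i) a \<otimes> (\<alpha> ^^ i) b"
  by (induction i) (auto simp: ring_hom_mult[OF alpha_hom])
lemma pow_add: "a \<in> carrier K \<Longrightarrow> b \<in> carrier K \<Longrightarrow>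
    (\<alpha> ^^ i) (a \<oplus> b) = (\<alpha> ^^ i) a \<oplus> (\<alpha> ^^ i) b"
  by (induction i) (auto simp: ring_hom_add[OF alpha_hom])
lemma pow_one [simp]: "(\<alpha> ^^ i) \<one> = \<one>"
  by (induction i) (auto simp: ring_hom_one[OF alpha_hom])
lemma pow_smult: "c \<in> carrier k \<Longrightarrow> a \<in> carrier K \<Longrightarrow> (\<alpha> ^^ i) (c \<odot> a) = c \<odot> (\<alpha> ^^ i) a"
  by (induction i) (auto simp: alpha_smult)
lemma pow_zero [simp]: "(\<alpha> ^^ i) \<zero> = \<zero>"
proof -
  have "(\<alpha> ^^ i) \<zero> \<oplus> (\<alpha> ^^ i) \<zero> = (\<alpha> ^^ i) \<zero>"
    using pow_add[of \<zero> \<zero> i] by simp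
  then show ?thesis by (simp add: M.add.l_cancel_one)
qed
lemma pow_minus: "a \<in> carrier K \<Longrightarrow> (\<alpha> ^^ i) (\<ominus> a) = \<ominus> (\<alpha> ^^ i) a"
proof -
  assume a: "a \<in> carrier K"
  then have "(\<alpha> ^^ i) (\<ominus> a) \<oplus> (\<alpha> ^^ i) a = \<zero>"
    using pow_add[of "\<ominus> a" a i] by (simp add: M.l_neg)
  then show ?thesis using a by (simp add: M.minus_equality)
qed

abbreviation B where "B \<equiv> ore_ext K \<alpha>"

text \<open>The polynomial \<open>a x\<^sup>m\<close>.\<close>

definition mono :: "'a \<Rightarrow> nat \<Rightarrow> nat \<Rightarrow> 'a" where
  "mono a m = (\<lambda>i. if i = m then a else \<zero>)"

lemma carrier_B: "carrier B = up K" by (simp add: ore_ext_def)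
lemma B_add: "p \<oplus>\<^bsub>B\<^esub> q = (\<lambda>i. p i \<oplus> q i)" by (simp add: ore_ext_def)
lemma B_mult: "p \<otimes>\<^bsub>B\<^esub> q = (\<lambda>n. \<Oplus>i\<in>{..n}. p i \<otimes> (\<alpha> ^^ i) (q (n - i)))"
  by (simp add: ore_ext_def)
lemma B_zero: "\<zero>\<^bsub>B\<^esub> = (\<lambda>i. \<zero>)" by (simp add: ore_ext_def)
lemma B_one: "\<one>\<^bsub>B\<^esub> = mono \<one> 0" by (simp add: ore_ext_def mono_def)
lemma B_smult: "c \<odot>\<^bsub>B\<^esub> p = (\<lambda>i. c \<odot> p i)" by (simp add: ore_ext_def)
lemma const_mono: "ore_const K a = mono a 0" by (simp add: ore_const_def mono_def)
lemma var_mono: "ore_var K = mono \<one> 1" by (simp add: ore_var_def mono_def)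

lemma mono_closed [simp, intro]: "a \<in> carrier K \<Longrightarrow> mono a m \<in> carrier B"
  by (auto simp: carrier_B mono_def intro!: mem_upI exI[of _ m] bound.intro)

lemma up_D: "p \<in> carrier B \<Longrightarrow> p i \<in> carrier K"
  by (auto simp: carrier_B)
lemma up_bound: "p \<in> carrier B \<Longrightarrow> \<exists>N. \<forall>m>N. p m = \<zero>"
  by (auto simp: carrier_B up_def bound_def)
lemma B_I: "(\<And>i. p i \<in> carrier K) \<Longrightarrow> \<forall>m>N. p m = \<zero> \<Longrightarrow> p \<in> carrier B"
  by (auto simp: carrier_B intro!: mem_upI exI[of _ N] bound.intro)

lemma B_add_closed: "p \<in> carrier B \<Longrightarrow> q \<in> carrier B \<Longrightarrow> p \<oplus>\<^bsub>B\<^esub> q \<in> carrier B"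
  by (simp add: carrier_B B_add M.up_add_closed)

lemma B_induct [consumes 1, case_names zero mono add]:
  assumes "p \<in> carrier B" "Q (\<lambda>i. \<zero>)" "\<And>a m. a \<in> carrier K \<Longrightarrow> Q (mono a m)"
    "\<And>p q. p \<in> carrier B \<Longrightarrow> q \<in> carrier B \<Longrightarrow> Q p \<Longrightarrow> Q q \<Longrightarrow> Q (p \<oplus>\<^bsub>B\<^esub> q)"
  shows "Q p"
proof -
  have "Q p" if "p \<in> carrier B" "\<forall>m\<ge>N. p m = \<zero>" for N p
    using that
  proof (induction N arbitrary: p)
    case 0
    then have "p = (\<lambda>i. \<zero>)" by auto
    then show ?case using assms(2) by simp
  next
    case (Suc N)
    let ?q = "\<lambda>i. if i = N then \<zero> else p i"
    have q: "?q \<in> carrier B"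
      using Suc.prems up_D by (intro B_I[of _ N]) auto
    have "?q \<oplus>\<^bsub>B\<^esub> mono (p N) N = p"
      using Suc.prems up_D by (auto simp: B_add mono_def fun_eq_iff)
    moreover have "Q ?q"
    proof (rule Suc.IH[OF q])
      show "\<forall>m\<ge>N. ?q m = \<zero>" using Suc.prems(2) by (metis Suc_leI le_neq_implies_less)
    qed
    ultimately show ?case
      using assms(4)[OF q, of "mono (p N) N"] assms(3) Suc.prems up_D by force
  qed
  moreover obtain N where "\<forall>m>N. p m = \<zero>" using up_bound assms(1) by blast
  then have "\<forall>m\<ge>Suc N. p m = \<zero>" by auto
  ultimately show ?thesis using assms(1) by blast
qed

lemma mono_mult_coef:
  assumes "a \<in> carrier K" "p \<in> carrier B"
  shows "(mono a m \<otimes>\<^bsub>B\<^esub> p) i = (if m \<le> i then a \<otimes> (\<alpha> ^^ m) (p (i - m)) else \<zero>)"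
proof -
  have "(mono a m \<otimes>\<^bsub>B\<^esub> p) i = (\<Oplus>j\<in>{..i}. if m = j then a \<otimes> (\<alpha> ^^ j) (p (i - j)) else \<zero>)"
    unfolding B_mult by (rule M.finsum_cong') (use assms in \<open>auto simp: mono_def up_D\<close>)
  also have "\<dots> = (if m \<le> i then a \<otimes> (\<alpha> ^^ m) (p (i - m)) else \<zero>)"
  proof (cases "m \<le> i")
    case True
    then show ?thesis using assms
      by (simp add: M.finsum_singleton[of m "{..i}" "\<lambda>j. a \<otimes> (\<alpha> ^^ j) (p (i - j))"] up_D Pi_def)
  next
    case False
    then have "(\<Oplus>j\<in>{..i}. if m = j then a \<otimes> (\<alpha> ^^ j) (p (i - j)) else \<zero>) = (\<Oplus>j\<in>{..i}. \<zero>)"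
      by (intro M.finsum_cong') auto
    then show ?thesis using False by simp
  qed
  finally show ?thesis .
qed

lemma mult_mono_coef:
  assumes "b \<in> carrier K" "p \<in> carrier B"
  shows "(p \<otimes>\<^bsub>B\<^esub> mono b m) i = (if m \<le> i then p (i - m) \<otimes> (\<alpha> ^^ (i - m)) b else \<zero>)"
proof -
  have "(p \<otimes>\<^bsub>B\<^esub> mono b m) i = (\<Oplus>j\<in>{..i}. if m \<le> i \<and> i - m = j then p j \<otimes> (\<alpha> ^^ j) b else \<zero>)"
    unfolding B_mult by (rule M.finsum_cong') (use assms in \<open>auto simp: mono_def up_D\<close>)
  also have "\<dots> = (if m \<le> i then p (i - m) \<otimes> (\<alpha> ^^ (i - m)) b else \<zero>)"
  proof (cases "m \<le> i")
    case True
    then show ?thesis using assms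
      by (simp add: M.finsum_singleton[of "i - m" "{..i}" "\<lambda>j. p j \<otimes> (\<alpha> ^^ j) b"] up_D Pi_def)
  next
    case False
    then have "(\<Oplus>j\<in>{..i}. if m \<le> i \<and> i - m = j then p j \<otimes> (\<alpha> ^^ j) b else \<zero>) = (\<Oplus>j\<in>{..i}. \<zero>)"
      by (intro M.finsum_cong') auto
    then show ?thesis using False by simp
  qed
  finally show ?thesis .
qed

lemma mono_mono:
  "a \<in> carrier K \<Longrightarrow> b \<in> carrier K \<Longrightarrow> mono a i \<otimes>\<^bsub>B\<^esub> mono b j = mono (a \<otimes> (\<alpha> ^^ i) b) (i + j)"
  by (rule ext) (auto simp: mono_mult_coef, auto simp: mono_def)

lemma mult_add_left:
  assumes "p \<in> carrier B" "q \<in> carrier B" "r \<in> carrier B"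
  shows "(p \<oplus>\<^bsub>B\<^esub> q) \<otimes>\<^bsub>B\<^esub> r = (p \<otimes>\<^bsub>B\<^esub> r) \<oplus>\<^bsub>B\<^esub> (q \<otimes>\<^bsub>B\<^esub> r)"
proof (rule ext)
  fix i
  have "((p \<oplus>\<^bsub>B\<^esub> q) \<otimes>\<^bsub>B\<^esub> r) i =
    (\<Oplus>j\<in>{..i}. p j \<otimes> (\<alpha> ^^ j) (r (i - j)) \<oplus> q j \<otimes> (\<alpha> ^^ j) (r (i - j)))"
    unfolding B_mult B_add by (rule M.finsum_cong') (use assms in \<open>auto simp: M.l_distr up_D\<close>)
  then show "((p \<oplus>\<^bsub>B\<^esub> q) \<otimes>\<^bsub>B\<^esub> r) i = ((p \<otimes>\<^bsub>B\<^esub> r) \<oplus>\<^bsub>B\<^esub> (q \<otimes>\<^bsub>B\<^esub> r)) i"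
    using assms by (simp add: M.finsum_addf up_D Pi_def) (simp add: B_mult B_add)
qed

lemma mult_add_right:
  assumes "p \<in> carrier B" "q \<in> carrier B" "r \<in> carrier B"
  shows "r \<otimes>\<^bsub>B\<^esub> (p \<oplus>\<^bsub>B\<^esub> q) = (r \<otimes>\<^bsub>B\<^esub> p) \<oplus>\<^bsub>B\<^esub> (r \<otimes>\<^bsub>B\<^esub> q)"
proof (rule ext)
  fix i
  have "(r \<otimes>\<^bsub>B\<^esub> (p \<oplus>\<^bsub>B\<^esub> q)) i =
    (\<Oplus>j\<in>{..i}. r j \<otimes> (\<alpha> ^^ j) (p (i - j)) \<oplus> r j \<otimes> (\<alpha> ^^ j) (q (i - j)))"
    unfolding B_mult B_add by (rule M.finsum_cong') (use assms in \<open>auto simp: M.r_distr up_D pow_add\<close>)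
  then show "(r \<otimes>\<^bsub>B\<^esub> (p \<oplus>\<^bsub>B\<^esub> q)) i = ((r \<otimes>\<^bsub>B\<^esub> p) \<oplus>\<^bsub>B\<^esub> (r \<otimes>\<^bsub>B\<^esub> q)) i"
    using assms by (simp add: M.finsum_addf up_D Pi_def) (simp add: B_mult B_add)
qed

lemma zero_mult: "p \<in> carrier B \<Longrightarrow> (\<lambda>i. \<zero>) \<otimes>\<^bsub>B\<^esub> p = (\<lambda>i. \<zero>)"
  by (rule ext) (simp add: B_mult up_D)
lemma mult_zero: "p \<in> carrier B \<Longrightarrow> p \<otimes>\<^bsub>B\<^esub> (\<lambda>i. \<zero>) = (\<lambda>i. \<zero>)"
  by (rule ext) (simp add: B_mult up_D)
lemma B_zero_closed: "(\<lambda>i. \<zero>) \<in> carrier B" by (intro B_I[of _ 0]) auto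

lemma B_mult_closed:
  assumes "p \<in> carrier B" "q \<in> carrier B" shows "p \<otimes>\<^bsub>B\<^esub> q \<in> carrier B"
  using assms(1)
proof (induction p rule: B_induct)
  case zero
  show ?case using assms by (simp add: zero_mult B_zero_closed)
next
  case (mono a m)
  show ?case using assms(2)
  proof (induction q rule: B_induct)
    case zero
    show ?case using mono by (simp add: mult_zero B_zero_closed)
  next
    case (mono b j)
    then show ?case using \<open>a \<in> carrier K\<close> by (simp add: mono_mono)
  qed (use mono in \<open>simp add: mult_add_right B_add_closed\<close>)
qed (use assms in \<open>simp add: mult_add_left B_add_closed\<close>)

text \<open>By additivity in each argument associativity is checked on monomials, where it amounts to
  \<open>\<alpha>\<^sup>i\<close> being multiplicative.\<close>

lemma B_assoc:
  assumes "p \<in> carrier B" "q \<in> carrier B" "r \<in> carrier B"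
  shows "(p \<otimes>\<^bsub>B\<^esub> q) \<otimes>\<^bsub>B\<^esub> r = p \<otimes>\<^bsub>B\<^esub> (q \<otimes>\<^bsub>B\<^esub> r)"
  using assms(1)
proof (induction p rule: B_induct)
  case zero
  show ?case using assms by (simp add: zero_mult B_mult_closed)
next
  case (mono a i)
  note a = mono
  show ?case using assms(2)
  proof (induction q rule: B_induct)
    case zero
    show ?case using assms a by (simp add: zero_mult mult_zero)
  next
    case (mono b j)
    note b = mono
    show ?case using assms(3)
    proof (induction r rule: B_induct)
      case zero
      show ?case using a b by (simp add: mult_zero mono_mono)
    next
      case (mono c m)
      show ?case using a b mono
        by (simp add: mono_mono pow_mult M.m_assoc funpow_add ac_simps)
    next
      case (add p q)
      then show ?case using a b by (simp add: mult_add_right B_mult_closed)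
    qed
  next
    case (add p q)
    then show ?case using a assms by (simp add: mult_add_right mult_add_left B_mult_closed)
  qed
next
  case (add p q)
  then show ?case using assms by (simp add: mult_add_left B_mult_closed)
qed

lemma B_abelian_group: "abelian_group B"
proof (rule abelian_groupI)
  fix p assume p: "p \<in> carrier B"
  then have "(\<lambda>i. \<ominus> p i) \<in> carrier B" by (simp add: carrier_B M.up_a_inv_closed)
  moreover have "(\<lambda>i. \<ominus> p i) \<oplus>\<^bsub>B\<^esub> p = \<zero>\<^bsub>B\<^esub>"
    using p by (simp add: B_add B_zero M.l_neg up_D)
  ultimately show "\<exists>q\<in>carrier B. q \<oplus>\<^bsub>B\<^esub> p = \<zero>\<^bsub>B\<^esub>" by blast
qed (simp_all add: B_add_closed B_zero B_zero_closed, simp_all add: B_add M.a_ac up_D)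

lemma B_ring: "ring B"
proof (rule ringI[OF B_abelian_group])
  show "Group.monoid B"
  proof (rule monoidI)
    fix p assume p: "p \<in> carrier B"
    show "\<one>\<^bsub>B\<^esub> \<otimes>\<^bsub>B\<^esub> p = p" using p by (auto simp: B_one mono_mult_coef up_D)
    show "p \<otimes>\<^bsub>B\<^esub> \<one>\<^bsub>B\<^esub> = p" using p by (auto simp: B_one mult_mono_coef up_D)
  qed (auto simp: B_mult_closed B_assoc B_one)
qed (auto simp: mult_add_left mult_add_right)

sublocale B: ring B by (rule B_ring)

lemma B_smult_closed: "c \<in> carrier k \<Longrightarrow> p \<in> carrier B \<Longrightarrow> c \<odot>\<^bsub>B\<^esub> p \<in> carrier B"
proof -
  assume c: "c \<in> carrier k" and p: "p \<in> carrier B"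
  obtain N where "\<forall>m>N. p m = \<zero>" using up_bound[OF p] by blast
  then show ?thesis using c p by (intro B_I[of _ N]) (auto simp: B_smult up_D)
qed

lemma B_module: "Module.module k B"
  by (rule moduleI)
    (auto simp: R.is_cring B_abelian_group B_smult_closed, auto simp: B_smult B_add up_D smult_l_distr smult_r_distr smult_assoc1)

lemma B_algebra: "assoc_algebra k B"
proof (intro assoc_algebra.intro assoc_algebra_axioms.intro B_module B_ring)
  fix c p q assume *: "c \<in> carrier k" "p \<in> carrier B" "q \<in> carrier B"
  have sum: "c \<odot> finsum K f S = (\<Oplus>j\<in>S. c \<odot> f j)"
    if "f \<in> S \<rightarrow> carrier K" "finite S" for f and S :: "nat set"
    using that(2,1) by (induction S rule: finite_induct)
      (use *(1) in \<open>auto simp: smult_r_distr Pi_def intro!: M.finsum_closed\<close>)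
  show "c \<odot>\<^bsub>B\<^esub> p \<otimes>\<^bsub>B\<^esub> q = c \<odot>\<^bsub>B\<^esub> (p \<otimes>\<^bsub>B\<^esub> q)"
  proof (rule ext)
    fix i
    have "(c \<odot>\<^bsub>B\<^esub> p \<otimes>\<^bsub>B\<^esub> q) i = (\<Oplus>j\<in>{..i}. c \<odot> (p j \<otimes> (\<alpha> ^^ j) (q (i - j))))"
      unfolding B_mult B_smult
      by (rule M.finsum_cong') (use * in \<open>auto simp: smult_mult_left up_D\<close>)
    then show "(c \<odot>\<^bsub>B\<^esub> p \<otimes>\<^bsub>B\<^esub> q) i = (c \<odot>\<^bsub>B\<^esub> (p \<otimes>\<^bsub>B\<^esub> q)) i"
      using * by (simp add: B_smult B_mult sum up_D)
  qed
  show "p \<otimes>\<^bsub>B\<^esub> (c \<odot>\<^bsub>B\<^esub> q) = c \<odot>\<^bsub>B\<^esub> (p \<otimes>\<^bsub>B\<^esub> q)"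
  proof (rule ext)
    fix i
    have "(p \<otimes>\<^bsub>B\<^esub> (c \<odot>\<^bsub>B\<^esub> q)) i = (\<Oplus>j\<in>{..i}. c \<odot> (p j \<otimes> (\<alpha> ^^ j) (q (i - j))))"
      unfolding B_mult B_smult
      by (rule M.finsum_cong') (use * in \<open>auto simp: smult_mult_right up_D pow_smult\<close>)
    then show "(p \<otimes>\<^bsub>B\<^esub> (c \<odot>\<^bsub>B\<^esub> q)) i = (c \<odot>\<^bsub>B\<^esub> (p \<otimes>\<^bsub>B\<^esub> q)) i"
      using * by (simp add: B_smult B_mult sum up_D)
  qed
qed

lemma var_pow: "mono \<one> 1 [^]\<^bsub>B\<^esub> m = mono \<one> m"
  by (induction m) (auto simp: B_one mono_mono)

end


section \<open>The monogenic extension\<close>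

locale monogenic = twisted_algebra k K \<alpha>
  for k :: "('k, 'r) ring_scheme" and K :: "('k, 'a, 'm) module_scheme" (structure) and \<alpha> +
  fixes n :: nat and l :: "nat \<Rightarrow> 'a" and u :: 'a
  assumes n_ge_2: "n \<ge> 2"
    and l_0: "l 0 = \<one>"
    and l_closed: "\<And>i. 1 \<le> i \<Longrightarrow> i \<le> n \<Longrightarrow> l i \<in> carrier K"
    and alpha_l: "\<And>i. 1 \<le> i \<Longrightarrow> i \<le> n \<Longrightarrow> \<alpha> (l i) = l i"
    and l_comm: "\<And>i a. 1 \<le> i \<Longrightarrow> i \<le> n \<Longrightarrow> a \<in> carrier K \<Longrightarrow> l i \<otimes> a = (\<alpha> ^^ i) a \<otimes> l i"
    and u_center: "u \<in> center K" and alpha_u: "(\<alpha> ^^ n) u = u"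
    and u_unit: "\<And>i. 1 \<le> i \<Longrightarrow> i < n \<Longrightarrow> u \<ominus> (\<alpha> ^^ i) u \<in> Units K"
begin

lemma u_closed: "u \<in> carrier K" and u_comm: "a \<in> carrier K \<Longrightarrow> u \<otimes> a = a \<otimes> u"
  using u_center by (auto simp: center_def)

text \<open>\<open>u \<lambda>\<^sub>i = \<lambda>\<^sub>i u = \<alpha>\<^sup>i(u) \<lambda>\<^sub>i\<close>, and \<open>u - \<alpha>\<^sup>i(u)\<close> is a unit.\<close>

lemma l_middle:
  assumes "1 \<le> i" "i < n" shows "l i = \<zero>"
proof -
  have li: "l i \<in> carrier K" using assms l_closed by simp
  have "(u \<ominus> (\<alpha> ^^ i) u) \<otimes> l i = u \<otimes> l i \<ominus> (\<alpha> ^^ i) u \<otimes> l i"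
    using li u_closed by (simp add: M.minus_eq M.l_distr M.l_minus)
  also have "\<dots> = \<zero>"
    using u_comm[OF li] l_comm[of i u] assms u_closed li by (simp add: M.r_neg M.minus_eq)
  finally have 0: "(u \<ominus> (\<alpha> ^^ i) u) \<otimes> l i = \<zero>" .
  let ?w = "u \<ominus> (\<alpha> ^^ i) u"
  have w: "?w \<in> Units K" using u_unit assms by simp
  have "l i = inv ?w \<otimes> (?w \<otimes> l i)"
    using w li by (simp add: M.m_assoc[symmetric] M.Units_closed)
  then show ?thesis using 0 w by simp
qed

definition c where "c = \<ominus> l n"

lemma ln: "l n \<in> carrier K" using l_closed n_ge_2 by simp
lemma c_closed [simp, intro]: "c \<in> carrier K" using ln by (simp add: c_def)
lemma alpha_c: "\<alpha> c = c"
  using pow_minus[of "l n" 1] ln alpha_l[of n] n_ge_2 by (simp add: c_def)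
lemma c_comm: "a \<in> carrier K \<Longrightarrow> c \<otimes> a = (\<alpha> ^^ n) a \<otimes> c"
  using l_comm[of n a] n_ge_2 ln by (simp add: c_def M.l_minus M.r_minus)
lemma pow_c [simp]: "(\<alpha> ^^ i) c = c"
  by (induction i) (auto simp: alpha_c)
lemma c_pow_closed [simp, intro]: "c [^] (i::nat) \<in> carrier K" by simp
lemma pow_c_pow [simp]: "(\<alpha> ^^ i) (c [^] (j::nat)) = c [^] j"
  by (induction j) (auto simp: pow_mult)
lemma c_pow_comm: "a \<in> carrier K \<Longrightarrow> c [^] j \<otimes> a = (\<alpha> ^^ (j * n)) a \<otimes> c [^] (j::nat)"
proof (induction j arbitrary: a)
  case (Suc j)
  have "c [^] Suc j \<otimes> a = c [^] j \<otimes> (c \<otimes> a)"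
    using Suc.prems by (simp add: M.m_assoc)
  also have "\<dots> = c [^] j \<otimes> (\<alpha> ^^ n) a \<otimes> c"
    using Suc.prems by (simp add: c_comm M.m_assoc)
  also have "\<dots> = (\<alpha> ^^ (j * n)) ((\<alpha> ^^ n) a) \<otimes> c [^] j \<otimes> c"
    using Suc by simp
  finally show ?case using Suc.prems by (simp add: funpow_add M.m_assoc add.commute[of n])
qed simp

lemma poly_eq: "monogenic_poly K \<alpha> n l = mono \<one> n \<oplus>\<^bsub>B\<^esub> mono (l n) 0"
proof -
  let ?t = "\<lambda>i. ore_const K (l i) \<otimes>\<^bsub>B\<^esub> (ore_var K [^]\<^bsub>B\<^esub> (n - i))"
  let ?m = "\<lambda>i. mono (l i) (n - i)"
  have li: "l i \<in> carrier K" if "i \<le> n" for i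
    using that l_0 l_closed[of i] by (cases "i = 0") auto
  have t: "?t i = ?m i" if "i \<le> n" for i
    using that li unfolding const_mono var_mono var_pow by (simp add: mono_mono)
  have "monogenic_poly K \<alpha> n l = finsum B ?t {..n}" by (simp add: monogenic_poly_def)
  also have "\<dots> = finsum B ?m {..n}"
  proof (rule B.finsum_cong')
    show "?m \<in> {..n} \<rightarrow> carrier B" using li by auto
  qed (use t in simp_all)
  also have "\<dots> = finsum B ?m {0, n}"
  proof (rule B.add.finprod_mono_neutral_cong_right)
    fix i assume "i \<in> {..n} - {0, n}"
    then have "l i = \<zero>" by (intro l_middle) auto
    then show "?m i = \<zero>\<^bsub>B\<^esub>" by (simp add: B_zero mono_def)
  qed (use li in auto)
  also have "\<dots> = ?m 0 \<oplus>\<^bsub>B\<^esub> ?m n"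
    using n_ge_2 l_0 ln by (subst B.finsum_insert) auto
  finally show ?thesis using l_0 by simp
qed

text \<open>The coefficient of \<open>x\<^sup>i\<close> after substituting \<open>c\<close> for \<open>x\<^sup>n\<close>. The maps \<open>rho i\<close>, \<open>i < n\<close>, show that
  \<open>A\<close> is no smaller than expected: their common kernel is an ideal containing \<open>f\<close>.\<close>

definition rho :: "nat \<Rightarrow> (nat \<Rightarrow> 'a) \<Rightarrow> 'a" where
  "rho i p = (\<Oplus>j\<in>{j. p (i + j * n) \<noteq> \<zero>}. p (i + j * n) \<otimes> c [^] j)"

lemma rho_eq:
  assumes "p \<in> carrier B" "\<forall>m>N. p m = \<zero>"
  shows "rho i p = (\<Oplus>j\<in>{..N}. p (i + j * n) \<otimes> c [^] j)"
  unfolding rho_def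
proof (rule M.add.finprod_mono_neutral_cong_left)
  show "{j. p (i + j * n) \<noteq> \<zero>} \<subseteq> {..N}"
  proof
    fix j assume "j \<in> {j. p (i + j * n) \<noteq> \<zero>}"
    then have "i + j * n \<le> N" using assms(2) by (auto simp: not_less[symmetric])
    moreover have "j \<le> j * n" using n_ge_2 by (cases n) auto
    ultimately show "j \<in> {..N}" unfolding atMost_iff by linarith
  qed
qed (use assms in \<open>auto simp: up_D\<close>)

lemma rho_closed [simp]: "p \<in> carrier B \<Longrightarrow> rho i p \<in> carrier K"
  unfolding rho_def by (intro M.finsum_closed) (auto simp: up_D)

lemma rho_add: "p \<in> carrier B \<Longrightarrow> q \<in> carrier B \<Longrightarrow> rho i (p \<oplus>\<^bsub>B\<^esub> q) = rho i p \<oplus> rho i q"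
proof -
  assume p: "p \<in> carrier B" and q: "q \<in> carrier B"
  obtain N1 N2 where N1: "\<forall>m>N1. p m = \<zero>" and N2: "\<forall>m>N2. q m = \<zero>"
    using up_bound p q by blast
  let ?N = "max N1 N2"
  have "rho i (p \<oplus>\<^bsub>B\<^esub> q) = (\<Oplus>j\<in>{..?N}. (p \<oplus>\<^bsub>B\<^esub> q) (i + j * n) \<otimes> c [^] j)"
    by (rule rho_eq) (use p q N1 N2 in \<open>auto simp: B_add_closed, auto simp: B_add\<close>)
  also have "\<dots> = (\<Oplus>j\<in>{..?N}. p (i + j * n) \<otimes> c [^] j \<oplus> q (i + j * n) \<otimes> c [^] j)"
    by (rule M.finsum_cong') (use p q in \<open>auto simp: B_add M.l_distr up_D\<close>)
  also have "\<dots> = (\<Oplus>j\<in>{..?N}. p (i + j * n) \<otimes> c [^] j) \<oplus> (\<Oplus>j\<in>{..?N}. q (i + j * n) \<otimes> c [^] j)"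
    by (rule M.finsum_addf) (use p q in \<open>auto simp: up_D\<close>)
  also have "\<dots> = rho i p \<oplus> rho i q"
    using p q N1 N2 by (subst (1 2) rho_eq[where N = ?N]) auto
  finally show ?thesis .
qed

lemma rho_mono:
  assumes "a \<in> carrier K" "i < n"
  shows "rho i (mono a m) = (if m mod n = i then a \<otimes> c [^] (m div n) else \<zero>)"
proof -
  have "{j. mono a m (i + j * n) \<noteq> \<zero>} = (if m mod n = i \<and> a \<noteq> \<zero> then {m div n} else {})"
  proof -
    have "i + j * n = m \<longleftrightarrow> m mod n = i \<and> j = m div n" for j
      using assms(2) n_ge_2 div_mult_mod_eq[of m n] by auto
    then show ?thesis by (auto simp: mono_def)
  qed
  then show ?thesis using assms by (auto simp: rho_def mono_def)
qed

lemma rho_zero [simp]: "rho i (\<lambda>i. \<zero>) = \<zero>" by (simp add: rho_def)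

lemma rho_smult:
  assumes "x \<in> carrier k" "p \<in> carrier B" "i < n"
  shows "rho i (x \<odot>\<^bsub>B\<^esub> p) = x \<odot> rho i p"
  using assms(2)
proof (induction p rule: B_induct)
  case zero
  show ?case using assms by (simp add: B_smult)
next
  case (mono a m)
  have "x \<odot>\<^bsub>B\<^esub> mono a m = mono (x \<odot> a) m" using assms by (auto simp: B_smult mono_def)
  then show ?case using assms mono by (simp add: rho_mono smult_mult_left)
next
  case (add p q)
  interpret BM: Module.module k B by (rule B_module)
  from add assms show ?case by (simp add: rho_add BM.smult_r_distr B_smult_closed smult_r_distr)
qed

text \<open>Multiplication by \<open>x\<^sup>s\<close> permutes the residue classes of exponents modulo \<open>n\<close>, with a carry that
  depends only on the class.\<close>

lemma shift_residue:
  assumes "i < n"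
  obtains i' where "i' < n" "\<And>m. (s + m) mod n = i \<longleftrightarrow> m mod n = i'"
    "\<And>m. m mod n = i' \<Longrightarrow> (s + m) div n = m div n + (i' + s) div n"
proof -
  define d where "d = n - 1"
  \<comment> \<open>Subtracting s modulo n is adding s * (n - 1).\<close>
  define i' where "i' = (i + s * d) mod n"
  have arith: "x + s * d + s = x + s * n" for x
    using n_ge_2 by (cases n) (simp_all add: d_def algebra_simps)
  have a: "i' < n" using n_ge_2 by (simp add: i'_def)
  have b: "(s + m) mod n = i \<longleftrightarrow> m mod n = i'" for m
    unfolding i'_def
  proof
    assume "m mod n = (i + s * d) mod n"
    then have "(s + m) mod n = (i + s * d + s) mod n" by (metis mod_add_cong add.commute)
    then show "(s + m) mod n = i" using assms by (simp add: arith)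
  next
    assume "(s + m) mod n = i"
    then have "(i + s * d) mod n = ((s + m) mod n + s * d) mod n" by simp
    also have "\<dots> = (s + m + s * d) mod n" by (rule mod_add_left_eq)
    also have "s + m + s * d = m + s * d + s" by simp
    finally show "m mod n = (i + s * d) mod n" by (simp add: arith)
  qed
  have c: "(s + m) div n = m div n + (i' + s) div n" if "m mod n = i'" for m
  proof -
    have "s + m = (i' + s) + (m div n) * n"
      using that div_mult_mod_eq[of m n] by linarith
    then have "(s + m) div n = ((i' + s) + (m div n) * n) div n" by (simp only:)
    then show ?thesis using n_ge_2 by simp
  qed
  show thesis by (rule that[OF a]) (fact b, fact c)
qed

text \<open>The coefficients of the product are obtained from those of \<open>p\<close> by twisting and multiplying with a
  power of \<open>c\<close>.\<close>

lemma rho_mono_mult: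
  assumes "a \<in> carrier K" "p \<in> carrier B" "\<And>i. i < n \<Longrightarrow> rho i p = \<zero>" "i < n"
  shows "rho i (mono a s \<otimes>\<^bsub>B\<^esub> p) = \<zero>"
proof -
  obtain i' where i': "i' < n" and iff: "\<And>m. (s + m) mod n = i \<longleftrightarrow> m mod n = i'"
    and div: "\<And>m. m mod n = i' \<Longrightarrow> (s + m) div n = m div n + (i' + s) div n"
    using shift_residue[OF assms(4), of s] by blast
  let ?e = "(i' + s) div n"
  have "rho i (mono a s \<otimes>\<^bsub>B\<^esub> p) = a \<otimes> (\<alpha> ^^ s) (rho i' p) \<otimes> c [^] ?e"
    using assms(2)
  proof (induction p rule: B_induct)
    case zero
    show ?case using assms by (simp add: mult_zero)
  next
    case (mono b m)
    show ?case using mono assms(1,4) i'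
      by (auto simp: div mono_mono rho_mono iff pow_mult M.m_assoc M.nat_pow_mult)
  next
    case (add p q)
    then show ?case using assms(1)
      by (simp add: mult_add_right rho_add B_mult_closed pow_add M.l_distr M.r_distr)
  qed
  then show ?thesis using assms i' by simp
qed

text \<open>Here the scalar \<open>a\<close> has to pass the power of \<open>c\<close> that was substituted for \<open>x\<^bsup>jn\<^esup>\<close>, which
  is possible since \<open>c\<^sup>j a = \<alpha>\<^bsup>jn\<^esup>(a) c\<^sup>j\<close>.\<close>

lemma rho_mult_mono:
  assumes "a \<in> carrier K" "p \<in> carrier B" "\<And>i. i < n \<Longrightarrow> rho i p = \<zero>" "i < n"
  shows "rho i (p \<otimes>\<^bsub>B\<^esub> mono a s) = \<zero>"
proof -
  obtain i' where i': "i' < n" and iff: "\<And>m. (s + m) mod n = i \<longleftrightarrow> m mod n = i'"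
    and div: "\<And>m. m mod n = i' \<Longrightarrow> (s + m) div n = m div n + (i' + s) div n"
    using shift_residue[OF assms(4), of s] by blast
  let ?e = "(i' + s) div n"
  have "rho i (p \<otimes>\<^bsub>B\<^esub> mono a s) = rho i' p \<otimes> (\<alpha> ^^ i') a \<otimes> c [^] ?e"
    using assms(2)
  proof (induction p rule: B_induct)
    case zero
    show ?case using assms by (simp add: zero_mult)
  next
    case (mono b m)
    have "b \<otimes> (\<alpha> ^^ m) a \<otimes> c [^] ((s + m) div n) = b \<otimes> c [^] (m div n) \<otimes> (\<alpha> ^^ i') a \<otimes> c [^] ?e"
      if "m mod n = i'"
    proof -
      have 1: "(s + m) div n = m div n + ?e" using that by (rule div)
      have "m = (m div n) * n + i'" using that div_mult_mod_eq[of m n] by simp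
      then have "(\<alpha> ^^ m) a = (\<alpha> ^^ ((m div n) * n)) ((\<alpha> ^^ i') a)"
        by (metis comp_apply funpow_add)
      then have "(\<alpha> ^^ m) a \<otimes> c [^] (m div n) = c [^] (m div n) \<otimes> (\<alpha> ^^ i') a"
        using assms(1) by (simp add: c_pow_comm)
      then show ?thesis using mono assms(1)
        by (simp add: 1 M.nat_pow_mult[symmetric] M.m_assoc[symmetric]) (simp add: M.m_assoc)
    qed
    then show ?case using mono assms(1,4) i'
      by (auto simp: mono_mono rho_mono iff add.commute[of m])
  next
    case (add p q)
    then show ?case using assms(1)
      by (simp add: mult_add_left rho_add B_mult_closed M.l_distr)
  qed
  then show ?thesis using assms i' by simp
qed

definition J where "J = {p \<in> carrier B. \<forall>i<n. rho i p = \<zero>}"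

lemma J_ideal: "ideal J B"
proof (rule idealI[OF B_ring])
  show "subgroup J (add_monoid B)"
  proof (rule B.add.subgroupI)
    show "J \<noteq> {}" by (auto simp: J_def B_zero_closed intro!: exI[of _ "\<lambda>i. \<zero>"])
    fix p assume p: "p \<in> J"
    then have pc: "p \<in> carrier B" by (simp add: J_def)
    have "rho i (\<ominus>\<^bsub>B\<^esub> p) = \<zero>" if "i < n" for i
    proof -
      have "rho i (\<ominus>\<^bsub>B\<^esub> p \<oplus>\<^bsub>B\<^esub> p) = \<zero>" using pc by (simp add: B.l_neg) (simp add: B_zero)
      then show ?thesis using p pc that by (simp add: rho_add J_def)
    qed
    then show "\<ominus>\<^bsub>B\<^esub> p \<in> J" using pc by (simp add: J_def)
  qed (auto simp: J_def rho_add B_add_closed)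
  fix p q assume p: "p \<in> J" and q: "q \<in> carrier B"
  then have pc: "p \<in> carrier B" by (simp add: J_def)
  have z: "\<And>i. i < n \<Longrightarrow> rho i p = \<zero>" using p by (simp add: J_def)
  show "q \<otimes>\<^bsub>B\<^esub> p \<in> J" using q
  proof (induction q rule: B_induct)
    case (mono a m)
    then show ?case using pc z rho_mono_mult by (simp add: J_def B_mult_closed)
  qed (use pc in \<open>auto simp: J_def zero_mult B_zero_closed mult_add_left rho_add B_mult_closed B_add_closed\<close>)
  show "p \<otimes>\<^bsub>B\<^esub> q \<in> J" using q
  proof (induction q rule: B_induct)
    case (mono a m)
    then show ?case using pc z rho_mult_mono by (simp add: J_def B_mult_closed)
  qed (use pc in \<open>auto simp: J_def mult_zero B_zero_closed mult_add_right rho_add B_mult_closed B_add_closed\<close>)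
qed

definition I where "I = monogenic_ideal K \<alpha> n l"

lemma poly_closed: "monogenic_poly K \<alpha> n l \<in> carrier B"
  using ln by (simp add: poly_eq B_add_closed)
lemma I_ideal: "ideal I B"
  unfolding I_def monogenic_ideal_def using poly_closed by (intro B.genideal_ideal) simp
lemma poly_in_I: "monogenic_poly K \<alpha> n l \<in> I"
  unfolding I_def monogenic_ideal_def using poly_closed B.genideal_self' by simp
lemma I_sub_J: "I \<subseteq> J"
  unfolding I_def monogenic_ideal_def
proof (rule B.genideal_minimal[OF J_ideal])
  have "\<one> \<otimes> c \<oplus> l n = \<zero>" using ln by (simp add: c_def M.l_neg)
  then show "{monogenic_poly K \<alpha> n l} \<subseteq> J"
    using poly_closed ln n_ge_2 by (auto simp: J_def) (auto simp: poly_eq rho_add rho_mono)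
qed

sublocale I: ideal I B by (rule I_ideal)

definition cls where "cls p = I +>\<^bsub>B\<^esub> p"

abbreviation A where "A \<equiv> monogenic_ext K \<alpha> n l"

lemma A_eq: "A = quot_algebra B I" by (simp add: monogenic_ext_def I_def)
lemma A_simps: "carrier A = carrier (B Quot I)" "mult A = mult (B Quot I)" "one A = one (B Quot I)"
  "\<zero>\<^bsub>A\<^esub> = \<zero>\<^bsub>B Quot I\<^esub>" "add A = add (B Quot I)"
  by (simp_all add: A_eq quot_algebra_def)

lemma cls_hom: "cls \<in> ring_hom B A"
  using I.rcos_ring_hom unfolding ring_hom_def cls_def by (auto simp: A_simps)
lemma cls_closed [simp, intro]: "p \<in> carrier B \<Longrightarrow> cls p \<in> carrier A"
  using cls_hom by (auto simp: ring_hom_def)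
lemma cls_add: "p \<in> carrier B \<Longrightarrow> q \<in> carrier B \<Longrightarrow> cls (p \<oplus>\<^bsub>B\<^esub> q) = cls p \<oplus>\<^bsub>A\<^esub> cls q"
  using cls_hom by (rule ring_hom_add)
lemma cls_mult: "p \<in> carrier B \<Longrightarrow> q \<in> carrier B \<Longrightarrow> cls (p \<otimes>\<^bsub>B\<^esub> q) = cls p \<otimes>\<^bsub>A\<^esub> cls q"
  using cls_hom by (rule ring_hom_mult)
lemma cls_one: "cls \<one>\<^bsub>B\<^esub> = \<one>\<^bsub>A\<^esub>"
  using cls_hom by (rule ring_hom_one)
lemma A_cases: "Y \<in> carrier A \<Longrightarrow> (\<And>p. p \<in> carrier B \<Longrightarrow> Y = cls p \<Longrightarrow> thesis) \<Longrightarrow> thesis"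
  by (auto simp: A_simps FactRing_def A_RCOSETS_def' cls_def)
lemma cls_zero: "cls \<zero>\<^bsub>B\<^esub> = \<zero>\<^bsub>A\<^esub>"
  by (simp add: cls_def A_simps FactRing_def I.a_rcos_const[OF I.zero_closed])

lemma A_ring: "ring A"
proof (rule ringI)
  show "abelian_group A"
  proof (rule abelian_groupI)
    fix x assume "x \<in> carrier A"
    then show "\<exists>y\<in>carrier A. y \<oplus>\<^bsub>A\<^esub> x = \<zero>\<^bsub>A\<^esub>"
    proof (rule A_cases)
      fix p assume p: "p \<in> carrier B" "x = cls p"
      then show ?thesis
        by (intro bexI[of _ "cls (\<ominus>\<^bsub>B\<^esub> p)"]) (simp_all add: cls_add[symmetric] cls_zero[symmetric] B.l_neg)
    qed
  qed (auto elim!: A_cases simp: cls_add[symmetric] B.a_ac cls_zero[symmetric])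
  show "Group.monoid A"
    by (rule monoidI) (auto elim!: A_cases simp: cls_mult[symmetric] B.m_assoc cls_one[symmetric])
qed (auto elim!: A_cases simp: cls_add[symmetric] cls_mult[symmetric] B.l_distr B.r_distr)
sublocale A: ring A by (rule A_ring)

lemma cls_eq_iff: "p \<in> carrier B \<Longrightarrow> q \<in> carrier B \<Longrightarrow> cls p = cls q \<longleftrightarrow> p \<ominus>\<^bsub>B\<^esub> q \<in> I"
  unfolding cls_def using B.quotient_eq_iff_same_a_r_cos[OF I_ideal] by simp

lemma I_smult: "x \<in> carrier k \<Longrightarrow> p \<in> I \<Longrightarrow> x \<odot>\<^bsub>B\<^esub> p \<in> I"
proof -
  assume x: "x \<in> carrier k" and p: "p \<in> I"
  interpret BA: assoc_algebra k B by (rule B_algebra)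
  have pc: "p \<in> carrier B" using p I.a_subset by blast
  have "x \<odot>\<^bsub>B\<^esub> p = (x \<odot>\<^bsub>B\<^esub> \<one>\<^bsub>B\<^esub>) \<otimes>\<^bsub>B\<^esub> p" using x pc by (simp add: BA.smult_mult_left)
  then show ?thesis using I.I_l_closed[OF p] x by simp
qed

lemma cls_smult: "x \<in> carrier k \<Longrightarrow> p \<in> carrier B \<Longrightarrow> x \<odot>\<^bsub>A\<^esub> cls p = cls (x \<odot>\<^bsub>B\<^esub> p)"
proof -
  assume x: "x \<in> carrier k" and p: "p \<in> carrier B"
  interpret BA: assoc_algebra k B by (rule B_algebra)
  have "I +>\<^bsub>B\<^esub> (x \<odot>\<^bsub>B\<^esub> y) = cls (x \<odot>\<^bsub>B\<^esub> p)" if "y \<in> I +>\<^bsub>B\<^esub> p" for y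
  proof -
    obtain i where i: "i \<in> I" "y = i \<oplus>\<^bsub>B\<^esub> p" using \<open>y \<in> I +>\<^bsub>B\<^esub> p\<close> by (auto simp: a_r_coset_def')
    have ic: "i \<in> carrier B" using i I.a_subset by blast
    have "x \<odot>\<^bsub>B\<^esub> y \<ominus>\<^bsub>B\<^esub> x \<odot>\<^bsub>B\<^esub> p = x \<odot>\<^bsub>B\<^esub> i"
      using x p ic i by (simp add: BA.smult_r_distr B.minus_eq B.a_assoc B.r_neg)
    then show ?thesis using cls_eq_iff[of "x \<odot>\<^bsub>B\<^esub> y" "x \<odot>\<^bsub>B\<^esub> p"] I_smult[OF x i(1)] x p ic i
      by (simp add: cls_def)
  qed
  then have 1: "(\<Union>y\<in>I +>\<^bsub>B\<^esub> p. I +>\<^bsub>B\<^esub> (x \<odot>\<^bsub>B\<^esub> y)) = (\<Union>y\<in>I +>\<^bsub>B\<^esub> p. cls (x \<odot>\<^bsub>B\<^esub> p))"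
    by (intro SUP_cong refl)
  have "p \<in> I +>\<^bsub>B\<^esub> p" using p by (rule I.a_rcos_self)
  then have "I +>\<^bsub>B\<^esub> p \<noteq> {}" by (intro notI) simp
  then have 2: "(\<Union>y\<in>I +>\<^bsub>B\<^esub> p. cls (x \<odot>\<^bsub>B\<^esub> p)) = cls (x \<odot>\<^bsub>B\<^esub> p)"
    by (rule SUP_const)
  show ?thesis unfolding A_eq quot_algebra_def cls_def[of p] using 1 2 by simp
qed

lemma A_algebra: "assoc_algebra k A"
proof -
  interpret BA: assoc_algebra k B by (rule B_algebra)
  note [simp] = cls_smult cls_add[symmetric] cls_mult[symmetric]
  have "Module.module k A"
    by (rule moduleI) (auto elim!: A_cases simp: R.is_cring A.abelian_group_axioms
      BA.smult_l_distr BA.smult_r_distr BA.smult_assoc1)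
  then show ?thesis
    by (intro assoc_algebra.intro assoc_algebra_axioms.intro A_ring)
      (auto elim!: A_cases simp: BA.smult_mult_left BA.smult_mult_right)
qed

text \<open>The coordinates of an element of \<open>A\<close> with respect to the \<open>K\<close>-basis \<open>1, x, \<dots>, x\<^sup>n\<^sup>-\<^sup>1\<close>. By
  \<open>I_sub_J\<close> they are independent of the chosen representative (\<open>coef_cls\<close>).\<close>

definition coef where "coef i Y = rho i (SOME p. p \<in> carrier B \<and> cls p = Y)"

lemma coef_cls:
  assumes "p \<in> carrier B" "i < n" shows "coef i (cls p) = rho i p"
proof -
  let ?q = "SOME q. q \<in> carrier B \<and> cls q = cls p"
  have q: "?q \<in> carrier B \<and> cls ?q = cls p" by (rule someI[of _ p]) (use assms in auto)
  then have "?q \<ominus>\<^bsub>B\<^esub> p \<in> J" using cls_eq_iff assms I_sub_J by blast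
  then have "rho i (?q \<ominus>\<^bsub>B\<^esub> p) = \<zero>" using assms by (simp add: J_def)
  moreover have "rho i ((?q \<ominus>\<^bsub>B\<^esub> p) \<oplus>\<^bsub>B\<^esub> p) = rho i (?q \<ominus>\<^bsub>B\<^esub> p) \<oplus> rho i p"
    using q assms by (intro rho_add) auto
  moreover have "(?q \<ominus>\<^bsub>B\<^esub> p) \<oplus>\<^bsub>B\<^esub> p = ?q"
    using q assms by (simp add: B.minus_eq B.a_assoc B.l_neg)
  ultimately show ?thesis using assms by (simp add: coef_def)
qed

definition emb where "emb a = monogenic_const K \<alpha> n l a"
definition X where "X = monogenic_var K \<alpha> n l"

lemma emb_cls: "emb a = cls (mono a 0)"
  by (simp add: emb_def monogenic_const_def cls_def I_def const_mono)
lemma X_cls: "X = cls (mono \<one> 1)"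
  by (simp add: X_def monogenic_var_def cls_def I_def var_mono)
lemma X_pow: "X [^]\<^bsub>A\<^esub> m = cls (mono \<one> m)"
proof (induction m)
  case 0 show ?case using cls_one by (simp add: B_one)
next
  case (Suc m)
  then show ?case by (simp add: X_cls cls_mult[symmetric] mono_mono)
qed


lemma emb_closed [simp, intro]: "a \<in> carrier K \<Longrightarrow> emb a \<in> carrier A"
  by (simp add: emb_cls)
lemma X_closed [simp, intro]: "X \<in> carrier A"
  by (simp add: X_cls)
lemma emb_X_pow: "a \<in> carrier K \<Longrightarrow> emb a \<otimes>\<^bsub>A\<^esub> X [^]\<^bsub>A\<^esub> (m::nat) = cls (mono a m)"
  by (simp add: emb_cls X_pow cls_mult[symmetric] mono_mono)
lemma emb_hom: "emb \<in> ring_hom K A"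
proof (rule ring_hom_memI)
  fix a b assume ab: "a \<in> carrier K" "b \<in> carrier K"
  then show "emb (a \<otimes> b) = emb a \<otimes>\<^bsub>A\<^esub> emb b"
    by (simp add: emb_cls cls_mult[symmetric] mono_mono)
  have "mono (a \<oplus> b) 0 = mono a 0 \<oplus>\<^bsub>B\<^esub> mono b 0" using ab by (auto simp: mono_def B_add)
  then show "emb (a \<oplus> b) = emb a \<oplus>\<^bsub>A\<^esub> emb b"
    using ab by (simp add: emb_cls cls_add)
qed (auto simp: emb_cls cls_one[symmetric] B_one)
lemma emb_smult: "x \<in> carrier k \<Longrightarrow> a \<in> carrier K \<Longrightarrow> emb (x \<odot> a) = x \<odot>\<^bsub>A\<^esub> emb a"
proof -
  assume *: "x \<in> carrier k" "a \<in> carrier K"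
  then have "mono (x \<odot> a) 0 = x \<odot>\<^bsub>B\<^esub> mono a 0" by (auto simp: mono_def B_smult)
  then show ?thesis using * by (simp add: emb_cls cls_smult)
qed
lemma X_pow_emb: "a \<in> carrier K \<Longrightarrow> X [^]\<^bsub>A\<^esub> (m::nat) \<otimes>\<^bsub>A\<^esub> emb a = emb ((\<alpha> ^^ m) a) \<otimes>\<^bsub>A\<^esub> X [^]\<^bsub>A\<^esub> m"
  by (simp add: emb_X_pow) (simp add: emb_cls X_pow cls_mult[symmetric] mono_mono)
lemma X_pow_n: "X [^]\<^bsub>A\<^esub> n = emb c"
proof -
  have "mono \<one> n \<ominus>\<^bsub>B\<^esub> mono c 0 = monogenic_poly K \<alpha> n l"
  proof -
    have "\<ominus>\<^bsub>B\<^esub> mono c 0 = mono (l n) 0"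
    proof (rule B.minus_equality)
      show "mono (l n) 0 \<oplus>\<^bsub>B\<^esub> mono c 0 = \<zero>\<^bsub>B\<^esub>"
        using ln by (auto simp: B_add B_zero mono_def c_def M.r_neg)
    qed (use ln in auto)
    then show ?thesis by (simp add: poly_eq a_minus_def)
  qed
  then show ?thesis using cls_eq_iff[of "mono \<one> n" "mono c 0"] poly_in_I
    by (simp add: X_pow emb_cls)
qed

lemma A_induct [consumes 1, case_names mono add]:
  assumes "Y \<in> carrier A" "\<And>a m. a \<in> carrier K \<Longrightarrow> Q (emb a \<otimes>\<^bsub>A\<^esub> X [^]\<^bsub>A\<^esub> (m::nat))"
    "\<And>x y. x \<in> carrier A \<Longrightarrow> y \<in> carrier A \<Longrightarrow> Q x \<Longrightarrow> Q y \<Longrightarrow> Q (x \<oplus>\<^bsub>A\<^esub> y)"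
  shows "Q Y"
proof -
  obtain p where p: "p \<in> carrier B" "Y = cls p" using assms(1) by (rule A_cases)
  have "Q (cls p)" using p(1)
  proof (induction p rule: B_induct)
    case zero
    have "mono \<zero> 0 = (\<lambda>i. \<zero>)" by (simp add: mono_def)
    then show ?case using assms(2)[of \<zero> 0] by (simp only: emb_X_pow M.zero_closed)
  next
    case (mono a m)
    then show ?case using assms(2)[of a m] by (simp add: emb_X_pow)
  next
    case (add p q)
    then show ?case using assms(3) by (simp add: cls_add)
  qed
  then show ?thesis using p by simp
qed

lemma coef_closed [simp, intro]: "Y \<in> carrier A \<Longrightarrow> i < n \<Longrightarrow> coef i Y \<in> carrier K"
  by (erule A_cases) (simp add: coef_cls)
lemma coef_add: "Y \<in> carrier A \<Longrightarrow> Z \<in> carrier A \<Longrightarrow> i < n \<Longrightarrow> coef i (Y \<oplus>\<^bsub>A\<^esub> Z) = coef i Y \<oplus> coef i Z"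
  by (elim A_cases) (simp add: cls_add[symmetric] coef_cls rho_add B_add_closed)
lemma coef_smult: "x \<in> carrier k \<Longrightarrow> Y \<in> carrier A \<Longrightarrow> i < n \<Longrightarrow> coef i (x \<odot>\<^bsub>A\<^esub> Y) = x \<odot> coef i Y"
  by (elim A_cases) (simp add: cls_smult coef_cls rho_smult B_smult_closed)
lemma coef_mono: "a \<in> carrier K \<Longrightarrow> i < n \<Longrightarrow> coef i (emb a \<otimes>\<^bsub>A\<^esub> X [^]\<^bsub>A\<^esub> (m::nat)) =
    (if m mod n = i then a \<otimes> c [^] (m div n) else \<zero>)"
  by (simp add: emb_X_pow coef_cls rho_mono)
lemma coef_emb: "a \<in> carrier K \<Longrightarrow> i < n \<Longrightarrow> coef i (emb a) = (if i = 0 then a else \<zero>)"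
  using coef_mono[of a i 0] by simp
lemma coef_X_pow: "i < n \<Longrightarrow> coef i (X [^]\<^bsub>A\<^esub> (m::nat)) = (if m mod n = i then c [^] (m div n) else \<zero>)"
  using coef_mono[of \<one> i m] ring_hom_one[OF emb_hom] by simp
lemma coef_emb_mult:
  assumes "a \<in> carrier K" "Y \<in> carrier A" "i < n"
  shows "coef i (emb a \<otimes>\<^bsub>A\<^esub> Y) = a \<otimes> coef i Y"
  using assms(2)
proof (induction Y rule: A_induct)
  case (mono b m)
  then have "emb a \<otimes>\<^bsub>A\<^esub> (emb b \<otimes>\<^bsub>A\<^esub> X [^]\<^bsub>A\<^esub> m) = emb (a \<otimes> b) \<otimes>\<^bsub>A\<^esub> X [^]\<^bsub>A\<^esub> m"
    using assms by (simp add: ring_hom_mult[OF emb_hom] A.m_assoc)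
  then show ?case using assms mono by (simp add: coef_mono M.m_assoc)
next
  case (add x y)
  then show ?case using assms by (simp add: A.r_distr coef_add M.r_distr)
qed
lemma coef_mult_emb:
  assumes "a \<in> carrier K" "Y \<in> carrier A" "i < n"
  shows "coef i (Y \<otimes>\<^bsub>A\<^esub> emb a) = coef i Y \<otimes> (\<alpha> ^^ i) a"
  using assms(2)
proof (induction Y rule: A_induct)
  case (mono b m)
  then have 1: "emb b \<otimes>\<^bsub>A\<^esub> X [^]\<^bsub>A\<^esub> m \<otimes>\<^bsub>A\<^esub> emb a = emb (b \<otimes> (\<alpha> ^^ m) a) \<otimes>\<^bsub>A\<^esub> X [^]\<^bsub>A\<^esub> m"
    using assms by (simp add: ring_hom_mult[OF emb_hom] A.m_assoc X_pow_emb)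
  have "(\<alpha> ^^ m) a \<otimes> c [^] (m div n) = c [^] (m div n) \<otimes> (\<alpha> ^^ (m mod n)) a"
  proof -
    have "(\<alpha> ^^ m) a = (\<alpha> ^^ ((m div n) * n)) ((\<alpha> ^^ (m mod n)) a)"
      by (metis comp_apply div_mult_mod_eq funpow_add)
    then show ?thesis using assms by (simp add: c_pow_comm)
  qed
  then show ?case using assms mono by (simp add: 1 coef_mono M.m_assoc)
next
  case (add x y)
  then show ?case using assms by (simp add: A.l_distr coef_add M.l_distr)
qed

lemma top_eq: "monogenic_top K \<alpha> n l a = emb a \<otimes>\<^bsub>A\<^esub> X [^]\<^bsub>A\<^esub> (n - 1)"
  by (simp add: monogenic_top_def emb_def X_def Let_def)

end


section \<open>Linear algebra over a commutative ring\<close>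

lemma submodule_zero: "submodule N k M \<Longrightarrow> \<zero>\<^bsub>M\<^esub> \<in> N"
  using submodule.axioms(1) subgroup.one_closed by fastforce

lemma (in Module.module) span_mod_submodule:
  assumes "S \<subseteq> carrier M" shows "submodule (span_mod R M S) R M"
proof (rule submoduleI)
  have top: "submodule (carrier M) R M" by (rule carrier_is_submodule)
  show "span_mod R M S \<subseteq> carrier M" using top assms by (auto simp: span_mod_def)
  show "\<zero>\<^bsub>M\<^esub> \<in> span_mod R M S" by (auto simp: span_mod_def intro: submodule_zero)
  fix a assume "a \<in> span_mod R M S"
  then show "\<ominus>\<^bsub>M\<^esub> a \<in> span_mod R M S" by (auto simp: span_mod_def intro: submoduleE(3))
  fix b assume "b \<in> span_mod R M S"
  with \<open>a \<in> span_mod R M S\<close> show "a \<oplus>\<^bsub>M\<^esub> b \<in> span_mod R M S"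
    by (auto simp: span_mod_def intro: submoduleE(5))
next
  fix a x assume "a \<in> carrier R" "x \<in> span_mod R M S"
  then show "a \<odot>\<^bsub>M\<^esub> x \<in> span_mod R M S" by (auto simp: span_mod_def intro: submoduleE(4))
qed

lemma span_mod_superset: "S \<subseteq> span_mod k M S"
  by (auto simp: span_mod_def)
lemma span_mod_least: "submodule H k M \<Longrightarrow> S \<subseteq> H \<Longrightarrow> span_mod k M S \<subseteq> H"
  by (auto simp: span_mod_def)

definition linear_map ::
  "('k, 'r) ring_scheme \<Rightarrow> ('k, 'v, 'm) module_scheme \<Rightarrow> ('k, 'w, 'n) module_scheme \<Rightarrow> ('v \<Rightarrow> 'w) \<Rightarrow> bool" where
  "linear_map k M N f \<longleftrightarrow> f \<in> carrier M \<rightarrow> carrier N \<and>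
     (\<forall>x\<in>carrier M. \<forall>y\<in>carrier M. f (x \<oplus>\<^bsub>M\<^esub> y) = f x \<oplus>\<^bsub>N\<^esub> f y) \<and>
     (\<forall>c\<in>carrier k. \<forall>x\<in>carrier M. f (c \<odot>\<^bsub>M\<^esub> x) = c \<odot>\<^bsub>N\<^esub> f x)"

locale linear = M: Module.module k M + N: Module.module k N
  for k :: "('k, 'r) ring_scheme" and M :: "('k, 'v, 'm) module_scheme" and N :: "('k, 'w, 'n) module_scheme" +
  fixes f :: "'v \<Rightarrow> 'w"
  assumes lin: "linear_map k M N f"
begin

lemma closed [simp, intro]: "x \<in> carrier M \<Longrightarrow> f x \<in> carrier N"
  using lin by (auto simp: linear_map_def)
lemma add: "x \<in> carrier M \<Longrightarrow> y \<in> carrier M \<Longrightarrow> f (x \<oplus>\<^bsub>M\<^esub> y) = f x \<oplus>\<^bsub>N\<^esub> f y"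
  using lin by (auto simp: linear_map_def)
lemma smult: "c \<in> carrier k \<Longrightarrow> x \<in> carrier M \<Longrightarrow> f (c \<odot>\<^bsub>M\<^esub> x) = c \<odot>\<^bsub>N\<^esub> f x"
  using lin by (auto simp: linear_map_def)
lemma zero [simp]: "f \<zero>\<^bsub>M\<^esub> = \<zero>\<^bsub>N\<^esub>"
  using smult[of "\<zero>\<^bsub>k\<^esub>" "\<zero>\<^bsub>M\<^esub>"] by simp
lemma minus: "x \<in> carrier M \<Longrightarrow> f (\<ominus>\<^bsub>M\<^esub> x) = \<ominus>\<^bsub>N\<^esub> f x"
proof -
  assume x: "x \<in> carrier M"
  then have "f (\<ominus>\<^bsub>M\<^esub> x) \<oplus>\<^bsub>N\<^esub> f x = \<zero>\<^bsub>N\<^esub>"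
    using add[of "\<ominus>\<^bsub>M\<^esub> x" x] by (simp add: M.l_neg)
  then show ?thesis using x by (simp add: N.minus_equality)
qed
lemma diff: "x \<in> carrier M \<Longrightarrow> y \<in> carrier M \<Longrightarrow> f (x \<ominus>\<^bsub>M\<^esub> y) = f x \<ominus>\<^bsub>N\<^esub> f y"
  by (simp add: a_minus_def add minus)
lemma finsum: "finite S \<Longrightarrow> g \<in> S \<rightarrow> carrier M \<Longrightarrow> f (finsum M g S) = finsum N (\<lambda>i. f (g i)) S"
  by (induction S rule: finite_induct) (auto simp: add Pi_def M.finsum_closed)

lemma vimage_submodule:
  assumes "submodule H k N" shows "submodule {x \<in> carrier M. f x \<in> H} k M"
  by (rule M.submoduleI)
    (auto simp: add smult minus submodule_zero[OF assms] intro: N.submoduleE(3-5)[OF assms])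

lemma image_submodule:
  assumes "submodule H k M" shows "submodule (f ` H) k N"
proof (rule N.submoduleI)
  have H: "H \<subseteq> carrier M" using assms by (rule M.submoduleE(1))
  then show "f ` H \<subseteq> carrier N" by auto
  show "\<zero>\<^bsub>N\<^esub> \<in> f ` H" using submodule_zero[OF assms] zero by (metis image_eqI)
  fix a assume "a \<in> f ` H"
  then obtain x where x: "x \<in> H" "a = f x" by auto
  show "\<ominus>\<^bsub>N\<^esub> a \<in> f ` H"
    using M.submoduleE(3)[OF assms x(1)] x H minus[of x] by force
  { fix b assume "b \<in> f ` H"
    then obtain y where y: "y \<in> H" "b = f y" by auto
    show "a \<oplus>\<^bsub>N\<^esub> b \<in> f ` H"
      using M.submoduleE(5)[OF assms x(1) y(1)] x y H add[of x y] by force }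
next
  fix c a assume c: "c \<in> carrier k" and "a \<in> f ` H"
  then obtain x where x: "x \<in> H" "a = f x" by auto
  show "c \<odot>\<^bsub>N\<^esub> a \<in> f ` H"
    using M.submoduleE(4)[OF assms c x(1)] x c smult[of c x] M.submoduleE(1)[OF assms] by force
qed

end

subsection \<open>Subquotients\<close>

locale module_with_submodule = Module.module k M
  for k :: "('k, 'r) ring_scheme" and M :: "('k, 'v, 'm) module_scheme" (structure) +
  fixes N :: "'v set"
  assumes sub: "submodule N k M"
begin

abbreviation cl where "cl x \<equiv> N +> x"

lemma N_sub: "N \<subseteq> carrier M" and N_zero: "\<zero> \<in> N" and N_neg: "x \<in> N \<Longrightarrow> \<ominus> x \<in> N"
  and N_smult: "c \<in> carrier k \<Longrightarrow> x \<in> N \<Longrightarrow> c \<odot> x \<in> N"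
  and N_add: "x \<in> N \<Longrightarrow> y \<in> N \<Longrightarrow> x \<oplus> y \<in> N"
  using submoduleE[OF sub] submodule_zero[OF sub] by blast+
lemma N_closed: "x \<in> N \<Longrightarrow> x \<in> carrier M" using N_sub by blast

lemma cl_eq_iff:
  assumes "x \<in> carrier M" "y \<in> carrier M"
  shows "cl x = cl y \<longleftrightarrow> x \<ominus> y \<in> N"
proof
  assume "cl x = cl y"
  moreover have "x \<in> cl x" using assms N_zero by (force simp: a_r_coset_def')
  ultimately obtain z where "z \<in> N" "x = z \<oplus> y" by (auto simp: a_r_coset_def')
  then show "x \<ominus> y \<in> N" using assms N_closed by (simp add: a_minus_def M.a_assoc M.r_neg)
next
  assume *: "x \<ominus> y \<in> N"
  have "cl x \<subseteq> cl y" if "x \<in> carrier M" "y \<in> carrier M" "x \<ominus> y \<in> N" for x y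
  proof
    fix v assume "v \<in> cl x"
    then obtain z where z: "z \<in> N" "v = z \<oplus> x" by (auto simp: a_r_coset_def')
    have "v = (z \<oplus> (x \<ominus> y)) \<oplus> y" using z that N_closed
      by (simp add: a_minus_def M.a_assoc M.l_neg)
    then show "v \<in> cl y" using N_add[OF z(1) that(3)] by (auto simp: a_r_coset_def')
  qed
  moreover have "y \<ominus> x = \<ominus> (x \<ominus> y)" using assms by (simp add: a_minus_def M.minus_add M.a_comm)
  then have "y \<ominus> x \<in> N" using N_neg[OF *] by simp
  ultimately show "cl x = cl y" using assms * by blast
qed

lemma cl_zero: "cl \<zero> = N" using N_sub by (force simp: a_r_coset_def')
lemma cl_eq_N_iff: "x \<in> carrier M \<Longrightarrow> cl x = N \<longleftrightarrow> x \<in> N"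
  using cl_eq_iff[of x \<zero>] M.minus_equality[of \<zero> \<zero>] by (simp add: cl_zero a_minus_def)

lemma cl_add:
  assumes "x \<in> carrier M" "y \<in> carrier M" shows "cl x <+>\<^bsub>M\<^esub> cl y = cl (x \<oplus> y)"
proof
  show "cl x <+>\<^bsub>M\<^esub> cl y \<subseteq> cl (x \<oplus> y)"
  proof
    fix v assume "v \<in> cl x <+>\<^bsub>M\<^esub> cl y"
    then obtain z w where zw: "z \<in> N" "w \<in> N" "v = (z \<oplus> x) \<oplus> (w \<oplus> y)"
      by (auto simp: a_r_coset_def' set_add_def')
    then have "v = (z \<oplus> w) \<oplus> (x \<oplus> y)" using assms N_closed by (simp add: M.a_ac)
    then show "v \<in> cl (x \<oplus> y)" using N_add zw by (auto simp: a_r_coset_def')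
  qed
  show "cl (x \<oplus> y) \<subseteq> cl x <+>\<^bsub>M\<^esub> cl y"
  proof
    fix v assume "v \<in> cl (x \<oplus> y)"
    then obtain z where z: "z \<in> N" "v = z \<oplus> (x \<oplus> y)" by (auto simp: a_r_coset_def')
    then have "v = (z \<oplus> x) \<oplus> (\<zero> \<oplus> y)" using assms N_closed by (simp add: M.a_assoc)
    then show "v \<in> cl x <+>\<^bsub>M\<^esub> cl y" using z N_zero unfolding a_r_coset_def' set_add_def' by blast
  qed
qed

lemma cl_smult:
  assumes "c \<in> carrier k" "x \<in> carrier M" shows "(\<Union>y\<in>cl x. cl (c \<odot> y)) = cl (c \<odot> x)"
proof -
  have "cl (c \<odot> y) = cl (c \<odot> x)" if y: "y \<in> cl x" for y
  proof -
    obtain z where z: "z \<in> N" "y = z \<oplus> x" using y by (auto simp: a_r_coset_def')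
    then have "c \<odot> y \<ominus> c \<odot> x = c \<odot> z" using assms N_closed
      by (simp add: smult_r_distr a_minus_def M.a_assoc M.r_neg)
    then show ?thesis using z assms N_closed N_smult by (simp add: cl_eq_iff)
  qed
  moreover have "x \<in> cl x" using assms N_zero by (force simp: a_r_coset_def')
  ultimately show ?thesis by blast
qed

lemma subquot_simps:
  "carrier (subquot M S N) = {cl s | s. s \<in> S}" "\<zero>\<^bsub>subquot M S N\<^esub> = N"
  "x \<in> carrier M \<Longrightarrow> y \<in> carrier M \<Longrightarrow> cl x \<oplus>\<^bsub>subquot M S N\<^esub> cl y = cl (x \<oplus> y)"
  "c \<in> carrier k \<Longrightarrow> x \<in> carrier M \<Longrightarrow> c \<odot>\<^bsub>subquot M S N\<^esub> cl x = cl (c \<odot> x)"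
  by (simp_all add: subquot_def cl_add cl_smult)

abbreviation Qm where "Qm \<equiv> subquot M (carrier M) N"

lemma Q_cases: "Y \<in> carrier Qm \<Longrightarrow> (\<And>x. x \<in> carrier M \<Longrightarrow> Y = cl x \<Longrightarrow> thesis) \<Longrightarrow> thesis"
  by (auto simp: subquot_simps)
lemma cl_closed [simp, intro]: "x \<in> carrier M \<Longrightarrow> cl x \<in> carrier Qm"
  by (auto simp: subquot_simps)

lemma Q_zero: "\<zero>\<^bsub>Qm\<^esub> = cl \<zero>" by (simp add: subquot_simps cl_zero)

lemma Q_module: "Module.module k Qm"
proof (rule moduleI)
  show "abelian_group Qm"
  proof (rule abelian_groupI)
    fix Y assume "Y \<in> carrier Qm"
    then show "\<exists>Z\<in>carrier Qm. Z \<oplus>\<^bsub>Qm\<^esub> Y = \<zero>\<^bsub>Qm\<^esub>"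
    proof (rule Q_cases)
      fix x assume "x \<in> carrier M" "Y = cl x"
      then show ?thesis by (intro bexI[of _ "cl (\<ominus> x)"]) (auto simp: subquot_simps(3) Q_zero M.l_neg)
    qed
  qed (auto elim!: Q_cases simp: subquot_simps(3) M.a_ac Q_zero)
qed (auto elim!: Q_cases simp: R.is_cring subquot_simps(3,4) smult_l_distr smult_r_distr smult_assoc1)

lemma cl_linear: "linear_map k M Qm cl"
  by (auto simp: linear_map_def subquot_simps(3,4))

end

text \<open>An isomorphism of subquotients may be given by a map \<open>\<phi>\<close> on representatives that respects
  the operations on the nose, identifies the denominators, and reaches every class.\<close>

lemma module_iso_subquot:
  assumes 1: "module_with_submodule k M1 N1" and 2: "module_with_submodule k M2 N2"
    and S1: "S1 \<subseteq> carrier M1" and S2: "submodule S2 k M2"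
    and \<phi>: "\<And>a. a \<in> S2 \<Longrightarrow> \<phi> a \<in> S1"
    and add: "\<And>a b. a \<in> S2 \<Longrightarrow> b \<in> S2 \<Longrightarrow> \<phi> (a \<oplus>\<^bsub>M2\<^esub> b) = \<phi> a \<oplus>\<^bsub>M1\<^esub> \<phi> b"
    and smult: "\<And>c a. c \<in> carrier k \<Longrightarrow> a \<in> S2 \<Longrightarrow> \<phi> (c \<odot>\<^bsub>M2\<^esub> a) = c \<odot>\<^bsub>M1\<^esub> \<phi> a"
    and ker: "\<And>a. a \<in> S2 \<Longrightarrow> \<phi> a \<in> N1 \<longleftrightarrow> a \<in> N2"
    and surj: "\<And>s. s \<in> S1 \<Longrightarrow> \<exists>a\<in>S2. s \<ominus>\<^bsub>M1\<^esub> \<phi> a \<in> N1"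
  shows "module_iso k (subquot M1 S1 N1) (subquot M2 S2 N2)"
proof -
  interpret M1: module_with_submodule k M1 N1 by fact
  interpret M2: module_with_submodule k M2 N2 by fact
  note S2' = M2.submoduleE[OF S2]
  have S2c: "a \<in> carrier M2" if "a \<in> S2" for a using S2'(1) that by blast
  have pc: "\<phi> a \<in> carrier M1" if "a \<in> S2" for a using \<phi>[OF that] S1 by blast
  have diff: "\<phi> (a \<ominus>\<^bsub>M2\<^esub> b) = \<phi> a \<ominus>\<^bsub>M1\<^esub> \<phi> b" if "a \<in> S2" "b \<in> S2" for a b
  proof -
    have d: "a \<ominus>\<^bsub>M2\<^esub> b \<in> S2" using that S2' by (simp add: a_minus_def)
    have "(a \<ominus>\<^bsub>M2\<^esub> b) \<oplus>\<^bsub>M2\<^esub> b = a" using that S2c by (simp add: a_minus_def M2.a_assoc M2.l_neg)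
    then have "\<phi> (a \<ominus>\<^bsub>M2\<^esub> b) \<oplus>\<^bsub>M1\<^esub> \<phi> b = \<phi> a" using add[OF d that(2)] by simp
    then have "\<phi> a \<ominus>\<^bsub>M1\<^esub> \<phi> b = (\<phi> (a \<ominus>\<^bsub>M2\<^esub> b) \<oplus>\<^bsub>M1\<^esub> \<phi> b) \<ominus>\<^bsub>M1\<^esub> \<phi> b" by (simp only:)
    also have "\<dots> = \<phi> (a \<ominus>\<^bsub>M2\<^esub> b)"
      using pc[OF d] pc[OF that(2)] unfolding a_minus_def[of M1] by (simp add: M1.a_assoc M1.r_neg)
    finally show ?thesis by simp
  qed
  have eq_iff: "M1.cl (\<phi> a) = M1.cl (\<phi> b) \<longleftrightarrow> M2.cl a = M2.cl b" if "a \<in> S2" "b \<in> S2" for a b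
  proof -
    have "a \<ominus>\<^bsub>M2\<^esub> b \<in> S2" using that S2' by (simp add: a_minus_def)
    then show ?thesis using that ker[of "a \<ominus>\<^bsub>M2\<^esub> b"]
      by (simp add: M1.cl_eq_iff M2.cl_eq_iff pc S2c diff)
  qed
  \<comment> \<open>The inverse direction: h sends the class of phi a to the class of a.\<close>
  define h where "h Y = M2.cl (SOME a. a \<in> S2 \<and> Y = M1.cl (\<phi> a))" for Y
  have h: "h (M1.cl (\<phi> a)) = M2.cl a" if "a \<in> S2" for a
  proof -
    let ?b = "SOME b. b \<in> S2 \<and> M1.cl (\<phi> a) = M1.cl (\<phi> b)"
    have "?b \<in> S2 \<and> M1.cl (\<phi> a) = M1.cl (\<phi> ?b)" by (rule someI[of _ a]) (use that in auto)
    then show ?thesis using eq_iff[OF that, of ?b] by (auto simp: h_def)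
  qed
  have cases: "\<exists>a\<in>S2. Y = M1.cl (\<phi> a)" if Y: "Y \<in> carrier (subquot M1 S1 N1)" for Y
  proof -
    obtain s where s: "s \<in> S1" "Y = M1.cl s" using Y by (auto simp: M1.subquot_simps)
    obtain a where a: "a \<in> S2" "s \<ominus>\<^bsub>M1\<^esub> \<phi> a \<in> N1" using surj[OF s(1)] by blast
    moreover have "M1.cl s = M1.cl (\<phi> a)"
      using s S1 pc[OF a(1)] a(2) by (subst M1.cl_eq_iff) auto
    ultimately show ?thesis using s by auto
  qed
  show ?thesis unfolding module_iso_def
  proof (intro exI[of _ h] conjI ballI)
    show "bij_betw h (carrier (subquot M1 S1 N1)) (carrier (subquot M2 S2 N2))"
    proof (rule bij_betwI')
      fix Y Z assume "Y \<in> carrier (subquot M1 S1 N1)" "Z \<in> carrier (subquot M1 S1 N1)"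
      then obtain a b where "a \<in> S2" "b \<in> S2" "Y = M1.cl (\<phi> a)" "Z = M1.cl (\<phi> b)"
        using cases by blast
      then show "(h Y = h Z) = (Y = Z)" by (simp add: h eq_iff)
    next
      fix Y assume "Y \<in> carrier (subquot M1 S1 N1)"
      then obtain a where "a \<in> S2" "Y = M1.cl (\<phi> a)" using cases by blast
      then show "h Y \<in> carrier (subquot M2 S2 N2)" by (auto simp: h M2.subquot_simps)
    next
      fix Z assume "Z \<in> carrier (subquot M2 S2 N2)"
      then obtain a where "a \<in> S2" "Z = M2.cl a" by (auto simp: M2.subquot_simps)
      then show "\<exists>Y\<in>carrier (subquot M1 S1 N1). Z = h Y"
        by (intro bexI[of _ "M1.cl (\<phi> a)"]) (auto simp: h M1.subquot_simps \<phi>)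
    qed
  next
    fix Y Z assume "Y \<in> carrier (subquot M1 S1 N1)" "Z \<in> carrier (subquot M1 S1 N1)"
    then obtain a b where ab: "a \<in> S2" "b \<in> S2" "Y = M1.cl (\<phi> a)" "Z = M1.cl (\<phi> b)"
      using cases by blast
    then show "h (Y \<oplus>\<^bsub>subquot M1 S1 N1\<^esub> Z) = h Y \<oplus>\<^bsub>subquot M2 S2 N2\<^esub> h Z"
      using h[of "a \<oplus>\<^bsub>M2\<^esub> b"] S2'(5)
      by (simp add: h M1.subquot_simps(3) M2.subquot_simps(3) pc S2c add)
  next
    fix c Y assume c: "c \<in> carrier k" "Y \<in> carrier (subquot M1 S1 N1)"
    then obtain a where ab: "a \<in> S2" "Y = M1.cl (\<phi> a)"
      using cases by blast
    then show "h (c \<odot>\<^bsub>subquot M1 S1 N1\<^esub> Y) = c \<odot>\<^bsub>subquot M2 S2 N2\<^esub> h Y"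
      using h[of "c \<odot>\<^bsub>M2\<^esub> a"] S2'(4) c
      by (simp add: h M1.subquot_simps(4) M2.subquot_simps(4) pc S2c smult)
  qed
qed

subsection \<open>Free modules\<close>

context cring
begin

lemma free_simps:
  "carrier (free_mod R G) = {u. (\<forall>g. u g \<in> carrier R) \<and> (\<forall>g. g \<notin> G \<longrightarrow> u g = \<zero>) \<and> finite {g. u g \<noteq> \<zero>}}"
  "\<zero>\<^bsub>free_mod R G\<^esub> = (\<lambda>g. \<zero>)"
  "u \<oplus>\<^bsub>free_mod R G\<^esub> v = (\<lambda>g. u g \<oplus> v g)"
  "x \<odot>\<^bsub>free_mod R G\<^esub> u = (\<lambda>g. x \<otimes> u g)"
  by (simp_all add: free_mod_def)

lemma free_add_closed: "u \<in> carrier (free_mod R G) \<Longrightarrow> v \<in> carrier (free_mod R G) \<Longrightarrow>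
   (\<lambda>g. u g \<oplus> v g) \<in> carrier (free_mod R G)"
proof -
  assume u: "u \<in> carrier (free_mod R G)" and v: "v \<in> carrier (free_mod R G)"
  have "{g. u g \<oplus> v g \<noteq> \<zero>} \<subseteq> {g. u g \<noteq> \<zero>} \<union> {g. v g \<noteq> \<zero>}" by auto
  then show ?thesis using u v by (auto simp: free_simps elim: finite_subset)
qed

lemma free_smult_closed: "x \<in> carrier R \<Longrightarrow> u \<in> carrier (free_mod R G) \<Longrightarrow>
   (\<lambda>g. x \<otimes> u g) \<in> carrier (free_mod R G)"
proof -
  assume x: "x \<in> carrier R" and u: "u \<in> carrier (free_mod R G)"
  have "{g. x \<otimes> u g \<noteq> \<zero>} \<subseteq> {g. u g \<noteq> \<zero>}" using x by auto
  then show ?thesis using x u by (auto simp: free_simps elim: finite_subset)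
qed

lemma free_module: "Module.module R (free_mod R G)"
proof (rule moduleI)
  show "abelian_group (free_mod R G)"
  proof (rule abelian_groupI)
    fix u assume u: "u \<in> carrier (free_mod R G)"
    have "(\<lambda>g. \<ominus> u g) \<in> carrier (free_mod R G)"
    proof -
      have "(\<lambda>g. \<ominus> u g) = (\<lambda>g. \<ominus> \<one> \<otimes> u g)" using u by (auto simp: free_simps l_minus)
      then show ?thesis using free_smult_closed[of "\<ominus> \<one>" u] u by simp
    qed
    moreover have "(\<lambda>g. \<ominus> u g) \<oplus>\<^bsub>free_mod R G\<^esub> u = \<zero>\<^bsub>free_mod R G\<^esub>"
      using u by (auto simp: free_simps l_neg)
    ultimately show "\<exists>v\<in>carrier (free_mod R G). v \<oplus>\<^bsub>free_mod R G\<^esub> u = \<zero>\<^bsub>free_mod R G\<^esub>" by blast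
  qed (simp_all add: free_simps(2-) free_add_closed, simp_all add: free_simps a_ac)
qed (simp_all add: is_cring free_simps(3-) free_smult_closed, simp_all add: free_simps l_distr r_distr m_assoc)

lemma free_gen_closed: "g \<in> G \<Longrightarrow> free_gen R g \<in> carrier (free_mod R G)"
proof -
  assume "g \<in> G"
  moreover have "{h. free_gen R g h \<noteq> \<zero>} \<subseteq> {g}" by (auto simp: free_gen_def)
  ultimately show ?thesis by (auto simp: free_simps free_gen_def elim: finite_subset)
qed

lemma free_induct [consumes 1, case_names zero gen add]:
  assumes "u \<in> carrier (free_mod R G)" "Q \<zero>\<^bsub>free_mod R G\<^esub>"
    "\<And>x g. x \<in> carrier R \<Longrightarrow> g \<in> G \<Longrightarrow> Q (x \<odot>\<^bsub>free_mod R G\<^esub> free_gen R g)"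
    "\<And>u v. u \<in> carrier (free_mod R G) \<Longrightarrow> v \<in> carrier (free_mod R G) \<Longrightarrow> Q u \<Longrightarrow> Q v \<Longrightarrow>
       Q (u \<oplus>\<^bsub>free_mod R G\<^esub> v)"
  shows "Q u"
proof -
  have "Q u" if "finite S" "u \<in> carrier (free_mod R G)" "{g. u g \<noteq> \<zero>} \<subseteq> S" for S u
    using that
  proof (induction S arbitrary: u rule: finite_induct)
    case empty
    then have "u = \<zero>\<^bsub>free_mod R G\<^esub>" by (auto simp: free_simps)
    then show ?case using assms(2) by simp
  next
    case (insert g S)
    let ?v = "\<lambda>h. if h = g then \<zero> else u h"
    have "{h. ?v h \<noteq> \<zero>} \<subseteq> {h. u h \<noteq> \<zero>}" by auto
    then have "finite {h. ?v h \<noteq> \<zero>}" by (rule finite_subset) (use insert.prems(1) in \<open>simp add: free_simps\<close>)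
    then have v: "?v \<in> carrier (free_mod R G)"
      unfolding free_simps(1) mem_Collect_eq using insert.prems(1) by (intro conjI allI) (simp_all add: free_simps)
    have Qv: "Q ?v" using insert.prems v by (intro insert.IH) auto
    show ?case
    proof (cases "g \<in> G")
      case True
      have "u = ?v \<oplus>\<^bsub>free_mod R G\<^esub> (u g \<odot>\<^bsub>free_mod R G\<^esub> free_gen R g)"
        using insert.prems(1) by (auto simp: free_simps free_gen_def fun_eq_iff)
      moreover have "u g \<in> carrier R" using insert.prems(1) by (auto simp: free_simps)
      moreover have "u g \<odot>\<^bsub>free_mod R G\<^esub> free_gen R g \<in> carrier (free_mod R G)"
        using calculation(2) free_gen_closed[OF True] free_smult_closed by (simp add: free_simps(4))
      ultimately show ?thesis using assms(3,4) Qv v True by metis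
    next
      case False
      then have "u = ?v" using insert.prems(1) by (auto simp: free_simps fun_eq_iff)
      then show ?thesis using Qv by simp
    qed
  qed
  then show ?thesis using assms(1) by (auto simp: free_simps)
qed

text \<open>The linear extension of a map on generators; the boundary of the Hochschild complex has this
  form.\<close>

definition lin_ext where
  "lin_ext M \<phi> u = (\<Oplus>\<^bsub>M\<^esub>g\<in>{g. u g \<noteq> \<zero>}. u g \<odot>\<^bsub>M\<^esub> \<phi> g)"

lemma lin_ext_eq:
  assumes "Module.module R M" "\<phi> \<in> G \<rightarrow> carrier M" "u \<in> carrier (free_mod R G)"
    "finite S" "{g. u g \<noteq> \<zero>} \<subseteq> S" "S \<subseteq> G"
  shows "lin_ext M \<phi> u = (\<Oplus>\<^bsub>M\<^esub>g\<in>S. u g \<odot>\<^bsub>M\<^esub> \<phi> g)"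
proof -
  interpret M: Module.module R M by fact
  show ?thesis unfolding lin_ext_def
  proof (rule M.add.finprod_mono_neutral_cong_left)
    fix i assume "i \<in> S - {g. u g \<noteq> \<zero>}"
    then have "u i = \<zero>" "\<phi> i \<in> carrier M" using assms(2,6) by auto
    then show "u i \<odot>\<^bsub>M\<^esub> \<phi> i = \<zero>\<^bsub>M\<^esub>" by simp
  next
    show "(\<lambda>g. u g \<odot>\<^bsub>M\<^esub> \<phi> g) \<in> S \<rightarrow> carrier M"
      using assms by (auto simp: free_simps Pi_def subset_iff)
  qed (use assms in auto)
qed

lemma lin_ext_linear:
  assumes M: "Module.module R M" and \<phi>: "\<phi> \<in> G \<rightarrow> carrier M"
  shows "linear_map R (free_mod R G) M (lin_ext M \<phi>)"
proof -
  interpret M: Module.module R M by fact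
  let ?s = "\<lambda>u. {g. u g \<noteq> \<zero>}"
  have fin: "finite (?s u)" "?s u \<subseteq> G" if "u \<in> carrier (free_mod R G)" for u
    using that by (auto simp: free_simps)
  have uc: "u g \<in> carrier R" if "u \<in> carrier (free_mod R G)" for u g
    using that by (auto simp: free_simps)
  show ?thesis unfolding linear_map_def
  proof (intro conjI ballI funcsetI)
    fix u assume u: "u \<in> carrier (free_mod R G)"
    show "lin_ext M \<phi> u \<in> carrier M" unfolding lin_ext_def
      using \<phi> u fin[OF u] by (intro M.finsum_closed) (auto simp: uc Pi_def subset_iff)
    { fix v assume v: "v \<in> carrier (free_mod R G)"
      let ?S = "?s u \<union> ?s v"
      have S: "finite ?S" "?S \<subseteq> G" using fin[OF u] fin[OF v] by auto
      have uv: "(\<lambda>g. u g \<oplus> v g) \<in> carrier (free_mod R G)" using u v by (rule free_add_closed)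
      have "lin_ext M \<phi> (\<lambda>g. u g \<oplus> v g) = (\<Oplus>\<^bsub>M\<^esub>g\<in>?S. (u g \<oplus> v g) \<odot>\<^bsub>M\<^esub> \<phi> g)"
        by (rule lin_ext_eq[OF M \<phi> uv S(1) _ S(2)]) auto
      also have "\<dots> = (\<Oplus>\<^bsub>M\<^esub>g\<in>?S. u g \<odot>\<^bsub>M\<^esub> \<phi> g \<oplus>\<^bsub>M\<^esub> v g \<odot>\<^bsub>M\<^esub> \<phi> g)"
        by (rule M.finsum_cong') (use S \<phi> u v in \<open>auto simp: uc M.smult_l_distr Pi_def subset_iff\<close>)
      also have "\<dots> = (\<Oplus>\<^bsub>M\<^esub>g\<in>?S. u g \<odot>\<^bsub>M\<^esub> \<phi> g) \<oplus>\<^bsub>M\<^esub> (\<Oplus>\<^bsub>M\<^esub>g\<in>?S. v g \<odot>\<^bsub>M\<^esub> \<phi> g)"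
        by (rule M.finsum_addf) (use S \<phi> u v in \<open>auto simp: uc Pi_def subset_iff\<close>)
      also have "\<dots> = lin_ext M \<phi> u \<oplus>\<^bsub>M\<^esub> lin_ext M \<phi> v"
        using lin_ext_eq[OF M \<phi> u S(1) _ S(2)] lin_ext_eq[OF M \<phi> v S(1) _ S(2)] by auto
      finally show "lin_ext M \<phi> (u \<oplus>\<^bsub>free_mod R G\<^esub> v) = lin_ext M \<phi> u \<oplus>\<^bsub>M\<^esub> lin_ext M \<phi> v"
        by (simp add: free_simps(3)) }
  next
    fix x u assume x: "x \<in> carrier R" and u: "u \<in> carrier (free_mod R G)"
    have xu: "(\<lambda>g. x \<otimes> u g) \<in> carrier (free_mod R G)" using x u by (rule free_smult_closed)
    have "lin_ext M \<phi> (\<lambda>g. x \<otimes> u g) = (\<Oplus>\<^bsub>M\<^esub>g\<in>?s u. (x \<otimes> u g) \<odot>\<^bsub>M\<^esub> \<phi> g)"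
      by (rule lin_ext_eq[OF M \<phi> xu]) (use fin[OF u] x in auto)
    also have "\<dots> = (\<Oplus>\<^bsub>M\<^esub>g\<in>?s u. x \<odot>\<^bsub>M\<^esub> (u g \<odot>\<^bsub>M\<^esub> \<phi> g))"
      by (rule M.finsum_cong') (use fin[OF u] \<phi> u x in \<open>auto simp: uc M.smult_assoc1 Pi_def subset_iff\<close>)
    also have "\<dots> = x \<odot>\<^bsub>M\<^esub> lin_ext M \<phi> u" unfolding lin_ext_def
      by (rule M.finsum_smult_ldistr[symmetric]) (use fin[OF u] \<phi> u x in \<open>auto simp: uc Pi_def subset_iff\<close>)
    finally show "lin_ext M \<phi> (x \<odot>\<^bsub>free_mod R G\<^esub> u) = x \<odot>\<^bsub>M\<^esub> lin_ext M \<phi> u"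
      by (simp add: free_simps(4))
  qed
qed

lemma lin_ext_gen:
  assumes M: "Module.module R M" and \<phi>: "\<phi> \<in> G \<rightarrow> carrier M" and "g \<in> G"
  shows "lin_ext M \<phi> (free_gen R g) = \<phi> g"
proof -
  interpret M: Module.module R M by fact
  have "lin_ext M \<phi> (free_gen R g) = (\<Oplus>\<^bsub>M\<^esub>h\<in>{g}. free_gen R g h \<odot>\<^bsub>M\<^esub> \<phi> h)"
    by (rule lin_ext_eq[OF M \<phi> free_gen_closed]) (use assms in \<open>auto simp: free_gen_def\<close>)
  also have "\<dots> = \<phi> g" using assms by (simp add: free_gen_def Pi_def)
  finally show ?thesis .
qed

end


section \<open>The relative Hochschild complex\<close>

(* The numeral 1 stays intact, so that index expressions such as r - 1 keep one shape. *)
declare One_nat_def [simp del]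

locale rel_algebra = assoc_algebra k A
  for k :: "('k, 'r) ring_scheme" and A :: "('k, 'c, 'n) module_scheme" (structure) +
  fixes K :: "('a, 'm) ring_scheme" and \<iota> :: "'a \<Rightarrow> 'c"
  assumes K_ring: "ring K" and iota_hom: "\<iota> \<in> ring_hom K A"
begin

lemma iota_closed [simp, intro]: "y \<in> carrier K \<Longrightarrow> \<iota> y \<in> carrier A"
  using iota_hom by (rule ring_hom_closed)

abbreviation Fr where "Fr r \<equiv> hoch_free k K A \<iota> r"
abbreviation tn where "tn xs \<equiv> tens k K A \<iota> xs"
abbreviation Nul where "Nul r \<equiv> hoch_null k K A \<iota> r"
abbreviation Ch where "Ch r \<equiv> hoch_chain k K A \<iota> r"

lemma Fr_module: "Module.module k (Fr r)" by (rule R.free_module)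

lemma tuples_length: "xs \<in> tuples A r \<Longrightarrow> length xs = Suc r" by (simp add: tuples_def)
lemma tuples_nth: "xs \<in> tuples A r \<Longrightarrow> i \<le> r \<Longrightarrow> xs ! i \<in> carrier A"
  by (auto simp: tuples_def)
lemma tuplesI: "length xs = Suc r \<Longrightarrow> (\<And>i. i \<le> r \<Longrightarrow> xs ! i \<in> carrier A) \<Longrightarrow> xs \<in> tuples A r"
  by (auto simp: tuples_def in_set_conv_nth less_Suc_eq_le)
lemma tuples_update: "xs \<in> tuples A r \<Longrightarrow> a \<in> carrier A \<Longrightarrow> xs[i := a] \<in> tuples A r"
  by (auto simp: tuples_def dest!: subsetD[OF set_update_subset_insert])

lemma tn_closed: "xs \<in> tuples A r \<Longrightarrow> tn xs \<in> carrier (Fr r)"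
  by (intro R.free_gen_closed) auto

lemma rels_cases [consumes 1, case_names add smult balance]:
  assumes "x \<in> hoch_rels k K A \<iota> r"
    and "\<And>xs i a b. xs \<in> tuples A r \<Longrightarrow> i \<le> r \<Longrightarrow> a \<in> carrier A \<Longrightarrow> b \<in> carrier A \<Longrightarrow>
        x = tn (xs[i := a \<oplus> b]) \<ominus>\<^bsub>Fr r\<^esub> (tn (xs[i := a]) \<oplus>\<^bsub>Fr r\<^esub> tn (xs[i := b])) \<Longrightarrow> thesis"
    and "\<And>xs i a c. xs \<in> tuples A r \<Longrightarrow> i \<le> r \<Longrightarrow> a \<in> carrier A \<Longrightarrow> c \<in> carrier k \<Longrightarrow>
        x = tn (xs[i := c \<odot> a]) \<ominus>\<^bsub>Fr r\<^esub> (c \<odot>\<^bsub>Fr r\<^esub> tn (xs[i := a])) \<Longrightarrow> thesis"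
    and "\<And>xs i j y. xs \<in> tuples A r \<Longrightarrow> i \<le> r \<Longrightarrow> j = Suc i mod Suc r \<Longrightarrow> y \<in> carrier K \<Longrightarrow>
        x = tn (xs[i := xs ! i \<otimes> \<iota> y]) \<ominus>\<^bsub>Fr r\<^esub> tn (xs[j := \<iota> y \<otimes> xs ! j]) \<Longrightarrow> thesis"
  shows thesis
  using assms(1) unfolding hoch_rels_def Let_def
  apply (elim UnE CollectE exE conjE)
    apply (rule assms(2); assumption)
   apply (rule assms(3); assumption)
  apply (rule assms(4); assumption)
  done

lemma rels_closed: "hoch_rels k K A \<iota> r \<subseteq> carrier (Fr r)"
proof
  interpret F: Module.module k "Fr r" by (rule Fr_module)
  fix x assume "x \<in> hoch_rels k K A \<iota> r"
  then show "x \<in> carrier (Fr r)"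
  proof (cases rule: rels_cases)
    case (add xs i a b)
    then have "tn (xs[i := z]) \<in> carrier (Fr r)" if "z \<in> carrier A" for z
      using that by (intro tn_closed tuples_update)
    then show ?thesis using add by simp
  next
    case (smult xs i a c)
    then have "tn (xs[i := z]) \<in> carrier (Fr r)" if "z \<in> carrier A" for z
      using that by (intro tn_closed tuples_update)
    then show ?thesis using smult by simp
  next
    case (balance xs i j y)
    have "j \<le> r" using balance(3) by (simp add: less_Suc_eq_le[symmetric])
    then have "tn (xs[i := xs ! i \<otimes> \<iota> y]) \<in> carrier (Fr r)" "tn (xs[j := \<iota> y \<otimes> xs ! j]) \<in> carrier (Fr r)"
      using balance by (auto intro!: tn_closed tuples_update M.m_closed tuples_nth)
    then show ?thesis using balance by simp
  qed
qed

lemma Nul_submodule: "submodule (Nul r) k (Fr r)"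
proof -
  interpret F: Module.module k "Fr r" by (rule Fr_module)
  show ?thesis unfolding hoch_null_def by (rule F.span_mod_submodule[OF rels_closed])
qed

sublocale Nr: module_with_submodule k "Fr r" "Nul r" for r
  by (intro module_with_submodule.intro module_with_submodule_axioms.intro Fr_module Nul_submodule)

lemma Ch_eq: "Ch r = Nr.Qm r" by (simp add: hoch_chain_def)

lemma Ch_module: "Module.module k (Ch r)" unfolding Ch_eq by (rule Nr.Q_module)

sublocale Ch: Module.module k "Ch r" for r by (rule Ch_module)

text \<open>The class of the tensor \<open>a\<^sub>0 \<otimes> \<dots> \<otimes> a\<^sub>r\<close>.\<close>

abbreviation br where "br r xs \<equiv> Nr.cl r (tn xs)"

lemma cl_linear: "linear k (Fr r) (Ch r) (Nr.cl r)"
  unfolding Ch_eq by (intro linear.intro linear_axioms.intro Fr_module Nr.Q_module Nr.cl_linear)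

sublocale cl: linear k "Fr r" "Ch r" "Nr.cl r" for r by (rule cl_linear)

lemma br_closed [intro, simp]: "xs \<in> tuples A r \<Longrightarrow> br r xs \<in> carrier (Ch r)"
  by (intro cl.closed tn_closed)

lemma rel_in_Nul: "x \<in> hoch_rels k K A \<iota> r \<Longrightarrow> x \<in> Nul r"
  unfolding hoch_null_def by (rule subsetD[OF span_mod_superset])

lemma br_add:
  assumes "xs \<in> tuples A r" "i \<le> r" "a \<in> carrier A" "b \<in> carrier A"
  shows "br r (xs[i := a \<oplus> b]) = br r (xs[i := a]) \<oplus>\<^bsub>Ch r\<^esub> br r (xs[i := b])"
proof -
  have "tn (xs[i := a \<oplus> b]) \<ominus>\<^bsub>Fr r\<^esub> (tn (xs[i := a]) \<oplus>\<^bsub>Fr r\<^esub> tn (xs[i := b])) \<in> hoch_rels k K A \<iota> r"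
    unfolding hoch_rels_def Let_def
    by (rule UnI1, rule UnI1, rule CollectI, intro exI conjI, rule refl) (use assms in simp_all)
  note rel = rel_in_Nul[OF this]
  have c: "tn (xs[i := z]) \<in> carrier (Fr r)" if "z \<in> carrier A" for z
    using assms(1) that by (intro tn_closed tuples_update)
  have "br r (xs[i := a \<oplus> b]) = Nr.cl r (tn (xs[i := a]) \<oplus>\<^bsub>Fr r\<^esub> tn (xs[i := b]))"
    by (rule iffD2[OF Nr.cl_eq_iff rel]) (simp_all add: c assms)
  then show ?thesis using assms by (simp add: cl.add c)
qed

lemma br_smult:
  assumes "xs \<in> tuples A r" "i \<le> r" "a \<in> carrier A" "c \<in> carrier k"
  shows "br r (xs[i := c \<odot> a]) = c \<odot>\<^bsub>Ch r\<^esub> br r (xs[i := a])"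
proof -
  have "tn (xs[i := c \<odot> a]) \<ominus>\<^bsub>Fr r\<^esub> (c \<odot>\<^bsub>Fr r\<^esub> tn (xs[i := a])) \<in> hoch_rels k K A \<iota> r"
    unfolding hoch_rels_def Let_def
    by (rule UnI1, rule UnI2, rule CollectI, intro exI conjI, rule refl) (use assms in simp_all)
  note rel = rel_in_Nul[OF this]
  have c: "tn (xs[i := z]) \<in> carrier (Fr r)" if "z \<in> carrier A" for z
    using assms(1) that by (intro tn_closed tuples_update)
  have "br r (xs[i := c \<odot> a]) = Nr.cl r (c \<odot>\<^bsub>Fr r\<^esub> tn (xs[i := a]))"
    by (rule iffD2[OF Nr.cl_eq_iff rel]) (simp_all add: c assms)
  then show ?thesis using assms by (simp add: cl.smult c)
qed

lemma br_balance:
  assumes "xs \<in> tuples A r" "i \<le> r" "j = Suc i mod Suc r" "y \<in> carrier K"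
  shows "br r (xs[i := xs ! i \<otimes> \<iota> y]) = br r (xs[j := \<iota> y \<otimes> xs ! j])"
proof -
  have j: "j \<le> r" using assms(3) by (simp add: less_Suc_eq_le[symmetric])
  have "tn (xs[i := xs ! i \<otimes> \<iota> y]) \<ominus>\<^bsub>Fr r\<^esub> tn (xs[j := \<iota> y \<otimes> xs ! j]) \<in> hoch_rels k K A \<iota> r"
    unfolding hoch_rels_def Let_def
    by (rule UnI2, rule CollectI, intro exI conjI, rule refl) (use assms in simp_all)
  note rel = rel_in_Nul[OF this]
  have t: "xs[i := xs ! i \<otimes> \<iota> y] \<in> tuples A r" "xs[j := \<iota> y \<otimes> xs ! j] \<in> tuples A r"
    using assms j by (auto intro!: tuples_update M.m_closed tuples_nth)
  show ?thesis
    by (rule iffD2[OF Nr.cl_eq_iff rel]) (intro tn_closed t)+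
qed

lemma br_zero:
  assumes "xs \<in> tuples A r" "i \<le> r" shows "br r (xs[i := \<zero>]) = \<zero>\<^bsub>Ch r\<^esub>"
proof -
  have "br r (xs[i := \<zero>]) \<oplus>\<^bsub>Ch r\<^esub> br r (xs[i := \<zero>]) = br r (xs[i := \<zero>])"
    using br_add[OF assms, of \<zero> \<zero>] by simp
  moreover have "br r (xs[i := \<zero>]) \<in> carrier (Ch r)" using assms by (intro br_closed tuples_update) auto
  ultimately show ?thesis by (simp add: Ch.add.l_cancel_one)
qed

lemma iota_subgroup: "additive_subgroup (\<iota> ` carrier K) A"
proof -
  interpret K: ring K by (rule K_ring)
  interpret h: ring_hom_ring K A \<iota>
    by (intro ring_hom_ringI2 K_ring M.ring_axioms iota_hom)
  show ?thesis
  proof (intro additive_subgroup.intro M.add.subgroupI)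
    fix a assume "a \<in> \<iota> ` carrier K"
    then obtain x where x: "x \<in> carrier K" "a = \<iota> x" by auto
    then show "\<ominus> a \<in> \<iota> ` carrier K" by (intro rev_image_eqI[of "\<ominus>\<^bsub>K\<^esub> x"]) auto
    fix b assume "b \<in> \<iota> ` carrier K"
    then obtain y where "y \<in> carrier K" "b = \<iota> y" by auto
    with x show "a \<oplus> b \<in> \<iota> ` carrier K" by (intro rev_image_eqI[of "x \<oplus>\<^bsub>K\<^esub> y"]) auto
  qed auto
qed

sublocale iK: additive_subgroup "\<iota> ` carrier K" A by (rule iota_subgroup)
sublocale iK: abelian_subgroup "\<iota> ` carrier K" A
  by (intro abelian_subgroupI3 iota_subgroup M.abelian_group_axioms)

lemma reduce_cong:
  assumes "xs \<in> tuples A r" "ys \<in> tuples A r" "xs ! 0 = ys ! 0"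
    "\<And>i. 1 \<le> i \<Longrightarrow> i \<le> r \<Longrightarrow> (\<iota> ` carrier K) +> (xs ! i) = (\<iota> ` carrier K) +> (ys ! i)"
  shows "reduce K A \<iota> xs = reduce K A \<iota> ys"
  unfolding reduce_def
  using assms by (auto simp: tuples_def hd_conv_nth nth_tl intro!: nth_equalityI)
    (metis hd_conv_nth length_0_conv nat.distinct(1))

lemma reduceD:
  assumes "xs \<in> tuples A r" "ys \<in> tuples A r" "reduce K A \<iota> xs = reduce K A \<iota> ys"
  shows "xs ! 0 = ys ! 0" "1 \<le> i \<Longrightarrow> i \<le> r \<Longrightarrow> (\<iota> ` carrier K) +> (xs ! i) = (\<iota> ` carrier K) +> (ys ! i)"
proof -
  have ne: "xs \<noteq> []" "ys \<noteq> []" using assms by (auto simp: tuples_def)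
  then show "xs ! 0 = ys ! 0" using assms(3) by (simp add: reduce_def hd_conv_nth)
  assume i: "1 \<le> i" "i \<le> r"
  have "map (\<lambda>a. (\<iota> ` carrier K) +> a) (tl xs) ! (i - 1) = map (\<lambda>a. (\<iota> ` carrier K) +> a) (tl ys) ! (i - 1)"
    using assms(3) by (simp add: reduce_def)
  then show "(\<iota> ` carrier K) +> (xs ! i) = (\<iota> ` carrier K) +> (ys ! i)"
    using i assms(1,2) by (simp add: tuples_def nth_tl)
qed

text \<open>The factors behind the first one lie in \<open>A/K\<close>, where \<open>\<iota> y\<close> equals \<open>0\<close>.\<close>

lemma br_iota:
  assumes "xs \<in> tuples A r" "1 \<le> i" "i \<le> r" "y \<in> carrier K"
  shows "br r (xs[i := \<iota> y]) = \<zero>\<^bsub>Ch r\<^esub>"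
proof -
  have "(\<iota> ` carrier K) +> (\<iota> y) = \<iota> ` carrier K"
    using assms(4) by (intro iK.a_rcos_const) auto
  moreover have "(\<iota> ` carrier K) +> \<zero> = \<iota> ` carrier K"
    by (intro iK.a_rcos_const iK.zero_closed)
  ultimately have "reduce K A \<iota> (xs[i := \<iota> y]) = reduce K A \<iota> (xs[i := \<zero>])"
    using assms by (intro reduce_cong[where r = r] tuples_update)
      (auto simp: nth_list_update tuples_length)
  then show ?thesis using br_zero[OF assms(1,3)] by simp
qed

subsection \<open>Faces\<close>

text \<open>The entries of a face by position, which turns the list manipulations below into case
  distinctions on indices.\<close>

definition face_entry :: "nat \<Rightarrow> nat \<Rightarrow> 'c list \<Rightarrow> nat \<Rightarrow> 'c" where
  "face_entry r t xs m = (if t < r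
     then if m < t then xs ! m else if m = t then xs ! t \<otimes> xs ! Suc t else xs ! Suc m
     else if m = 0 then xs ! r \<otimes> xs ! 0 else xs ! m)"

lemma face_length: "xs \<in> tuples A r \<Longrightarrow> 1 \<le> r \<Longrightarrow> t \<le> r \<Longrightarrow> length (hoch_face A r t xs) = r"
  by (auto simp: hoch_face_def tuples_def)

lemma face_nth:
  assumes "xs \<in> tuples A r" "1 \<le> r" "t \<le> r" "m < r"
  shows "hoch_face A r t xs ! m = face_entry r t xs m"
proof (cases "t < r")
  case True
  then show ?thesis using assms
    by (auto simp: hoch_face_def face_entry_def tuples_def nth_append nth_Cons')
next
  case False
  have ne: "xs \<noteq> []" using assms by (auto simp: tuples_def)
  show ?thesis using False assms ne
    by (auto simp: hoch_face_def face_entry_def tuples_def nth_Cons' nth_butlast nth_tl last_conv_nth hd_conv_nth)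
qed

lemma face_closed:
  assumes "xs \<in> tuples A r" "1 \<le> r" "t \<le> r"
  shows "hoch_face A r t xs \<in> tuples A (r - 1)"
  using assms by (intro tuplesI)
    (auto simp: face_length face_nth face_entry_def intro!: tuples_nth[of xs r] M.m_closed)

lemma face_eqI:
  assumes "xs \<in> tuples A r" "1 \<le> r" "t \<le> r" "length ys = r" "\<And>m. m < r \<Longrightarrow> face_entry r t xs m = ys ! m"
  shows "hoch_face A r t xs = ys"
  using assms by (intro nth_equalityI) (auto simp: face_length face_nth)

text \<open>The position in the \<open>t\<close>-th face to which the factor in position \<open>m\<close> contributes.\<close>

definition pos :: "nat \<Rightarrow> nat \<Rightarrow> nat \<Rightarrow> nat" where
  "pos r t m = (if t < r then if m \<le> t then m else m - 1 else if m = r then 0 else m)"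

lemma pos_less: "1 \<le> r \<Longrightarrow> t \<le> r \<Longrightarrow> m \<le> r \<Longrightarrow> pos r t m < r"
  by (auto simp: pos_def)

lemma face_update_nth:
  assumes "xs \<in> tuples A r" "1 \<le> r" "t \<le> r" "m < r"
  shows "(hoch_face A r t xs)[i := v] ! m = (if m = i then v else face_entry r t xs m)"
  using assms face_length[OF assms(1-3)] face_nth[OF assms] by (simp add: nth_list_update)

lemma tuples_update_nth: "xs \<in> tuples A r \<Longrightarrow> i \<le> r \<Longrightarrow> xs[j := z] ! i = (if i = j then z else xs ! i)"
  by (simp add: nth_list_update tuples_length)

text \<open>A face depends on each factor through a two-sided multiplication; hence it inherits linearity in
  that factor.\<close>

lemma face_update:
  assumes xs: "xs \<in> tuples A r" and r: "1 \<le> r" "t \<le> r" "j \<le> r"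
  obtains p q where "p \<in> carrier A" "q \<in> carrier A"
    "\<And>a. a \<in> carrier A \<Longrightarrow> hoch_face A r t (xs[j := a]) = (hoch_face A r t xs)[pos r t j := p \<otimes> a \<otimes> q]"
proof -
  define p where "p = (if t < r \<and> j = Suc t then xs ! t else if t = r \<and> j = 0 then xs ! r else \<one>)"
  define q where "q = (if t < r \<and> j = t then xs ! Suc t else if t = r \<and> j = r then xs ! 0 else \<one>)"
  note upd = tuples_update_nth[OF xs] and xc = tuples_nth[OF xs]
  have "p \<in> carrier A" "q \<in> carrier A" using r by (auto simp: p_def q_def xc)
  moreover have "hoch_face A r t (xs[j := a]) = (hoch_face A r t xs)[pos r t j := p \<otimes> a \<otimes> q]"
    if a: "a \<in> carrier A" for a
  proof (rule face_eqI[OF tuples_update[OF xs a] r(1,2)])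
    fix m assume m: "m < r"
    show "face_entry r t (xs[j := a]) m = (hoch_face A r t xs)[pos r t j := p \<otimes> a \<otimes> q] ! m"
      unfolding face_update_nth[OF xs r(1,2) m]
    proof (cases "t < r")
      case True
      consider "m < t" | "m = t" | "t < m" by linarith
      then show "face_entry r t (xs[j := a]) m = (if m = pos r t j then p \<otimes> a \<otimes> q else face_entry r t xs m)"
        by cases (use True m r(3) in \<open>auto simp: face_entry_def upd pos_def p_def q_def xc a\<close>)
    next
      case False
      then show "face_entry r t (xs[j := a]) m = (if m = pos r t j then p \<otimes> a \<otimes> q else face_entry r t xs m)"
        using m r by (cases "m = 0"; cases "j = 0"; cases "j = r")
          (simp_all add: face_entry_def upd pos_def p_def q_def xc a)
    qed
  qed (use face_length[OF xs r(1,2)] in simp)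
  ultimately show thesis using that by blast
qed

lemma face_mult_right:
  assumes xs: "xs \<in> tuples A r" and r: "1 \<le> r" "t \<le> r" "i \<le> r" "t \<noteq> i" and z: "z \<in> carrier A"
  shows "hoch_face A r t (xs[i := xs ! i \<otimes> z]) =
    (hoch_face A r t xs)[pos r t i := hoch_face A r t xs ! pos r t i \<otimes> z]"
proof (rule face_eqI)
  note upd = tuples_update_nth[OF xs] and xc = tuples_nth[OF xs]
  show "xs[i := xs ! i \<otimes> z] \<in> tuples A r" using xs z r by (intro tuples_update M.m_closed xc) auto
  fix m assume m: "m < r"
  show "face_entry r t (xs[i := xs ! i \<otimes> z]) m =
     (hoch_face A r t xs)[pos r t i := hoch_face A r t xs ! pos r t i \<otimes> z] ! m"
    unfolding face_update_nth[OF xs r(1,2) m] face_nth[OF xs r(1,2) pos_less[OF r(1-3)]]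
  proof (cases "t < r")
    case True
    consider "m < t" | "m = t" | "t < m" by linarith
    then show "face_entry r t (xs[i := xs ! i \<otimes> z]) m =
      (if m = pos r t i then face_entry r t xs (pos r t i) \<otimes> z else face_entry r t xs m)"
      by cases (use True m r(3,4) z in \<open>auto simp: face_entry_def upd pos_def xc M.m_assoc\<close>)
  next
    case False
    then show "face_entry r t (xs[i := xs ! i \<otimes> z]) m =
      (if m = pos r t i then face_entry r t xs (pos r t i) \<otimes> z else face_entry r t xs m)"
      using m r z by (cases "m = 0"; cases "i = 0")
        (simp_all add: face_entry_def upd pos_def xc M.m_assoc)
  qed
qed (use r face_length[OF xs r(1,2)] in auto)

lemma face_mult_left:
  assumes xs: "xs \<in> tuples A r" and r: "1 \<le> r" "t \<le> r" "j \<le> r"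
    and j: "t < r \<Longrightarrow> j \<noteq> Suc t" "t = r \<Longrightarrow> j \<noteq> 0" and z: "z \<in> carrier A"
  shows "hoch_face A r t (xs[j := z \<otimes> xs ! j]) =
    (hoch_face A r t xs)[pos r t j := z \<otimes> hoch_face A r t xs ! pos r t j]"
proof (rule face_eqI)
  note upd = tuples_update_nth[OF xs] and xc = tuples_nth[OF xs]
  show "xs[j := z \<otimes> xs ! j] \<in> tuples A r" using xs z r by (intro tuples_update M.m_closed xc) auto
  fix m assume m: "m < r"
  show "face_entry r t (xs[j := z \<otimes> xs ! j]) m =
     (hoch_face A r t xs)[pos r t j := z \<otimes> hoch_face A r t xs ! pos r t j] ! m"
    unfolding face_update_nth[OF xs r(1,2) m] face_nth[OF xs r(1,2) pos_less[OF r(1-3)]]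
  proof (cases "t < r")
    case True
    consider "m < t" | "m = t" | "t < m" by linarith
    then show "face_entry r t (xs[j := z \<otimes> xs ! j]) m =
      (if m = pos r t j then z \<otimes> face_entry r t xs (pos r t j) else face_entry r t xs m)"
      by cases (use True m r(3) j(1)[OF True] z in \<open>auto simp: face_entry_def upd pos_def xc M.m_assoc\<close>)
  next
    case False
    then have "t = r" using r by simp
    with j(2) have "j \<noteq> 0" by simp
    then show "face_entry r t (xs[j := z \<otimes> xs ! j]) m =
      (if m = pos r t j then z \<otimes> face_entry r t xs (pos r t j) else face_entry r t xs m)"
      using m r z False by (cases "m = 0"; cases "j = r")
        (simp_all add: face_entry_def upd pos_def xc M.m_assoc)
  qed
qed (use r face_length[OF xs r(1,2)] in auto)

lemma cyclic_Suc: "i \<le> r \<Longrightarrow> Suc i mod Suc r = (if i = r then 0 else Suc i)"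
  by simp

lemma pos_Suc:
  assumes "1 \<le> r" "t \<le> r" "i \<le> r" "t \<noteq> i" "j = Suc i mod Suc r"
  shows "pos r t j = Suc (pos r t i) mod Suc (r - 1)"
proof -
  have "pos r t i \<le> r - 1" using pos_less[OF assms(1-3)] by simp
  then show ?thesis using assms(1-4) unfolding assms(5) cyclic_Suc[OF assms(3)]
    by (subst cyclic_Suc) (auto simp: pos_def)
qed

text \<open>If the \<open>t\<close>-th face multiplies the two factors between which \<open>y\<close> is moved, both sides agree by
  associativity; otherwise the two factors remain neighbours in the face.\<close>

lemma face_balance:
  assumes xs: "xs \<in> tuples A r" and r: "1 \<le> r" "t \<le> r" "i \<le> r" "j = Suc i mod Suc r" and y: "y \<in> carrier K"
  shows "br (r - 1) (hoch_face A r t (xs[i := xs ! i \<otimes> \<iota> y])) = br (r - 1) (hoch_face A r t (xs[j := \<iota> y \<otimes> xs ! j]))"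
proof (cases "t = i")
  case True
  have j: "j \<le> r" using r(4) by (simp add: less_Suc_eq_le[symmetric])
  have "hoch_face A r t (xs[i := xs ! i \<otimes> \<iota> y]) = hoch_face A r t (xs[j := \<iota> y \<otimes> xs ! j])"
  proof (rule face_eqI)
    show t1: "xs[i := xs ! i \<otimes> \<iota> y] \<in> tuples A r"
      using xs r y by (intro tuples_update M.m_closed tuples_nth) auto
    have t2: "xs[j := \<iota> y \<otimes> xs ! j] \<in> tuples A r"
      using xs j y by (intro tuples_update M.m_closed tuples_nth) auto
    show "length (hoch_face A r t (xs[j := \<iota> y \<otimes> xs ! j])) = r"
      by (rule face_length[OF t2 r(1,2)])
    fix m assume m: "m < r"
    show "face_entry r t (xs[i := xs ! i \<otimes> \<iota> y]) m = hoch_face A r t (xs[j := \<iota> y \<otimes> xs ! j]) ! m"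
      unfolding face_nth[OF t2 r(1,2) m]
    proof (cases "i < r")
      case True
      note simps = face_entry_def tuples_update_nth[OF xs] tuples_nth[OF xs] M.m_assoc
      have ij: "j = Suc i" using True r(3) unfolding r(4) by simp
      consider "m < i" | "m = i" | "i < m" by linarith
      then show "face_entry r t (xs[i := xs ! i \<otimes> \<iota> y]) m = face_entry r t (xs[j := \<iota> y \<otimes> xs ! j]) m"
        unfolding \<open>t = i\<close> ij by cases (use True m y in \<open>simp_all add: simps\<close>)
    next
      case False
      note simps = face_entry_def tuples_update_nth[OF xs] tuples_nth[OF xs] M.m_assoc
      have ij: "i = r" "j = 0" using False r(3) unfolding r(4) by simp_all
      show "face_entry r t (xs[i := xs ! i \<otimes> \<iota> y]) m = face_entry r t (xs[j := \<iota> y \<otimes> xs ! j]) m"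
        unfolding \<open>t = i\<close> ij using m y r(1) by (cases "m = 0") (simp_all add: simps)
    qed
  qed (use r in auto)
  then show ?thesis by simp
next
  case False
  have j: "j \<le> r" using r(4) by (simp add: less_Suc_eq_le[symmetric])
  have jt: "t < r \<Longrightarrow> j \<noteq> Suc t" "t = r \<Longrightarrow> j \<noteq> 0"
    using False r(1,3) unfolding r(4) cyclic_Suc[OF r(3)] by auto
  have p: "pos r t i \<le> r - 1" using pos_less[OF r(1-3)] by simp
  have eq: "hoch_face A r t (xs[j := \<iota> y \<otimes> xs ! j]) =
      (hoch_face A r t xs)[pos r t j := \<iota> y \<otimes> hoch_face A r t xs ! pos r t j]"
    by (rule face_mult_left[OF xs r(1,2) j _ _ iota_closed[OF y]]) (use jt in auto)
  show ?thesis
    unfolding face_mult_right[OF xs r(1-3) False iota_closed[OF y]] eq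
    by (rule br_balance[OF face_closed[OF xs r(1,2)] p pos_Suc[OF r(1-3) False r(4)] y])
qed

subsection \<open>The boundary\<close>

text \<open>The sign \<open>(-1)\<^sup>i\<close> in \<open>k\<close>.\<close>

definition sg :: "nat \<Rightarrow> 'k" where "sg i = (\<ominus>\<^bsub>k\<^esub> \<one>\<^bsub>k\<^esub>) [^]\<^bsub>k\<^esub> i"

lemma sg_closed [simp, intro]: "sg i \<in> carrier k" by (simp add: sg_def)
lemma sg_0 [simp]: "sg 0 = \<one>\<^bsub>k\<^esub>" by (simp add: sg_def)
lemma sg_Suc: "v \<in> carrier (Ch r) \<Longrightarrow> sg (Suc i) \<odot>\<^bsub>Ch r\<^esub> v = \<ominus>\<^bsub>Ch r\<^esub> (sg i \<odot>\<^bsub>Ch r\<^esub> v)"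
  by (simp add: sg_def Ch.smult_assoc1 Ch.smult_l_minus Ch.smult_r_minus)

text \<open>The class of the boundary of a tuple. In contrast to the tuple of faces it depends only on the
  generator \<open>reduce K A \<iota> xs\<close> (\<open>bdry_class_cong\<close>), which makes the chosen representatives in the
  definition of the boundary harmless.\<close>

definition bdry_class :: "nat \<Rightarrow> 'c list \<Rightarrow> ('c \<times> 'c set list \<Rightarrow> 'k) set" where
  "bdry_class r xs = (\<Oplus>\<^bsub>Ch (r - 1)\<^esub>t\<in>{..r}. sg t \<odot>\<^bsub>Ch (r - 1)\<^esub> br (r - 1) (hoch_face A r t xs))"

lemma bdry_tuple_closed:
  assumes "xs \<in> tuples A r" "1 \<le> r"
  shows "hoch_bdry_tuple k K A \<iota> r xs \<in> carrier (Fr (r - 1))"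
  unfolding hoch_bdry_tuple_def using assms
  by (intro Nr.finsum_closed) (auto intro!: Nr.smult_closed tn_closed face_closed)

lemma cl_bdry_tuple:
  assumes "xs \<in> tuples A r" "1 \<le> r"
  shows "Nr.cl (r - 1) (hoch_bdry_tuple k K A \<iota> r xs) = bdry_class r xs"
proof -
  have c: "tn (hoch_face A r t xs) \<in> carrier (Fr (r - 1))" if "t \<le> r" for t
    using assms that by (intro tn_closed face_closed)
  have "Nr.cl (r - 1) (hoch_bdry_tuple k K A \<iota> r xs) =
    (\<Oplus>\<^bsub>Ch (r - 1)\<^esub>t\<in>{..r}. Nr.cl (r - 1) (sg t \<odot>\<^bsub>Fr (r - 1)\<^esub> tn (hoch_face A r t xs)))"
    unfolding hoch_bdry_tuple_def sg_def[symmetric]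
    by (rule cl.finsum) (use c in \<open>auto intro!: Nr.smult_closed\<close>)
  also have "\<dots> = bdry_class r xs" unfolding bdry_class_def
    by (rule Ch.finsum_cong') (use c in \<open>auto simp: cl.smult intro!: Ch.smult_closed cl.closed\<close>)
  finally show ?thesis .
qed

lemma term_closed:
  "xs \<in> tuples A r \<Longrightarrow> 1 \<le> r \<Longrightarrow> t \<le> r \<Longrightarrow> sg t \<odot>\<^bsub>Ch (r - 1)\<^esub> br (r - 1) (hoch_face A r t xs) \<in> carrier (Ch (r - 1))"
  by (intro Ch.smult_closed sg_closed br_closed face_closed)

lemma bdry_class_closed: "xs \<in> tuples A r \<Longrightarrow> 1 \<le> r \<Longrightarrow> bdry_class r xs \<in> carrier (Ch (r - 1))"
  unfolding bdry_class_def by (intro Ch.finsum_closed) (auto intro!: term_closed)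

lemma bdry_class_add:
  assumes "xs \<in> tuples A r" "1 \<le> r" "j \<le> r" "a \<in> carrier A" "b \<in> carrier A"
  shows "bdry_class r (xs[j := a \<oplus> b]) = bdry_class r (xs[j := a]) \<oplus>\<^bsub>Ch (r - 1)\<^esub> bdry_class r (xs[j := b])"
proof -
  have upd: "xs[j := z] \<in> tuples A r" if "z \<in> carrier A" for z using tuples_update[OF assms(1) that] .
  have "br (r - 1) (hoch_face A r t (xs[j := a \<oplus> b])) = br (r - 1) (hoch_face A r t (xs[j := a]))
     \<oplus>\<^bsub>Ch (r - 1)\<^esub> br (r - 1) (hoch_face A r t (xs[j := b]))" if t: "t \<le> r" for t
  proof -
    obtain p q where pq: "p \<in> carrier A" "q \<in> carrier A" and
      f: "\<And>a. a \<in> carrier A \<Longrightarrow> hoch_face A r t (xs[j := a]) = (hoch_face A r t xs)[pos r t j := p \<otimes> a \<otimes> q]"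
      using face_update[OF assms(1,2) t assms(3)] by blast
    have "p \<otimes> (a \<oplus> b) \<otimes> q = p \<otimes> a \<otimes> q \<oplus> p \<otimes> b \<otimes> q"
      using pq assms by (simp add: M.l_distr M.r_distr)
    moreover have "pos r t j \<le> r - 1" using pos_less[OF assms(2) t assms(3)] by simp
    ultimately show ?thesis
      using f assms(4,5) pq br_add[OF face_closed[OF assms(1,2) t], of "pos r t j" "p \<otimes> a \<otimes> q" "p \<otimes> b \<otimes> q"]
      by simp
  qed
  note eq = this
  have c: "br (r - 1) (hoch_face A r t (xs[j := z])) \<in> carrier (Ch (r - 1))" if "z \<in> carrier A" "t \<le> r" for z t
    using that assms(2) by (intro br_closed face_closed upd)
  have "bdry_class r (xs[j := a \<oplus> b]) = (\<Oplus>\<^bsub>Ch (r - 1)\<^esub>t\<in>{..r}.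
      sg t \<odot>\<^bsub>Ch (r - 1)\<^esub> br (r - 1) (hoch_face A r t (xs[j := a])) \<oplus>\<^bsub>Ch (r - 1)\<^esub>
      sg t \<odot>\<^bsub>Ch (r - 1)\<^esub> br (r - 1) (hoch_face A r t (xs[j := b])))"
    unfolding bdry_class_def
  proof (rule Ch.finsum_cong'[OF refl])
    fix t assume "t \<in> {..r}"
    with c[of a t] c[of b t] eq[of t] assms(4,5)
    show "sg t \<odot>\<^bsub>Ch (r - 1)\<^esub> br (r - 1) (hoch_face A r t (xs[j := a \<oplus> b])) =
      sg t \<odot>\<^bsub>Ch (r - 1)\<^esub> br (r - 1) (hoch_face A r t (xs[j := a])) \<oplus>\<^bsub>Ch (r - 1)\<^esub>
      sg t \<odot>\<^bsub>Ch (r - 1)\<^esub> br (r - 1) (hoch_face A r t (xs[j := b]))"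
      by (simp add: Ch.smult_r_distr)
  qed (use c assms in simp)
  also have "\<dots> = bdry_class r (xs[j := a]) \<oplus>\<^bsub>Ch (r - 1)\<^esub> bdry_class r (xs[j := b])"
    unfolding bdry_class_def using assms by (intro Ch.finsum_addf) (auto intro!: term_closed upd)
  finally show ?thesis .
qed

lemma bdry_class_smult:
  assumes "xs \<in> tuples A r" "1 \<le> r" "j \<le> r" "a \<in> carrier A" "c \<in> carrier k"
  shows "bdry_class r (xs[j := c \<odot> a]) = c \<odot>\<^bsub>Ch (r - 1)\<^esub> bdry_class r (xs[j := a])"
proof -
  have upd: "xs[j := z] \<in> tuples A r" if "z \<in> carrier A" for z using tuples_update[OF assms(1) that] .
  have "br (r - 1) (hoch_face A r t (xs[j := c \<odot> a])) = c \<odot>\<^bsub>Ch (r - 1)\<^esub> br (r - 1) (hoch_face A r t (xs[j := a]))"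
    if t: "t \<le> r" for t
  proof -
    obtain p q where pq: "p \<in> carrier A" "q \<in> carrier A" and
      f: "\<And>a. a \<in> carrier A \<Longrightarrow> hoch_face A r t (xs[j := a]) = (hoch_face A r t xs)[pos r t j := p \<otimes> a \<otimes> q]"
      using face_update[OF assms(1,2) t assms(3)] by blast
    have "p \<otimes> (c \<odot> a) \<otimes> q = c \<odot> (p \<otimes> a \<otimes> q)"
      using pq assms by (simp add: smult_mult_left smult_mult_right)
    moreover have "pos r t j \<le> r - 1" using pos_less[OF assms(2) t assms(3)] by simp
    ultimately show ?thesis
      using f assms(4,5) pq br_smult[OF face_closed[OF assms(1,2) t], of "pos r t j" "p \<otimes> a \<otimes> q" c]
      by simp
  qed
  note eq = this
  have cl: "br (r - 1) (hoch_face A r t (xs[j := z])) \<in> carrier (Ch (r - 1))" if "z \<in> carrier A" "t \<le> r" for z t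
    using that assms(2) by (intro br_closed face_closed upd)
  have "bdry_class r (xs[j := c \<odot> a]) = (\<Oplus>\<^bsub>Ch (r - 1)\<^esub>t\<in>{..r}.
      c \<odot>\<^bsub>Ch (r - 1)\<^esub> (sg t \<odot>\<^bsub>Ch (r - 1)\<^esub> br (r - 1) (hoch_face A r t (xs[j := a]))))"
    unfolding bdry_class_def
  proof (rule Ch.finsum_cong'[OF refl])
    fix t assume "t \<in> {..r}"
    with cl[of a t] eq[of t] assms(4,5)
    show "sg t \<odot>\<^bsub>Ch (r - 1)\<^esub> br (r - 1) (hoch_face A r t (xs[j := c \<odot> a])) =
      c \<odot>\<^bsub>Ch (r - 1)\<^esub> (sg t \<odot>\<^bsub>Ch (r - 1)\<^esub> br (r - 1) (hoch_face A r t (xs[j := a])))"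
      by (simp add: Ch.smult_assoc1[symmetric] R.m_comm)
  qed (use cl assms in simp)
  also have "\<dots> = c \<odot>\<^bsub>Ch (r - 1)\<^esub> bdry_class r (xs[j := a])"
    unfolding bdry_class_def using assms by (intro Ch.finsum_smult_ldistr[symmetric]) (auto intro!: term_closed upd)
  finally show ?thesis .
qed

lemma bdry_class_balance:
  assumes "xs \<in> tuples A r" "1 \<le> r" "i \<le> r" "j = Suc i mod Suc r" "y \<in> carrier K"
  shows "bdry_class r (xs[i := xs ! i \<otimes> \<iota> y]) = bdry_class r (xs[j := \<iota> y \<otimes> xs ! j])"
proof -
  have "j \<le> r" using assms(4) by (simp add: less_Suc_eq_le[symmetric])
  then have "xs[j := \<iota> y \<otimes> xs ! j] \<in> tuples A r"
    using assms by (intro tuples_update M.m_closed tuples_nth) auto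
  then show ?thesis unfolding bdry_class_def using assms
    by (intro Ch.finsum_cong') (auto intro!: term_closed simp: face_balance)
qed

text \<open>If \<open>a\<^sub>j\<close> comes from \<open>K\<close>, all faces that keep it vanish. The two faces that multiply it with a
  neighbour agree by balancing and carry opposite signs.\<close>

lemma bdry_class_iota:
  assumes xs: "xs \<in> tuples A r" and j: "1 \<le> j" "j \<le> r" and y: "y \<in> carrier K"
  shows "bdry_class r (xs[j := \<iota> y]) = \<zero>\<^bsub>Ch (r - 1)\<^esub>"
proof -
  have r: "1 \<le> r" using j by simp
  let ?xs = "xs[j := \<iota> y]"
  have xs': "?xs \<in> tuples A r" using xs y by (intro tuples_update) auto
  let ?f = "\<lambda>t. sg t \<odot>\<^bsub>Ch (r - 1)\<^esub> br (r - 1) (hoch_face A r t ?xs)"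
  have 0: "br (r - 1) (hoch_face A r t ?xs) = \<zero>\<^bsub>Ch (r - 1)\<^esub>" if t: "t \<le> r" "t \<noteq> j" "t \<noteq> j - 1" for t
  proof -
    have "hoch_face A r t ?xs = (hoch_face A r t xs)[pos r t j := \<iota> y]"
    proof (rule face_eqI[OF xs' r t(1)])
      fix m assume m: "m < r"
      note simps = face_entry_def tuples_update_nth[OF xs] pos_def
      show "face_entry r t ?xs m = (hoch_face A r t xs)[pos r t j := \<iota> y] ! m"
        unfolding face_update_nth[OF xs r t(1) m]
      proof (cases "t < r")
        case True
        consider "m < t" | "m = t" | "t < m" by linarith
        then show "face_entry r t ?xs m = (if m = pos r t j then \<iota> y else face_entry r t xs m)"
          by cases (use True m t j in \<open>auto simp: simps\<close>)
      next
        case False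
        then show "face_entry r t ?xs m = (if m = pos r t j then \<iota> y else face_entry r t xs m)"
          using m t j by (cases "m = 0") (auto simp: simps)
      qed
    qed (use face_length[OF xs r t(1)] in simp)
    moreover have "1 \<le> pos r t j" using t j by (auto simp: pos_def)
    ultimately show ?thesis
      using br_iota[OF face_closed[OF xs r t(1)], of "pos r t j" y] pos_less[OF r t(1) j(2)] y by simp
  qed
  \<comment> \<open>The tuple without the factor j; both surviving faces multiply y onto one of its entries.\<close>
  define zs where "zs = take j xs @ drop (Suc j) xs"
  have zl: "length zs = r" using xs j by (simp add: zs_def tuples_def)
  have zn: "zs ! m = (if m < j then xs ! m else xs ! Suc m)" if "m < r" for m
    using that xs j by (auto simp: zs_def tuples_def nth_append)
  have zt: "zs \<in> tuples A (r - 1)" using zl zn r xs by (intro tuplesI) (auto simp: tuples_nth)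
  have f1: "hoch_face A r (j - 1) ?xs = zs[j - 1 := zs ! (j - 1) \<otimes> \<iota> y]"
  proof (rule face_eqI[OF xs' r])
    fix m assume "m < r"
    then show "face_entry r (j - 1) ?xs m = zs[j - 1 := zs ! (j - 1) \<otimes> \<iota> y] ! m"
      using j tuples_length[OF xs] zl by (auto simp: face_entry_def nth_list_update zn)
  qed (use j zl in auto)
  let ?j = "Suc (j - 1) mod Suc (r - 1)"
  have j': "?j = (if j < r then j else 0)" using j r by (subst cyclic_Suc) auto
  have f2: "hoch_face A r j ?xs = zs[?j := \<iota> y \<otimes> zs ! ?j]"
  proof (rule face_eqI[OF xs' r j(2)])
    fix m assume "m < r"
    then show "face_entry r j ?xs m = zs[?j := \<iota> y \<otimes> zs ! ?j] ! m"
      unfolding j' using j tuples_length[OF xs] zl by (auto simp: face_entry_def nth_list_update zn)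
  qed (use zl in auto)
  have eq: "br (r - 1) (hoch_face A r (j - 1) ?xs) = br (r - 1) (hoch_face A r j ?xs)"
    unfolding f1 f2 using j by (intro br_balance[OF zt _ _ y]) auto
  let ?v = "br (r - 1) (hoch_face A r j ?xs)"
  have v: "?v \<in> carrier (Ch (r - 1))" using face_closed[OF xs' r j(2)] by simp
  have "bdry_class r ?xs = (\<Oplus>\<^bsub>Ch (r - 1)\<^esub>t\<in>{j - 1, j}. ?f t)"
    unfolding bdry_class_def
  proof (rule Ch.add.finprod_mono_neutral_cong_right)
    fix t assume "t \<in> {..r} - {j - 1, j}"
    then show "?f t = \<zero>\<^bsub>Ch (r - 1)\<^esub>" using 0[of t] by simp
  qed (use j xs' r in \<open>auto intro!: term_closed\<close>)
  also have "\<dots> = ?f (j - 1) \<oplus>\<^bsub>Ch (r - 1)\<^esub> ?f j"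
    using j v eq by (subst Ch.finsum_insert) auto
  also have "?f j = \<ominus>\<^bsub>Ch (r - 1)\<^esub> (sg (j - 1) \<odot>\<^bsub>Ch (r - 1)\<^esub> ?v)"
    using sg_Suc[OF v, of "j - 1"] j by simp
  finally show ?thesis using v by (simp add: eq Ch.r_neg)
qed

text \<open>Two tuples of representatives are joined by changing one factor at a time; each change adds an
  element of \<open>\<iota>(K)\<close> to a factor behind the first one and does not affect the class by
  \<open>bdry_class_iota\<close>.\<close>

lemma bdry_class_cong:
  assumes xs: "xs \<in> tuples A r" and ys: "ys \<in> tuples A r" and r: "1 \<le> r"
    and red: "reduce K A \<iota> xs = reduce K A \<iota> ys"
  shows "bdry_class r xs = bdry_class r ys"
proof -
  have lx: "length xs = Suc r" "length ys = Suc r" using xs ys by (auto simp: tuples_def)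
  define zs where "zs m = take m ys @ drop m xs" for m
  have zl: "length (zs m) = Suc r" if "m \<le> Suc r" for m using that lx by (simp add: zs_def)
  have zn: "zs m ! i = (if i < m then ys ! i else xs ! i)" if "m \<le> Suc r" "i \<le> r" for m i
    using that lx by (auto simp: zs_def nth_append)
  have zt: "zs m \<in> tuples A r" if "m \<le> Suc r" for m
    using zl[OF that] zn[OF that] xs ys by (intro tuplesI) (auto simp: tuples_nth)
  have "bdry_class r (zs m) = bdry_class r xs" if "m \<le> Suc r" for m
    using that
  proof (induction m)
    case 0 show ?case by (simp add: zs_def)
  next
    case (Suc m)
    have m: "m \<le> r" using Suc.prems by simp
    have upd: "zs (Suc m) = (zs m)[m := ys ! m]" "zs m = (zs m)[m := xs ! m]"
      using m by (auto intro!: nth_equalityI simp: zl zn nth_list_update less_Suc_eq_le)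
    show ?case
    proof (cases "m = 0")
      case True
      then show ?thesis using reduceD(1)[OF xs ys red] upd Suc by simp
    next
      case False
      then have "(\<iota> ` carrier K) +> (xs ! m) = (\<iota> ` carrier K) +> (ys ! m)"
        using reduceD(2)[OF xs ys red, of m] m by simp
      moreover have "xs ! m \<in> (\<iota> ` carrier K) +> (xs ! m)"
        using tuples_nth[OF xs m] by (rule iK.a_rcos_self)
      ultimately obtain y where y: "y \<in> carrier K" "xs ! m = \<iota> y \<oplus> ys ! m"
        by (auto simp: a_r_coset_def')
      have "bdry_class r ((zs m)[m := xs ! m]) = bdry_class r ((zs m)[m := \<iota> y]) \<oplus>\<^bsub>Ch (r - 1)\<^esub> bdry_class r ((zs m)[m := ys ! m])"
        unfolding y(2) using m y tuples_nth[OF ys m] zt by (intro bdry_class_add r) auto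
      also have "bdry_class r ((zs m)[m := \<iota> y]) = \<zero>\<^bsub>Ch (r - 1)\<^esub>"
        using False m y zt by (intro bdry_class_iota) auto
      finally have "bdry_class r ((zs m)[m := xs ! m]) = bdry_class r ((zs m)[m := ys ! m])"
        using bdry_class_closed[OF tuples_update[OF zt tuples_nth[OF ys m]] r] m by simp
      then show ?thesis using upd Suc by simp
    qed
  qed
  from this[of "Suc r"] show ?thesis using lx by (simp add: zs_def)
qed

abbreviation bdf where "bdf r \<equiv> hoch_bdry_free k K A \<iota> r"

text \<open>The representatives chosen by the boundary on free modules.\<close>

definition rep :: "nat \<Rightarrow> 'c \<times> 'c set list \<Rightarrow> 'c list" where
  "rep r g = (SOME xs. xs \<in> tuples A r \<and> reduce K A \<iota> xs = g)"

lemma rep: "xs \<in> tuples A r \<Longrightarrow> rep r (reduce K A \<iota> xs) \<in> tuples A r \<and>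
    reduce K A \<iota> (rep r (reduce K A \<iota> xs)) = reduce K A \<iota> xs"
  unfolding rep_def by (rule someI[of _ xs]) simp

lemma bdf_eq: "bdf r = R.lin_ext (Fr (r - 1)) (\<lambda>g. hoch_bdry_tuple k K A \<iota> r (rep r g))"
  by (rule ext) (simp add: hoch_bdry_free_def R.lin_ext_def rep_def)

lemma bdf_fun: "1 \<le> r \<Longrightarrow> (\<lambda>g. hoch_bdry_tuple k K A \<iota> r (rep r g)) \<in> reduce K A \<iota> ` tuples A r \<rightarrow> carrier (Fr (r - 1))"
  using rep by (auto intro!: bdry_tuple_closed)

lemma bdf_linear: "1 \<le> r \<Longrightarrow> linear k (Fr r) (Fr (r - 1)) (bdf r)"
  unfolding bdf_eq by (intro linear.intro linear_axioms.intro Fr_module R.lin_ext_linear bdf_fun)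

lemma cl_bdf_tn:
  assumes "xs \<in> tuples A r" "1 \<le> r"
  shows "Nr.cl (r - 1) (bdf r (tn xs)) = bdry_class r xs"
proof -
  have "bdf r (tn xs) = hoch_bdry_tuple k K A \<iota> r (rep r (reduce K A \<iota> xs))"
    unfolding bdf_eq using assms by (intro R.lin_ext_gen[OF Fr_module bdf_fun]) auto
  then have "Nr.cl (r - 1) (bdf r (tn xs)) = bdry_class r (rep r (reduce K A \<iota> xs))"
    using rep[OF assms(1)] assms(2) by (simp add: cl_bdry_tuple)
  also have "\<dots> = bdry_class r xs" using rep[OF assms(1)] assms by (intro bdry_class_cong) auto
  finally show ?thesis .
qed

lemma bdf_Nul:
  assumes r: "1 \<le> r" and u: "u \<in> Nul r" shows "bdf r u \<in> Nul (r - 1)"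
proof -
  interpret b: linear k "Fr r" "Fr (r - 1)" "bdf r" by (rule bdf_linear[OF r])
  let ?H = "{x \<in> carrier (Fr r). bdf r x \<in> Nul (r - 1)}"
  have "hoch_rels k K A \<iota> r \<subseteq> ?H"
  proof
    fix x assume x: "x \<in> hoch_rels k K A \<iota> r"
    then have xc: "x \<in> carrier (Fr r)" using rels_closed by blast
    have "Nr.cl (r - 1) (bdf r x) = \<zero>\<^bsub>Ch (r - 1)\<^esub>"
    proof -
      show ?thesis using x
      proof (cases rule: rels_cases)
        case (add xs i a b)
        have t: "xs[i := z] \<in> tuples A r" if "z \<in> carrier A" for z using tuples_update[OF add(1) that] .
        note tc = tn_closed[OF t]
        show ?thesis using add(2-4) t tc r unfolding add(5)
          by (simp add: b.diff b.add cl.diff cl.add cl_bdf_tn bdry_class_add[OF add(1)] Ch.minus_eq Ch.r_neg bdry_class_closed)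
      next
        case (smult xs i a c)
        have t: "xs[i := z] \<in> tuples A r" if "z \<in> carrier A" for z using tuples_update[OF smult(1) that] .
        note tc = tn_closed[OF t]
        show ?thesis using smult(2-4) t tc r unfolding smult(5)
          by (simp add: b.diff b.smult cl.diff cl.smult cl_bdf_tn bdry_class_smult[OF smult(1)] Ch.minus_eq Ch.r_neg bdry_class_closed)
      next
        case (balance xs i j y)
        have j: "j \<le> r" using balance(3) by (simp add: less_Suc_eq_le[symmetric])
        have t: "xs[i := xs ! i \<otimes> \<iota> y] \<in> tuples A r" "xs[j := \<iota> y \<otimes> xs ! j] \<in> tuples A r"
          using balance j by (auto intro!: tuples_update M.m_closed tuples_nth)
        show ?thesis using t tn_closed[OF t(1)] tn_closed[OF t(2)] r bdry_class_balance[OF balance(1) r balance(2-4)] unfolding balance(5)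
          by (simp add: b.diff cl.diff cl_bdf_tn Ch.minus_eq Ch.r_neg bdry_class_closed)
      qed
    qed
    then show "x \<in> ?H" using xc b.closed[OF xc] Nr.cl_eq_N_iff by (simp add: Ch_eq Nr.subquot_simps(2))
  qed
  moreover have "submodule ?H k (Fr r)" by (rule b.vimage_submodule[OF Nul_submodule])
  ultimately have "Nul r \<subseteq> ?H" unfolding hoch_null_def by (intro span_mod_least)
  then show ?thesis using u by blast
qed

lemma bdry_cl:
  assumes r: "1 \<le> r" and u: "u \<in> carrier (Fr r)"
  shows "hoch_bdry k K A \<iota> r (Nr.cl r u) = Nr.cl (r - 1) (bdf r u)"
proof -
  interpret b: linear k "Fr r" "Fr (r - 1)" "bdf r" by (rule bdf_linear[OF r])
  have "Nr.cl (r - 1) (bdf r v) = Nr.cl (r - 1) (bdf r u)" if v: "v \<in> Nr.cl r u" for v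
  proof -
    obtain z where z: "z \<in> Nul r" "v = z \<oplus>\<^bsub>Fr r\<^esub> u" using v by (auto simp: a_r_coset_def')
    have zc: "z \<in> carrier (Fr r)" using z Nr.N_closed by blast
    have "Nr.cl (r - 1) (bdf r z) = \<zero>\<^bsub>Ch (r - 1)\<^esub>"
      using bdf_Nul[OF r z(1)] zc b.closed Nr.cl_eq_N_iff by (simp add: Ch_eq Nr.subquot_simps(2))
    then show ?thesis using z zc u by (simp add: b.add cl.add)
  qed
  moreover have "u \<in> Nr.cl r u" using u Nr.N_zero by (force simp: a_r_coset_def')
  ultimately show ?thesis unfolding hoch_bdry_def by blast
qed

abbreviation bd where "bd r \<equiv> hoch_bdry k K A \<iota> r"

lemma Ch_cases: "Y \<in> carrier (Ch r) \<Longrightarrow> (\<And>u. u \<in> carrier (Fr r) \<Longrightarrow> Y = Nr.cl r u \<Longrightarrow> thesis) \<Longrightarrow> thesis"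
  unfolding Ch_eq by (erule Nr.Q_cases)

lemma bd_linear: "1 \<le> r \<Longrightarrow> linear k (Ch r) (Ch (r - 1)) (bd r)"
proof (intro linear.intro linear_axioms.intro Ch_module)
  assume r: "1 \<le> r"
  interpret b: linear k "Fr r" "Fr (r - 1)" "bdf r" by (rule bdf_linear[OF r])
  show "linear_map k (Ch r) (Ch (r - 1)) (bd r)"
    unfolding linear_map_def
    by (auto elim!: Ch_cases simp: bdry_cl[OF r] cl.add[symmetric] cl.smult[symmetric] b.add b.smult)
qed

lemma bd_br: "xs \<in> tuples A r \<Longrightarrow> 1 \<le> r \<Longrightarrow> bd r (br r xs) = bdry_class r xs"
  by (simp add: bdry_cl tn_closed cl_bdf_tn)

lemma Ch_induct [consumes 1, case_names br add smult]:
  assumes "Y \<in> carrier (Ch r)" "\<And>xs. xs \<in> tuples A r \<Longrightarrow> Q (br r xs)"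
    "\<And>x y. x \<in> carrier (Ch r) \<Longrightarrow> y \<in> carrier (Ch r) \<Longrightarrow> Q x \<Longrightarrow> Q y \<Longrightarrow> Q (x \<oplus>\<^bsub>Ch r\<^esub> y)"
    "\<And>c x. c \<in> carrier k \<Longrightarrow> x \<in> carrier (Ch r) \<Longrightarrow> Q x \<Longrightarrow> Q (c \<odot>\<^bsub>Ch r\<^esub> x)"
  shows "Q Y"
proof -
  obtain u where u: "u \<in> carrier (Fr r)" "Y = Nr.cl r u" using assms(1) by (rule Ch_cases)
  have genQ: "Q (Nr.cl r (x \<odot>\<^bsub>Fr r\<^esub> tn xs))" if "x \<in> carrier k" "xs \<in> tuples A r" for x xs
    using that assms(2,4) by (simp add: cl.smult tn_closed)
  have "Q (Nr.cl r u)" using u(1)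
  proof (induction u rule: R.free_induct)
    case zero
    have t: "replicate (Suc r) \<zero> \<in> tuples A r" by (auto simp: tuples_def)
    have "Nr.cl r (\<zero>\<^bsub>k\<^esub> \<odot>\<^bsub>Fr r\<^esub> tn (replicate (Suc r) \<zero>)) = Nr.cl r \<zero>\<^bsub>Fr r\<^esub>"
      using tn_closed[OF t] by simp
    then show ?case using genQ[OF _ t, of "\<zero>\<^bsub>k\<^esub>"] by simp
  next
    case (gen x g)
    then show ?case using genQ by auto
  next
    case (add u v)
    then show ?case using assms(3) by (simp add: cl.add)
  qed
  then show ?thesis using u by simp
qed

end

declare One_nat_def [simp]


section \<open>Twisted commutators\<close>

text \<open>The additive extension of \<open>\<psi>\<close> to formal sums, with values in a group given by its carrier. It
  is chosen by its universal property.\<close>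

definition frag_map :: "('v, 'm) ring_scheme \<Rightarrow> ('x \<Rightarrow> 'v) \<Rightarrow> ('x \<Rightarrow>\<^sub>0 int) \<Rightarrow> 'v" where
  "frag_map M \<psi> = (SOME h. (\<forall>x y. h (x + y) = h x \<oplus>\<^bsub>M\<^esub> h y) \<and> (\<forall>x. h x \<in> carrier M) \<and> (\<forall>x. h (frag_of x) = \<psi> x))"

locale frag_hom = abelian_group M for M :: "('v, 'm) ring_scheme" (structure) +
  fixes \<psi> :: "'x \<Rightarrow> 'v"
  assumes psi_closed: "\<psi> x \<in> carrier M"
begin

abbreviation f where "f \<equiv> frag_map M \<psi>"

lemma props: "f (x + y) = f x \<oplus> f y" "f x \<in> carrier M" "f (frag_of i) = \<psi> i"
proof -
  have "\<psi> ` UNIV \<subseteq> carrier (add_monoid M)" using psi_closed by auto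
  from comm_group.free_Abelian_group_universal[OF a_comm_group this] obtain h
    where h: "h \<in> hom (free_Abelian_group UNIV) (add_monoid M)" "\<And>x. x \<in> UNIV \<Longrightarrow> h (frag_of x) = \<psi> x" by metis
  have "(\<forall>x y. h (x + y) = h x \<oplus> h y) \<and> (\<forall>x. h x \<in> carrier M) \<and> (\<forall>x. h (frag_of x) = \<psi> x)"
    using h by (auto simp: hom_def)
  from someI[of "\<lambda>h. (\<forall>x y. h (x + y) = h x \<oplus> h y) \<and> (\<forall>x. h x \<in> carrier M) \<and> (\<forall>x. h (frag_of x) = \<psi> x)", OF this]
  show "f (x + y) = f x \<oplus> f y" "f x \<in> carrier M" "f (frag_of i) = \<psi> i"
    unfolding frag_map_def by blast+
qed

lemmas add = props(1) and closed [simp, intro] = props(2) and of = props(3)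

lemma zero [simp]: "f 0 = \<zero>"
  using add[of 0 0] closed[of 0] by (simp add: add.l_cancel_one)
lemma minus: "f (- x) = \<ominus> f x"
proof -
  have "f (- x) \<oplus> f x = \<zero>" using add[of "- x" x] by simp
  then show ?thesis by (simp add: minus_equality)
qed
lemma diff: "f (x - y) = f x \<ominus> f y"
  using add[of x "- y"] by (simp add: minus a_minus_def)
lemma sum: "finite S \<Longrightarrow> f (sum g S) = (\<Oplus>i\<in>S. f (g i))"
  by (induction S rule: finite_induct) (auto simp: add)

end

context twisted_algebra
begin

abbreviation TC where "TC T \<equiv> twisted_comm k K \<alpha> T"

lemma K_module: "Module.module k K" ..

lemma TC_gens: "{(b \<otimes> (\<alpha> ^^ T) a) \<ominus> (a \<otimes> b) | a b. a \<in> carrier K \<and> b \<in> carrier K} \<subseteq> carrier K"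
  by auto
lemma TC_submodule: "submodule (TC T) k K"
  unfolding twisted_comm_def by (rule span_mod_submodule[OF TC_gens])
lemma TC_gen: "a \<in> carrier K \<Longrightarrow> b \<in> carrier K \<Longrightarrow> (b \<otimes> (\<alpha> ^^ T) a) \<ominus> (a \<otimes> b) \<in> TC T"
  unfolding twisted_comm_def by (rule subsetD[OF span_mod_superset]) blast
lemma TC_sub: "TC T \<subseteq> carrier K" using submoduleE(1)[OF TC_submodule] .
lemma TC_closed: "x \<in> TC T \<Longrightarrow> x \<in> carrier K" using TC_sub by blast
lemma TC_zero: "\<zero> \<in> TC T" by (rule submodule_zero[OF TC_submodule])
lemma TC_add: "x \<in> TC T \<Longrightarrow> y \<in> TC T \<Longrightarrow> x \<oplus> y \<in> TC T" using submoduleE(5)[OF TC_submodule] .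
lemma TC_neg: "x \<in> TC T \<Longrightarrow> \<ominus> x \<in> TC T" using submoduleE(3)[OF TC_submodule] .
lemma TC_diff: "x \<in> TC T \<Longrightarrow> y \<in> TC T \<Longrightarrow> x \<ominus> y \<in> TC T"
  unfolding a_minus_def by (intro TC_add TC_neg)

text \<open>A linear map sends twisted commutators into a submodule as soon as it does so for the generating
  ones.\<close>

lemma TC_linear:
  assumes "linear k K N f" "submodule S k N"
    and "\<And>a b. a \<in> carrier K \<Longrightarrow> b \<in> carrier K \<Longrightarrow> f (b \<otimes> (\<alpha> ^^ T) a) \<ominus>\<^bsub>N\<^esub> f (a \<otimes> b) \<in> S"
    and "x \<in> TC T"
  shows "f x \<in> S"
proof -
  interpret f: linear k K N f by fact
  have "submodule {x \<in> carrier K. f x \<in> S} k K" by (rule f.vimage_submodule[OF assms(2)])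
  moreover have "{(b \<otimes> (\<alpha> ^^ T) a) \<ominus> (a \<otimes> b) | a b. a \<in> carrier K \<and> b \<in> carrier K} \<subseteq> {x \<in> carrier K. f x \<in> S}"
    using assms(3) by (auto simp: f.diff)
  ultimately have "TC T \<subseteq> {x \<in> carrier K. f x \<in> S}" unfolding twisted_comm_def by (rule span_mod_least)
  then show ?thesis using assms(4) by blast
qed

lemma linearI:
  assumes "Module.module k N" "\<And>x. x \<in> carrier K \<Longrightarrow> f x \<in> carrier N"
    "\<And>x y. x \<in> carrier K \<Longrightarrow> y \<in> carrier K \<Longrightarrow> f (x \<oplus> y) = f x \<oplus>\<^bsub>N\<^esub> f y"
    "\<And>c x. c \<in> carrier k \<Longrightarrow> x \<in> carrier K \<Longrightarrow> f (c \<odot> x) = c \<odot>\<^bsub>N\<^esub> f x"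
  shows "linear k K N f"
  by (intro linear.intro linear_axioms.intro K_module assms(1)) (use assms(2-) in \<open>simp add: linear_map_def\<close>)

lemma pow_linear: "linear k K K (\<alpha> ^^ s)"
  by (rule linearI[OF K_module]) (auto simp: pow_add pow_smult)

lemma TC_pow: "x \<in> TC T \<Longrightarrow> (\<alpha> ^^ s) x \<in> TC T"
proof (rule TC_linear[OF pow_linear TC_submodule])
  fix a b assume "a \<in> carrier K" "b \<in> carrier K"
  moreover from this have "(\<alpha> ^^ s) ((\<alpha> ^^ T) a) = (\<alpha> ^^ T) ((\<alpha> ^^ s) a)"
    by (metis add.commute comp_apply funpow_add)
  ultimately show "(\<alpha> ^^ s) (b \<otimes> (\<alpha> ^^ T) a) \<ominus> (\<alpha> ^^ s) (a \<otimes> b) \<in> TC T"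
    using TC_gen[of "(\<alpha> ^^ s) a" "(\<alpha> ^^ s) b" T] by (simp add: pow_mult)
qed

text \<open>Outside the carrier of \<open>K\<close> the operations \<open>tw\<close> and \<open>mc\<close> are the identity, so that the laws of
  \<open>cyclic_complex\<close> hold for all elements of the type; \<open>val\<close> evaluates a formal sum of scalars and
  discards these extra elements.\<close>

definition tw where "tw s a = (if a \<in> carrier K then (\<alpha> ^^ s) a else a)"
definition val where "val = frag_map K (\<lambda>a. if a \<in> carrier K then a else \<zero>)"

sublocale val: frag_hom K "\<lambda>a. if a \<in> carrier K then a else \<zero>"
  by unfold_locales auto

lemma val_simps [simp]: "val 0 = \<zero>" "val (x + y) = val x \<oplus> val y" "val (x - y) = val x \<ominus> val y"
  "val q \<in> carrier K" "val (frag_of a) = (if a \<in> carrier K then a else \<zero>)"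
  by (simp_all add: val_def val.add val.diff val.of)

end

context monogenic
begin

lemma mult_c_linear: "linear k K K (\<lambda>a. a \<otimes> c)"
  by (rule linearI[OF K_module]) (auto simp: M.l_distr smult_mult_left)

text \<open>\<open>b \<alpha>\<^bsup>T+n\<^esup>(a) c = (b c) \<alpha>\<^sup>T(a)\<close>.\<close>

lemma TC_mult_c: "x \<in> TC (T + n) \<Longrightarrow> x \<otimes> c \<in> TC T"
proof (rule TC_linear[OF mult_c_linear TC_submodule])
  fix a b assume ab: "a \<in> carrier K" "b \<in> carrier K"
  have "(\<alpha> ^^ (T + n)) a = (\<alpha> ^^ n) ((\<alpha> ^^ T) a)" by (metis add.commute comp_apply funpow_add)
  then have "b \<otimes> (\<alpha> ^^ (T + n)) a \<otimes> c = b \<otimes> c \<otimes> (\<alpha> ^^ T) a"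
    using ab by (simp add: M.m_assoc c_comm)
  then show "b \<otimes> (\<alpha> ^^ (T + n)) a \<otimes> c \<ominus> a \<otimes> b \<otimes> c \<in> TC T"
    using TC_gen[of a "b \<otimes> c" T] ab by (simp add: M.m_assoc)
qed

lemma u_pow_mod: "(\<alpha> ^^ T) u = (\<alpha> ^^ (T mod n)) u"
proof -
  have "(\<alpha> ^^ (j * n)) u = u" for j
    by (induction j) (simp_all add: funpow_add alpha_u)
  then show ?thesis by (metis comp_apply funpow_add mod_div_mult_eq)
qed

text \<open>For \<open>b = x (u - \<alpha>\<^sup>T(u))\<^sup>-\<^sup>1\<close> the element \<open>x = u b - b \<alpha>\<^sup>T(u)\<close> is, up to sign, a generating
  twisted commutator; \<open>\<alpha>\<^sup>T(u)\<close> depends only on \<open>T\<close> modulo \<open>n\<close>.\<close>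

lemma TC_top: "\<not> n dvd T \<Longrightarrow> x \<in> carrier K \<Longrightarrow> x \<in> TC T"
proof -
  assume T: "\<not> n dvd T" and x: "x \<in> carrier K"
  let ?i = "T mod n"
  let ?v = "(\<alpha> ^^ ?i) u" and ?w = "u \<ominus> (\<alpha> ^^ ?i) u"
  have i: "1 \<le> ?i" "?i < n" using T n_ge_2 by (auto simp: dvd_eq_mod_eq_0 Suc_le_eq)
  have w: "?w \<in> Units K" by (rule u_unit[OF i])
  then have wi: "inv ?w \<in> carrier K" by simp
  let ?b = "x \<otimes> inv ?w"
  have "u \<otimes> ?b \<ominus> ?b \<otimes> ?v = ?b \<otimes> ?w"
    using x wi u_closed u_comm[of ?b] by (simp add: a_minus_def M.r_distr M.r_minus)
  also have "\<dots> = x" using x w wi by (simp add: M.m_assoc M.Units_closed)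
  finally have eq: "u \<otimes> ?b \<ominus> ?b \<otimes> ?v = x" .
  have "\<ominus> (?b \<otimes> (\<alpha> ^^ T) u \<ominus> u \<otimes> ?b) \<in> TC T"
    using x wi u_closed by (intro TC_neg TC_gen) auto
  moreover have "\<ominus> (?b \<otimes> (\<alpha> ^^ T) u \<ominus> u \<otimes> ?b) = u \<otimes> ?b \<ominus> ?b \<otimes> ?v"
    using x wi u_closed unfolding u_pow_mod[of T] by (simp add: a_minus_def M.minus_add M.a_comm)
  ultimately show "x \<in> TC T" using eq by simp
qed

definition mc where "mc a = (if a \<in> carrier K then a \<otimes> c else a)"
definition Q where "Q T = {q. val q \<in> TC T}"

lemma val_push_tw: "val (push (tw s) q) = (\<alpha> ^^ s) (val q)"
  by (induction q rule: frag_all_induct) (auto simp: tw_def a_minus_def pow_add pow_minus)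
lemma val_push_mc: "val (push mc q) = val q \<otimes> c"
  by (induction q rule: frag_all_induct) (auto simp: mc_def a_minus_def M.l_distr M.l_minus)

lemma cyclic: "cyclic_complex n tw mc Q"
proof
  show "2 \<le> n" by (rule n_ge_2)
  show "tw 0 a = a" for a by (simp add: tw_def)
  show "tw s (tw t a) = tw (s + t) a" for s t a by (simp add: tw_def funpow_add)
  show "mc (tw s a) = tw s (mc a)" for s a by (simp add: tw_def mc_def pow_mult)
  show "0 \<in> Q T" for T by (simp add: Q_def TC_zero)
  show "x - y \<in> Q T" if "x \<in> Q T" "y \<in> Q T" for x y T using that by (simp add: Q_def TC_diff)
  show "push (tw s) x \<in> Q T" if "x \<in> Q T" for x s T using that by (simp add: Q_def val_push_tw TC_pow)
  show "push mc x \<in> Q T" if "x \<in> Q (T + n)" for x T using that by (simp add: Q_def val_push_mc TC_mult_c)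
  show "x \<in> Q T" if "\<not> n dvd T" for x T using that by (simp add: Q_def TC_top)
  show "frag_of (mc a) - frag_of (mc (tw n a)) \<in> Q T" for a T
  proof (cases "a \<in> carrier K")
    case True
    then have "val (frag_of (mc a) - frag_of (mc (tw n a))) = a \<otimes> (\<alpha> ^^ T) c \<ominus> c \<otimes> a"
      by (simp add: mc_def tw_def c_comm)
    then show ?thesis using TC_gen[of c a T] True by (simp add: Q_def)
  next
    case False
    then show ?thesis by (simp add: mc_def tw_def Q_def TC_zero)
  qed
qed

sublocale cyc: cyclic_complex n tw mc Q by (rule cyclic)

sublocale H: rel_algebra k A K emb
  by (intro rel_algebra.intro rel_algebra_axioms.intro A_algebra M.ring_axioms emb_hom)

end


section \<open>From symbols to Hochschild chains\<close>

context monogenic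
begin

abbreviation xp where "xp w \<equiv> X [^]\<^bsub>A\<^esub> (w::nat)"

text \<open>The tuple \<open>(a x\<^sup>e, x\<^bsup>w\<^sub>1\<^esup>, \<dots>, x\<^bsup>w\<^sub>r\<^esup>)\<close> described by a symbol.\<close>

definition pt where "pt a e W = (emb a \<otimes>\<^bsub>A\<^esub> xp e) # map xp W"

lemma pt_length [simp]: "length (pt a e W) = Suc (length W)" by (simp add: pt_def)
lemma pt_tuples: "a \<in> carrier K \<Longrightarrow> pt a e W \<in> tuples A (length W)"
  by (auto simp: tuples_def pt_def)
lemma pt_update_0: "(pt a e W)[0 := emb b \<otimes>\<^bsub>A\<^esub> xp e] = pt b e W"
  by (simp add: pt_def)
lemma pt_nth_Suc: "i < length W \<Longrightarrow> pt a e W ! Suc i = xp (W ! i)"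
  by (simp add: pt_def)
lemma pt_nth_0: "pt a e W ! 0 = emb a \<otimes>\<^bsub>A\<^esub> xp e"
  by (simp add: pt_def)

lemma head_mult_emb:
  assumes "a \<in> carrier K" "b \<in> carrier K"
  shows "emb a \<otimes>\<^bsub>A\<^esub> xp e \<otimes>\<^bsub>A\<^esub> emb b = emb (a \<otimes> (\<alpha> ^^ e) b) \<otimes>\<^bsub>A\<^esub> xp e"
  using assms by (simp add: A.m_assoc X_pow_emb ring_hom_mult[OF emb_hom])

text \<open>A scalar standing behind the factor \<open>j\<close> moves to the front and is twisted by every power of \<open>x\<close>
  that it passes.\<close>

lemma br_slide:
  fixes e :: nat
  assumes a: "a \<in> carrier K" and y: "y \<in> carrier K" and j: "j \<le> length W"
  defines "xs \<equiv> pt a e W"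
  shows "H.br (length W) (xs[j := xs ! j \<otimes>\<^bsub>A\<^esub> emb y]) = H.br (length W) (pt (a \<otimes> (\<alpha> ^^ (e + sum_list (take j W))) y) e W)"
  using y j
proof (induction j arbitrary: y)
  case 0
  then show ?case using a head_mult_emb[of a y e] by (simp add: xs_def pt_nth_0 pt_update_0)
next
  case (Suc j)
  let ?w = "W ! j"
  have xs: "xs \<in> tuples A (length W)" using a by (simp add: xs_def pt_tuples)
  have "xs ! Suc j \<otimes>\<^bsub>A\<^esub> emb y = emb ((\<alpha> ^^ ?w) y) \<otimes>\<^bsub>A\<^esub> xs ! Suc j"
    using Suc.prems by (simp add: xs_def pt_nth_Suc X_pow_emb)
  then have "H.br (length W) (xs[Suc j := xs ! Suc j \<otimes>\<^bsub>A\<^esub> emb y]) =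
      H.br (length W) (xs[Suc j := emb ((\<alpha> ^^ ?w) y) \<otimes>\<^bsub>A\<^esub> xs ! Suc j])" by simp
  also have "\<dots> = H.br (length W) (xs[j := xs ! j \<otimes>\<^bsub>A\<^esub> emb ((\<alpha> ^^ ?w) y)])"
    using Suc.prems by (intro H.br_balance[OF xs, symmetric]) auto
  also have "\<dots> = H.br (length W) (pt (a \<otimes> (\<alpha> ^^ (e + sum_list (take j W))) ((\<alpha> ^^ ?w) y)) e W)"
    using Suc.prems by (intro Suc.IH) auto
  also have "(\<alpha> ^^ (e + sum_list (take j W))) ((\<alpha> ^^ ?w) y) = (\<alpha> ^^ (e + sum_list (take (Suc j) W))) y"
  proof -
    have "e + sum_list (take (Suc j) W) = e + sum_list (take j W) + ?w"
      using Suc.prems by (simp add: take_Suc_conv_app_nth)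
    then show ?thesis by (simp only: funpow_add comp_apply)
  qed
  finally show ?case .
qed

lemma pt_mult_left: "a \<in> carrier K \<Longrightarrow> y \<in> carrier K \<Longrightarrow> emb y \<otimes>\<^bsub>A\<^esub> (emb a \<otimes>\<^bsub>A\<^esub> xp e) = emb (y \<otimes> a) \<otimes>\<^bsub>A\<^esub> xp e"
  by (simp add: A.m_assoc[symmetric] ring_hom_mult[OF emb_hom])

text \<open>Sliding \<open>y\<close> from the last position to the front, or passing it across the cyclic joint, gives
  the two sides. Their difference is a twisted commutator of the weight of the symbol, which is how
  \<open>[K,K]\<^bsub>\<alpha>\<^sup>T\<^esub>\<close> enters.\<close>

lemma br_cyclic:
  assumes a: "a \<in> carrier K" and y: "y \<in> carrier K"
  shows "H.br (length W) (pt (a \<otimes> (\<alpha> ^^ (e + sum_list W)) y) e W) = H.br (length W) (pt (y \<otimes> a) e W)"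
proof -
  let ?xs = "pt a e W"
  have "H.br (length W) (?xs[length W := ?xs ! length W \<otimes>\<^bsub>A\<^esub> emb y]) = H.br (length W) (?xs[0 := emb y \<otimes>\<^bsub>A\<^esub> ?xs ! 0])"
    using y by (intro H.br_balance[OF pt_tuples[OF a]]) auto
  also have "?xs[0 := emb y \<otimes>\<^bsub>A\<^esub> ?xs ! 0] = pt (y \<otimes> a) e W"
    using a y by (simp add: pt_nth_0 pt_mult_left pt_update_0)
  finally show ?thesis using br_slide[OF a y, of "length W" W e] by simp
qed

lemma br_pt_linear: "linear k K (H.Ch (length W)) (\<lambda>a. H.br (length W) (pt a e W))"
proof (rule linearI[OF H.Ch_module])
  fix a b assume ab: "a \<in> carrier K" "b \<in> carrier K"
  have "emb (a \<oplus> b) \<otimes>\<^bsub>A\<^esub> xp e = emb a \<otimes>\<^bsub>A\<^esub> xp e \<oplus>\<^bsub>A\<^esub> emb b \<otimes>\<^bsub>A\<^esub> xp e"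
    using ab by (simp add: ring_hom_add[OF emb_hom] A.l_distr)
  then show "H.br (length W) (pt (a \<oplus> b) e W) = H.br (length W) (pt a e W) \<oplus>\<^bsub>H.Ch (length W)\<^esub> H.br (length W) (pt b e W)"
    using H.br_add[OF pt_tuples[OF ab(1), of e W], of 0 "emb a \<otimes>\<^bsub>A\<^esub> xp e" "emb b \<otimes>\<^bsub>A\<^esub> xp e"] ab
    by (simp add: pt_def)
next
  fix x a assume xa: "x \<in> carrier k" "a \<in> carrier K"
  have "emb (x \<odot> a) \<otimes>\<^bsub>A\<^esub> xp e = x \<odot>\<^bsub>A\<^esub> (emb a \<otimes>\<^bsub>A\<^esub> xp e)"
    using xa by (simp add: emb_smult H.smult_mult_left)
  then show "H.br (length W) (pt (x \<odot> a) e W) = x \<odot>\<^bsub>H.Ch (length W)\<^esub> H.br (length W) (pt a e W)"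
    using H.br_smult[OF pt_tuples[OF xa(2), of e W], of 0 "emb a \<otimes>\<^bsub>A\<^esub> xp e" x] xa
    by (simp add: pt_def)
qed (simp add: pt_tuples)

lemma Ch_minus_zero [simp]: "\<ominus>\<^bsub>H.Ch r\<^esub> \<zero>\<^bsub>H.Ch r\<^esub> = \<zero>\<^bsub>H.Ch r\<^esub>"
  by (rule H.Ch.minus_equality) simp_all
lemma Ch_diff_self [simp]: "x \<in> carrier (H.Ch r) \<Longrightarrow> x \<ominus>\<^bsub>H.Ch r\<^esub> x = \<zero>\<^bsub>H.Ch r\<^esub>"
  by (simp add: a_minus_def H.Ch.r_neg)
lemma br_pt_closed [simp]: "a \<in> carrier K \<Longrightarrow> length W = r \<Longrightarrow> H.br r (pt a e W) \<in> carrier (H.Ch r)"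
  using pt_tuples H.br_closed by blast

lemma br_TC:
  assumes "a \<in> TC (e + sum_list W)"
  shows "H.br (length W) (pt a e W) = \<zero>\<^bsub>H.Ch (length W)\<^esub>"
proof -
  let ?Z = "{\<zero>\<^bsub>H.Ch (length W)\<^esub>}"
  have "submodule ?Z k (H.Ch (length W))"
    by (rule H.Ch.submoduleI) auto
  then have "H.br (length W) (pt a e W) \<in> ?Z"
  proof (rule TC_linear[OF br_pt_linear _ _ assms])
    fix x b assume "x \<in> carrier K" "b \<in> carrier K"
    then show "H.br (length W) (pt (b \<otimes> (\<alpha> ^^ (e + sum_list W)) x) e W) \<ominus>\<^bsub>H.Ch (length W)\<^esub>
       H.br (length W) (pt (x \<otimes> b) e W) \<in> ?Z"
      by (simp add: br_cyclic pt_tuples)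
  qed
  then show ?thesis by simp
qed

definition phi where
  "phi r = frag_map (H.Ch r) (\<lambda>(a, e, W). if a \<in> carrier K \<and> length W = r then H.br r (pt a e W) else \<zero>\<^bsub>H.Ch r\<^esub>)"

lemma phi_hom: "frag_hom (H.Ch r) (\<lambda>(a, e, W). if a \<in> carrier K \<and> length W = r then H.br r (pt a e W) else \<zero>\<^bsub>H.Ch r\<^esub>)"
  by (intro frag_hom.intro frag_hom_axioms.intro H.Ch.abelian_group_axioms) (auto simp: pt_tuples)

sublocale phi: frag_hom "H.Ch r" "\<lambda>(a, e, W). if a \<in> carrier K \<and> length W = r then H.br r (pt a e W) else \<zero>\<^bsub>H.Ch r\<^esub>" for r
  by (rule phi_hom)

lemma phi_simps:
  "phi r 0 = \<zero>\<^bsub>H.Ch r\<^esub>" "phi r (x + y) = phi r x \<oplus>\<^bsub>H.Ch r\<^esub> phi r y" "phi r (x - y) = phi r x \<ominus>\<^bsub>H.Ch r\<^esub> phi r y"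
  "phi r (- x) = \<ominus>\<^bsub>H.Ch r\<^esub> phi r x" "phi r x \<in> carrier (H.Ch r)"
  "finite S \<Longrightarrow> phi r (sum g S) = (\<Oplus>\<^bsub>H.Ch r\<^esub>i\<in>S. phi r (g i))"
  "phi r (frag_of (a, e, W)) = (if a \<in> carrier K \<and> length W = r then H.br r (pt a e W) else \<zero>\<^bsub>H.Ch r\<^esub>)"
  unfolding phi_def by (simp_all add: phi.add phi.diff phi.minus phi.sum phi.of)

lemma phi_closed [simp, intro]: "phi r x \<in> carrier (H.Ch r)" by (rule phi_simps(5))

lemma phi_place:
  assumes "length W = r" shows "phi r (place e W q) = H.br r (pt (val q) e W)"
proof -
  interpret l: linear k K "H.Ch r" "\<lambda>a. H.br r (pt a e W)"
    using br_pt_linear[of W e] assms by simp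
  show ?thesis
  proof (induction q rule: frag_all_induct)
    case zero
    show ?case using l.zero by (simp add: phi_simps)
  next
    case (of a)
    show ?case using assms l.zero by (simp add: phi_simps)
  next
    case (diff p q)
    then show ?case by (simp add: phi_simps l.diff)
  qed
qed

lemma phi_place_other: "length W \<noteq> r \<Longrightarrow> phi r (place e W q) = \<zero>\<^bsub>H.Ch r\<^esub>"
  by (induction q rule: frag_all_induct) (auto simp: phi_simps)

lemma xp_add_n: "xp (w + n) = emb c \<otimes>\<^bsub>A\<^esub> xp w"
  using A.nat_pow_mult[OF X_closed, of n w] by (simp add: X_pow_n add.commute)

lemma phi_R: "z \<in> cyc.R 0 \<Longrightarrow> phi r z = \<zero>\<^bsub>H.Ch r\<^esub>"
proof (induction z rule: cyc.R.induct)
  case (coef q e W)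
  then have "val q \<in> TC (e + sum_list W)" by (simp add: Q_def)
  then show ?case using br_TC by (cases "length W = r") (auto simp: phi_place phi_place_other)
next
  case (head a e W)
  show ?case
  proof (cases "a \<in> carrier K")
    case True
    have "emb a \<otimes>\<^bsub>A\<^esub> xp (e + n) = emb (a \<otimes> c) \<otimes>\<^bsub>A\<^esub> xp e"
      using True by (simp add: xp_add_n A.m_assoc ring_hom_mult[OF emb_hom])
    then have "pt a (e + n) W = pt (a \<otimes> c) e W" by (simp add: pt_def)
    then show ?thesis using True by (auto simp: phi_simps mc_def)
  next
    case False
    then show ?thesis by (simp add: phi_simps mc_def)
  qed
next
  case (entry a e U w V)
  show ?case
  proof (cases "a \<in> carrier K \<and> length (U @ w # V) = r")
    case True
    then have a: "a \<in> carrier K" and r: "r = length (U @ w # V)" by auto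
    let ?xs = "pt a e (U @ w # V)" and ?j = "length U"
    have j: "?j \<le> length (U @ w # V)" by simp
    have "pt a e (U @ (w + n) # V) = ?xs[Suc ?j := emb c \<otimes>\<^bsub>A\<^esub> ?xs ! Suc ?j]"
      by (simp add: pt_def xp_add_n list_update_append nth_append)
    then have "H.br r (pt a e (U @ (w + n) # V)) = H.br r (?xs[Suc ?j := emb c \<otimes>\<^bsub>A\<^esub> ?xs ! Suc ?j])" by simp
    also have "\<dots> = H.br r (?xs[?j := ?xs ! ?j \<otimes>\<^bsub>A\<^esub> emb c])"
      unfolding r by (intro H.br_balance[OF pt_tuples[OF a], symmetric]) auto
    also have "\<dots> = H.br r (pt (a \<otimes> c) e (U @ w # V))"
      unfolding r br_slide[OF a c_closed j] by simp
    finally show ?thesis using a r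
      by (simp add: phi_simps mc_def)
  next
    case False
    then show ?thesis by (auto simp: phi_simps mc_def)
  qed
next
  case (null a e U V)
  show ?case
  proof (cases "a \<in> carrier K \<and> length (U @ 0 # V) = r")
    case True
    then have a: "a \<in> carrier K" and r: "r = length (U @ 0 # V)" by auto
    have "pt a e (U @ 0 # V) = (pt a e (U @ 0 # V))[Suc (length U) := emb \<one>]"
      by (simp add: pt_def ring_hom_one[OF emb_hom] list_update_append)
    then have "H.br r (pt a e (U @ 0 # V)) = H.br r ((pt a e (U @ 0 # V))[Suc (length U) := emb \<one>])" by simp
    also have "\<dots> = \<zero>\<^bsub>H.Ch r\<^esub>"
      unfolding r by (rule H.br_iota[OF pt_tuples[OF a]]) auto
    finally show ?thesis using a r by (simp add: phi_simps)
  qed (auto simp: phi_simps)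
qed (auto simp: phi_simps)

text \<open>Formal sums carry no action of \<open>k\<close>; scalar multiplication is imitated on the scalars of the
  symbols.\<close>

lemma phi_smult:
  assumes "x \<in> carrier k"
  shows "phi r (map_coef (\<lambda>a. if a \<in> carrier K then x \<odot> a else a) z) = x \<odot>\<^bsub>H.Ch r\<^esub> phi r z"
proof (induction z rule: chain_induct)
  case zero
  show ?case using assms by (simp add: phi_simps)
next
  case (of a e W)
  show ?case
  proof (cases "a \<in> carrier K \<and> length W = r")
    case True
    then interpret l: linear k K "H.Ch r" "\<lambda>a. H.br r (pt a e W)"
      using br_pt_linear[of W e] by simp
    show ?thesis using True assms by (simp add: phi_simps l.smult)
  next
    case False
    then show ?thesis using assms by (auto simp: phi_simps)
  qed
next
  case (diff y z)
  then show ?case using assms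
    by (simp add: phi_simps H.Ch.minus_eq H.Ch.smult_r_distr H.Ch.smult_r_minus)
qed

subsection \<open>Compatibility with the boundaries\<close>

text \<open>The \<open>t\<close>-th face of a symbol; \<open>bdry0_sum\<close> unrolls the recursive boundary into the alternating sum
  of these.\<close>

definition face_symbol where
  "face_symbol t a e W = (if t = 0 then (a, e + hd W, tl W)
     else if t < length W then (a, e, take (t - 1) W @ (W ! (t - 1) + W ! t) # drop (t + 1) W)
     else (tw (last W) a, e + last W, butlast W))"

definition signed :: "nat \<Rightarrow> 'b :: ab_group_add \<Rightarrow> 'b" where "signed t x = (if even t then x else - x)"

lemma inner_faces_sum:
  "W \<noteq> [] \<Longrightarrow> cyc.inner_faces a e W = (\<Sum>t = 1..length W. signed t (frag_of (face_symbol t a e W)))"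
proof (induction a e W rule: cyc.inner_faces.induct)
  case (2 a e w)
  show ?case by (simp add: signed_def face_symbol_def)
next
  case (3 a e w w' W)
  let ?V = "w' # W"
  have "(\<Sum>t = 1..length (w # ?V). signed t (frag_of (face_symbol t a e (w # ?V)))) =
     signed 1 (frag_of (face_symbol 1 a e (w # ?V))) + (\<Sum>t = Suc 1..Suc (length ?V). signed t (frag_of (face_symbol t a e (w # ?V))))"
    by (subst sum.atLeast_Suc_atMost) auto
  also have "signed 1 (frag_of (face_symbol 1 a e (w # ?V))) = - frag_of (a, e, (w + w') # W)"
    by (simp add: signed_def face_symbol_def)
  also have "(\<Sum>t = Suc 1..Suc (length ?V). signed t (frag_of (face_symbol t a e (w # ?V)))) =
     (\<Sum>t = 1..length ?V. signed (Suc t) (frag_of (face_symbol (Suc t) a e (w # ?V))))"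
    by (rule sum.shift_bounds_cl_Suc_ivl)
  also have "\<dots> = (\<Sum>t = 1..length ?V. - insert_pow w (signed t (frag_of (face_symbol t a e ?V))))"
  proof (rule sum.cong[OF refl])
    fix t assume "t \<in> {1..length ?V}"
    then obtain s where t: "t = Suc s" by (cases t) auto
    show "signed (Suc t) (frag_of (face_symbol (Suc t) a e (w # ?V))) = - insert_pow w (signed t (frag_of (face_symbol t a e ?V)))"
      unfolding t by (auto simp: signed_def face_symbol_def)
  qed
  also have "\<dots> = - insert_pow w (cyc.inner_faces a e ?V)"
    using 3 by (simp add: sum_negf)
  finally show ?case by simp
qed simp

lemma bdry0_sum:
  assumes "W \<noteq> []" shows "cyc.bdry0 a e W = (\<Sum>t\<le>length W. signed t (frag_of (face_symbol t a e W)))"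
proof -
  have "(\<Sum>t\<le>length W. signed t (frag_of (face_symbol t a e W))) =
    signed 0 (frag_of (face_symbol 0 a e W)) + (\<Sum>t = 1..length W. signed t (frag_of (face_symbol t a e W)))"
    unfolding atMost_atLeast0 by (subst sum.atLeast_Suc_atMost) auto
  then show ?thesis using assms
    by (cases W) (simp_all add: cyc.bdry0_def inner_faces_sum signed_def face_symbol_def)
qed

lemma face_pt:
  assumes a: "a \<in> carrier K" and W: "W \<noteq> []" and t: "t \<le> length W"
  shows "hoch_face A (length W) t (pt a e W) = (case face_symbol t a e W of (a', e', W') \<Rightarrow> pt a' e' W')"
proof -
  consider (0) "t = 0" | (mid) s where "t = Suc s" "t < length W" | (last) "t = length W"
    using t by (cases t) fastforce+
  then show ?thesis
  proof cases
    case 0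
    then show ?thesis using W a
      by (cases W) (simp_all add: hoch_face_def pt_def face_symbol_def A.m_assoc A.nat_pow_mult)
  next
    case mid
    have "xp (W ! s) \<otimes>\<^bsub>A\<^esub> xp (W ! Suc s) = xp (W ! s + W ! Suc s)"
      by (simp add: A.nat_pow_mult)
    then show ?thesis using mid
      by (simp add: hoch_face_def pt_def face_symbol_def take_map drop_map)
  next
    case last
    have lw: "last (map xp W) = xp (last W)" using W by (simp add: last_map)
    have "xp (last W) \<otimes>\<^bsub>A\<^esub> (emb a \<otimes>\<^bsub>A\<^esub> xp e) = emb ((\<alpha> ^^ last W) a) \<otimes>\<^bsub>A\<^esub> xp (e + last W)"
      using a by (simp add: A.m_assoc[symmetric] X_pow_emb) (simp add: A.m_assoc A.nat_pow_mult add.commute)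
    then show ?thesis using last W a lw
      by (simp add: hoch_face_def pt_def face_symbol_def tw_def map_butlast)
  qed
qed

lemma phi_D_of:
  assumes a: "a \<in> carrier K" and W: "length W = Suc r"
  shows "phi r (cyc.bdry0 a e W) = H.bdry_class (Suc r) (pt a e W)"
proof -
  have ne: "W \<noteq> []" using W by auto
  have tup: "pt a e W \<in> tuples A (Suc r)" using pt_tuples[OF a, of e W] W by simp
  have "phi r (cyc.bdry0 a e W) = (\<Oplus>\<^bsub>H.Ch r\<^esub>t\<in>{..Suc r}. phi r (signed t (frag_of (face_symbol t a e W))))"
    unfolding bdry0_sum[OF ne] W by (simp only: phi_simps(6) finite_atMost)
  also have "\<dots> = (\<Oplus>\<^bsub>H.Ch r\<^esub>t\<in>{..Suc r}. H.sg t \<odot>\<^bsub>H.Ch r\<^esub> H.br r (hoch_face A (Suc r) t (pt a e W)))"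
  proof (rule H.Ch.finsum_cong')
    show "(\<lambda>t. H.sg t \<odot>\<^bsub>H.Ch r\<^esub> H.br r (hoch_face A (Suc r) t (pt a e W))) \<in> {..Suc r} \<rightarrow> carrier (H.Ch r)"
      using H.term_closed[OF tup] by auto
    fix t assume "t \<in> {..Suc r}"
    then have t: "t \<le> length W" using W by simp
    obtain a' e' W' where f: "face_symbol t a e W = (a', e', W')" by (metis prod_cases3)
    have a': "a' \<in> carrier K" using f a by (auto simp: face_symbol_def tw_def split: if_splits)
    have W': "length W' = r" using f W t by (auto simp: face_symbol_def split: if_splits)
    have "H.br r (hoch_face A (Suc r) t (pt a e W)) = phi r (frag_of (face_symbol t a e W))"
      using face_pt[OF a ne t, of e] a' W' W f by (simp add: phi_simps)
    moreover have "H.sg t \<odot>\<^bsub>H.Ch r\<^esub> v = (if even t then v else \<ominus>\<^bsub>H.Ch r\<^esub> v)" if "v \<in> carrier (H.Ch r)" for v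
      using that by (induction t) (auto simp: H.sg_Suc)
    ultimately show "phi r (signed t (frag_of (face_symbol t a e W))) = H.sg t \<odot>\<^bsub>H.Ch r\<^esub> H.br r (hoch_face A (Suc r) t (pt a e W))"
      by (simp add: signed_def phi_simps)
  qed simp
  also have "\<dots> = H.bdry_class (Suc r) (pt a e W)" by (simp add: H.bdry_class_def)
  finally show ?thesis .
qed

lemma phi_D:
  assumes "z \<in> cyc.len (Suc r)"
  shows "phi r (cyc.D z) = H.bd (Suc r) (phi (Suc r) z)"
proof -
  interpret D: Modules.additive cyc.D unfolding cyc.D_def by (rule additive_frag_extend)
  interpret b: linear k "H.Ch (Suc r)" "H.Ch r" "H.bd (Suc r)"
    using H.bd_linear[of "Suc r"] by simp
  show ?thesis using assms
  proof (induction z rule: cyc.len_induct)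
    case zero
    then show ?case using b.zero by (simp add: D.zero phi_simps)
  next
    case (of a e W)
    show ?case
    proof (cases "a \<in> carrier K")
      case True
      then show ?thesis using of phi_D_of[OF True of] pt_tuples[OF True, of e W]
        by (simp add: phi_simps H.bd_br)
    next
      case False
      have 0: "phi r (frag_of (face_symbol t a e W)) = \<zero>\<^bsub>H.Ch r\<^esub>" for t
      proof -
        obtain a' e' W' where f: "face_symbol t a e W = (a', e', W')" by (metis prod_cases3)
        then have "a' \<notin> carrier K" using False by (auto simp: face_symbol_def tw_def split: if_splits)
        then show ?thesis by (simp add: f phi_simps)
      qed
      have ne: "W \<noteq> []" using of by auto
      have "phi r (cyc.bdry0 a e W) = (\<Oplus>\<^bsub>H.Ch r\<^esub>t\<in>{..length W}. phi r (signed t (frag_of (face_symbol t a e W))))"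
        by (simp add: bdry0_sum[OF ne] phi_simps)
      also have "\<dots> = (\<Oplus>\<^bsub>H.Ch r\<^esub>t\<in>{..length W}. \<zero>\<^bsub>H.Ch r\<^esub>)"
        by (intro H.Ch.finsum_cong') (auto simp: signed_def phi_simps 0)
      finally show ?thesis using False b.zero by (simp add: phi_simps)
    qed
  next
    case (diff x y)
    then show ?case by (simp add: D.diff phi_simps b.diff)
  qed
qed

text \<open>Coefficients are removed from the factors from right to left: once all factors behind position
  \<open>j\<close> are powers of \<open>x\<close>, the factor in position \<open>j\<close> is expanded into monomials and their coefficients
  are passed on to position \<open>j - 1\<close>.\<close>

lemma phi_surj:
  assumes "Y \<in> carrier (H.Ch r)" shows "\<exists>z\<in>cyc.len r. phi r z = Y"
proof -
  define Im where "Im Y \<longleftrightarrow> (\<exists>z\<in>cyc.len r. phi r z = Y)" for Y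
  have Im_add: "Im (x \<oplus>\<^bsub>H.Ch r\<^esub> y)" if xy: "Im x" "Im y" for x y
  proof -
    obtain z w where "z \<in> cyc.len r" "phi r z = x" "w \<in> cyc.len r" "phi r w = y"
      using xy unfolding Im_def by blast
    then show ?thesis unfolding Im_def by (intro bexI[of _ "z + w"] cyc.len_add) (simp_all add: phi_simps)
  qed
  have Im_smult: "Im (x \<odot>\<^bsub>H.Ch r\<^esub> y)" if x: "x \<in> carrier k" and y: "Im y" for x y
  proof -
    obtain z where z: "z \<in> cyc.len r" "phi r z = y" using y by (auto simp: Im_def)
    have "map_coef g z \<in> cyc.len r" for g
      using z(1) by (induction z rule: cyc.len_induct) (auto intro: cyc.len_diff)
    then show ?thesis unfolding Im_def using phi_smult[OF x, of r z] z(2)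
      by (intro bexI[of _ "map_coef (\<lambda>a. if a \<in> carrier K then x \<odot> a else a) z"]) simp_all
  qed
  have entry: "Im (H.br r xs)"
    if xs: "xs \<in> tuples A r" and j: "j \<le> r" and pw: "\<And>i. j < i \<Longrightarrow> i \<le> r \<Longrightarrow> xs ! i \<in> range xp" for xs j
    using that
  proof (induction j arbitrary: xs)
    case 0
    have "Im (H.br r (xs[0 := Y]))" if Y: "Y \<in> carrier A" for Y
      using Y
    proof (induction Y rule: A_induct)
      case (mono a m)
      define W where "W = map (\<lambda>i. SOME w. xs ! Suc i = xp w) [0..<r]"
      have W: "xs ! Suc i = xp (W ! i)" if i: "i < r" for i
      proof -
        have "\<exists>w. xs ! Suc i = xp w" using 0(3)[of "Suc i"] i by auto
        from someI_ex[OF this] show ?thesis using i by (simp add: W_def)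
      qed
      have lW: "length W = r" by (simp add: W_def)
      have "xs[0 := emb a \<otimes>\<^bsub>A\<^esub> xp m] = pt a m W"
      proof (rule nth_equalityI)
        show "length (xs[0 := emb a \<otimes>\<^bsub>A\<^esub> xp m]) = length (pt a m W)"
          using H.tuples_length[OF 0(1)] lW by simp
        fix i assume "i < length (xs[0 := emb a \<otimes>\<^bsub>A\<^esub> xp m])"
        then have "i \<le> r" using H.tuples_length[OF 0(1)] by simp
        then show "xs[0 := emb a \<otimes>\<^bsub>A\<^esub> xp m] ! i = pt a m W ! i"
          using H.tuples_length[OF 0(1)] W lW
          by (cases i) (simp_all add: pt_nth_0 pt_nth_Suc)
      qed
      then have "H.br r (xs[0 := emb a \<otimes>\<^bsub>A\<^esub> xp m]) = phi r (frag_of (a, m, W))"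
        using mono lW by (simp add: phi_simps)
      then show ?case unfolding Im_def using lW by (intro bexI[of _ "frag_of (a, m, W)"]) simp_all
    next
      case (add x y)
      then show ?case using H.br_add[OF 0(1)] Im_add by simp
    qed
    from this[of "xs ! 0"] H.tuples_nth[OF 0(1), of 0] show ?case by simp
  next
    case (Suc j)
    have "Im (H.br r (xs[Suc j := Y]))" if Y: "Y \<in> carrier A" for Y
      using Y
    proof (induction Y rule: A_induct)
      case (mono a m)
      let ?xs = "xs[Suc j := xp m]"
      have t: "?xs \<in> tuples A r" using Suc.prems(1) by (intro H.tuples_update) auto
      have "xs[Suc j := emb a \<otimes>\<^bsub>A\<^esub> xp m] = ?xs[Suc j := emb a \<otimes>\<^bsub>A\<^esub> ?xs ! Suc j]"
        using Suc.prems H.tuples_length[OF Suc.prems(1)] by simp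
      then have "H.br r (xs[Suc j := emb a \<otimes>\<^bsub>A\<^esub> xp m]) = H.br r (?xs[Suc j := emb a \<otimes>\<^bsub>A\<^esub> ?xs ! Suc j])" by simp
      also have "\<dots> = H.br r (?xs[j := ?xs ! j \<otimes>\<^bsub>A\<^esub> emb a])"
        using Suc.prems(2) mono by (intro H.br_balance[OF t, symmetric]) auto
      also have "Im \<dots>"
      proof (rule Suc.IH)
        show "?xs[j := ?xs ! j \<otimes>\<^bsub>A\<^esub> emb a] \<in> tuples A r"
          using mono Suc.prems(2) H.tuples_nth[OF t, of j] by (intro H.tuples_update[OF t]) auto
        fix i assume "j < i" "i \<le> r"
        then show "?xs[j := ?xs ! j \<otimes>\<^bsub>A\<^esub> emb a] ! i \<in> range xp"
          using Suc.prems(3)[of i] H.tuples_length[OF Suc.prems(1)]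
          by (cases "i = Suc j") (auto simp: nth_list_update)
      qed (use Suc.prems in auto)
      finally show ?case .
    next
      case (add x y)
      then show ?case using H.br_add[OF Suc.prems(1,2)] Im_add by simp
    qed
    from this[of "xs ! Suc j"] H.tuples_nth[OF Suc.prems(1,2)] show ?case by simp
  qed
  have "Im Y" using assms
  proof (induction Y rule: H.Ch_induct)
    case (br xs)
    show ?case by (rule entry[OF br order_refl]) auto
  next
    case (add x y)
    then show ?case by (intro Im_add)
  next
    case (smult x y)
    then show ?case by (intro Im_smult)
  qed
  then show ?thesis by (simp add: Im_def)
qed

end


section \<open>Coordinates of Hochschild chains\<close>

context monogenic
begin

text \<open>The coordinate of \<open>a\<^sub>0 \<otimes> \<dots> \<otimes> a\<^sub>r\<close> at \<open>x\<^bsup>w\<^sub>0\<^esup> \<otimes> \<dots> \<otimes> x\<^bsup>w\<^sub>r\<^esup>\<close>: the \<open>w\<^sub>i\<close>-th coefficient of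
  each \<open>a\<^sub>i\<close>, collected at the front.\<close>

fun coef_prod :: "nat list \<Rightarrow> (nat \<Rightarrow> 'a) set list \<Rightarrow> 'a" where
  "coef_prod (w # ws) (x # xs) = coef w x \<otimes> (\<alpha> ^^ w) (coef_prod ws xs)"
| "coef_prod _ _ = \<one>"

definition admissible where "admissible ws xs \<longleftrightarrow> length xs = length ws \<and> set ws \<subseteq> {..<n} \<and> set xs \<subseteq> carrier A"

lemma admissible_Cons: "admissible (w # ws) xs \<longleftrightarrow> (\<exists>y ys. xs = y # ys \<and> w < n \<and> y \<in> carrier A \<and> admissible ws ys)"
  by (cases xs) (auto simp: admissible_def)
lemma admissible_Nil [simp]: "admissible [] xs \<longleftrightarrow> xs = []" by (auto simp: admissible_def)

lemma coef_prod_closed [simp]: "admissible ws xs \<Longrightarrow> coef_prod ws xs \<in> carrier K"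
  by (induction ws arbitrary: xs) (auto simp: admissible_Cons)

text \<open>Like a face, a coordinate depends on each factor through a two-sided multiplication, here after a
  twist; this yields its linearity.\<close>

lemma coef_prod_update:
  "admissible ws xs \<Longrightarrow> i < length ws \<Longrightarrow>
   \<exists>p\<in>carrier K. \<exists>q\<in>carrier K. \<exists>s. \<forall>Y\<in>carrier A. coef_prod ws (xs[i := Y]) = p \<otimes> (\<alpha> ^^ s) (coef (ws ! i) Y) \<otimes> q"
proof (induction ws arbitrary: xs i)
  case (Cons w ws)
  then obtain y ys where xs: "xs = y # ys" "w < n" "y \<in> carrier A" "admissible ws ys" by (auto simp: admissible_Cons)
  show ?case
  proof (cases i)
    case 0
    have "\<forall>Y\<in>carrier A. coef_prod (w # ws) (xs[i := Y]) = \<one> \<otimes> (\<alpha> ^^ 0) (coef ((w # ws) ! i) Y) \<otimes> (\<alpha> ^^ w) (coef_prod ws ys)"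
      using 0 xs by simp
    then show ?thesis using xs(4) by (metis M.one_closed coef_prod_closed pow_closed)
  next
    case (Suc i')
    then obtain p q s where pqs: "p \<in> carrier K" "q \<in> carrier K"
      "\<And>Y. Y \<in> carrier A \<Longrightarrow> coef_prod ws (ys[i' := Y]) = p \<otimes> (\<alpha> ^^ s) (coef (ws ! i') Y) \<otimes> q"
      using Cons.IH[OF xs(4), of i'] Cons.prems by auto
    have wi: "ws ! i' < n" using Cons.prems Suc xs(4) by (auto simp: admissible_def dest!: subsetD[OF _ nth_mem])
    have "\<forall>Y\<in>carrier A. coef_prod (w # ws) (xs[i := Y]) =
      (coef w y \<otimes> (\<alpha> ^^ w) p) \<otimes> (\<alpha> ^^ (w + s)) (coef ((w # ws) ! i) Y) \<otimes> (\<alpha> ^^ w) q"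
      using xs Suc pqs wi by (simp add: pow_mult funpow_add M.m_assoc)
    moreover have "coef w y \<otimes> (\<alpha> ^^ w) p \<in> carrier K" "(\<alpha> ^^ w) q \<in> carrier K" using xs pqs by auto
    ultimately show ?thesis by blast
  qed
qed simp

lemma coef_prod_balance:
  "admissible ws xs \<Longrightarrow> Suc i < length ws \<Longrightarrow> y \<in> carrier K \<Longrightarrow>
   coef_prod ws (xs[i := xs ! i \<otimes>\<^bsub>A\<^esub> emb y]) = coef_prod ws (xs[Suc i := emb y \<otimes>\<^bsub>A\<^esub> xs ! Suc i])"
proof (induction ws arbitrary: xs i)
  case (Cons w ws)
  then obtain x ys where xs: "xs = x # ys" "w < n" "x \<in> carrier A" "admissible ws ys" by (auto simp: admissible_Cons)
  show ?case
  proof (cases i)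
    case 0
    then obtain w' ws' where ws: "ws = w' # ws'" using Cons.prems by (cases ws) auto
    then obtain x' zs where ys: "ys = x' # zs" "w' < n" "x' \<in> carrier A" "admissible ws' zs" using xs by (auto simp: admissible_Cons)
    show ?thesis using 0 xs ws ys Cons.prems(3)
      by (simp add: coef_mult_emb coef_emb_mult pow_mult M.m_assoc)
  next
    case (Suc i')
    then show ?thesis using xs Cons.IH[OF xs(4), of i'] Cons.prems by simp
  qed
qed simp

text \<open>A scalar at the right end comes out twisted by the whole weight; with \<open>coef_prod_first\<close> this shows
  that the cyclic relation changes the coordinate by a twisted commutator.\<close>

lemma coef_prod_last:
  "admissible ws xs \<Longrightarrow> ws \<noteq> [] \<Longrightarrow> y \<in> carrier K \<Longrightarrow>
   coef_prod ws (xs[length ws - 1 := xs ! (length ws - 1) \<otimes>\<^bsub>A\<^esub> emb y]) = coef_prod ws xs \<otimes> (\<alpha> ^^ sum_list ws) y"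
proof (induction ws arbitrary: xs)
  case (Cons w ws)
  then obtain x ys where xs: "xs = x # ys" "w < n" "x \<in> carrier A" "admissible ws ys" by (auto simp: admissible_Cons)
  show ?case
  proof (cases ws)
    case Nil
    then show ?thesis using xs Cons.prems by (simp add: coef_mult_emb)
  next
    case (Cons w' ws')
    then have "length ws = Suc (length ws - 1)" by simp
    then have "xs[length (w # ws) - 1 := xs ! (length (w # ws) - 1) \<otimes>\<^bsub>A\<^esub> emb y] =
       x # ys[length ws - 1 := ys ! (length ws - 1) \<otimes>\<^bsub>A\<^esub> emb y]"
      unfolding xs(1) by (metis diff_Suc_1 length_Cons list_update_code(3) nth_Cons_Suc)
    then show ?thesis using Cons.IH[OF xs(4)] xs Cons.prems Cons
      by (simp add: pow_mult funpow_add M.m_assoc)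
  qed
qed simp

lemma coef_prod_first:
  "admissible ws xs \<Longrightarrow> ws \<noteq> [] \<Longrightarrow> y \<in> carrier K \<Longrightarrow> coef_prod ws (xs[0 := emb y \<otimes>\<^bsub>A\<^esub> xs ! 0]) = y \<otimes> coef_prod ws xs"
  by (cases ws) (auto simp: admissible_Cons coef_emb_mult M.m_assoc)

lemma coef_prod_cong:
  "admissible ws xs \<Longrightarrow> admissible ws ys \<Longrightarrow> (\<And>i. i < length ws \<Longrightarrow> coef (ws ! i) (xs ! i) = coef (ws ! i) (ys ! i)) \<Longrightarrow> coef_prod ws xs = coef_prod ws ys"
proof (induction ws arbitrary: xs ys)
  case (Cons w ws)
  then obtain x xs' y ys' where eq: "xs = x # xs'" "ys = y # ys'" "admissible ws xs'" "admissible ws ys'" by (auto simp: admissible_Cons)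
  have "coef_prod ws xs' = coef_prod ws ys'"
  proof (rule Cons.IH[OF eq(3,4)])
    fix i assume "i < length ws"
    then show "coef (ws ! i) (xs' ! i) = coef (ws ! i) (ys' ! i)" using Cons.prems(3)[of "Suc i"] eq by simp
  qed
  then show ?case using Cons.prems(3)[of 0] eq by simp
qed simp

text \<open>Coefficients of positive index do not see elements of \<open>K\<close>; this makes coordinates well defined on
  \<open>A/K\<close>.\<close>

lemma coef_coset:
  assumes "x \<in> carrier A" "y \<in> carrier A" "(emb ` carrier K) +>\<^bsub>A\<^esub> x = (emb ` carrier K) +>\<^bsub>A\<^esub> y" "1 \<le> w" "w < n"
  shows "coef w x = coef w y"
proof -
  have "x \<in> (emb ` carrier K) +>\<^bsub>A\<^esub> y" using H.iK.a_rcos_self[OF assms(1)] assms(3) by simp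
  then obtain z where z: "z \<in> carrier K" "x = emb z \<oplus>\<^bsub>A\<^esub> y" by (auto simp: a_r_coset_def')
  then show ?thesis using assms by (simp add: coef_add coef_emb)
qed

lemma admissible_tuples: "(e0, W) \<in> cyc.reduced_symbols r \<Longrightarrow> xs \<in> tuples A r \<Longrightarrow> admissible (e0 # W) xs"
  by (auto simp: cyc.reduced_symbols_def admissible_def tuples_def)

lemma coef_prod_reduce:
  assumes W: "(e0, W) \<in> cyc.reduced_symbols r" and xs: "xs \<in> tuples A r" and ys: "ys \<in> tuples A r"
    and red: "reduce K A emb xs = reduce K A emb ys"
  shows "coef_prod (e0 # W) xs = coef_prod (e0 # W) ys"
proof (rule coef_prod_cong[OF admissible_tuples[OF W xs] admissible_tuples[OF W ys]])
  fix i assume i: "i < length (e0 # W)"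
  show "coef ((e0 # W) ! i) (xs ! i) = coef ((e0 # W) ! i) (ys ! i)"
  proof (cases i)
    case 0
    then show ?thesis using H.reduceD(1)[OF xs ys red] by simp
  next
    case (Suc j)
    have "length W = r" using W by (simp add: cyc.reduced_symbols_def)
    then have ir: "1 \<le> i" "i \<le> r" using i Suc by auto
    have "W ! j \<in> set W" using i Suc by simp
    then have "1 \<le> W ! j" "W ! j < n" using W by (auto simp: cyc.reduced_symbols_def)
    then show ?thesis using Suc coef_coset[OF H.tuples_nth[OF xs ir(2)] H.tuples_nth[OF ys ir(2)] H.reduceD(2)[OF xs ys red ir]]
      by simp
  qed
qed

text \<open>The coordinate at \<open>x\<^bsup>e\<^sub>0\<^esup> \<otimes> x\<^bsup>w\<^sub>1\<^esup> \<otimes> \<dots>\<close> as a linear map on the free module.\<close>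

definition coord_map where
  "coord_map e0 W r = R.lin_ext K (\<lambda>g. coef_prod (e0 # W) (H.rep r g))"

lemma coord_map_fun: "(e0, W) \<in> cyc.reduced_symbols r \<Longrightarrow> (\<lambda>g. coef_prod (e0 # W) (H.rep r g)) \<in> reduce K A emb ` tuples A r \<rightarrow> carrier K"
  using H.rep admissible_tuples coef_prod_closed by (auto simp del: coef_prod.simps)

lemma coord_map_linear: "(e0, W) \<in> cyc.reduced_symbols r \<Longrightarrow> linear k (H.Fr r) K (coord_map e0 W r)"
  unfolding coord_map_def by (intro linear.intro linear_axioms.intro H.Fr_module K_module R.lin_ext_linear coord_map_fun)

lemma coord_map_tn:
  assumes "(e0, W) \<in> cyc.reduced_symbols r" "xs \<in> tuples A r" shows "coord_map e0 W r (H.tn xs) = coef_prod (e0 # W) xs"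
proof -
  have "coord_map e0 W r (H.tn xs) = coef_prod (e0 # W) (H.rep r (reduce K A emb xs))"
    unfolding coord_map_def using assms by (intro R.lin_ext_gen[OF K_module coord_map_fun]) auto
  also have "\<dots> = coef_prod (e0 # W) xs" using H.rep[OF assms(2)] assms by (intro coef_prod_reduce) auto
  finally show ?thesis .
qed

lemma coord_map_Nul:
  assumes W: "(e0, W) \<in> cyc.reduced_symbols r" and v: "v \<in> H.Nul r" shows "coord_map e0 W r v \<in> TC (e0 + sum_list W)"
proof -
  interpret e: linear k "H.Fr r" K "coord_map e0 W r" by (rule coord_map_linear[OF W])
  let ?T = "e0 + sum_list W"
  let ?S = "{x \<in> carrier (H.Fr r). coord_map e0 W r x \<in> TC ?T}"
  have len: "length W = r" using W by (simp add: cyc.reduced_symbols_def)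
  have "hoch_rels k K A emb r \<subseteq> ?S"
  proof
    fix x assume x: "x \<in> hoch_rels k K A emb r"
    then have xc: "x \<in> carrier (H.Fr r)" using H.rels_closed by blast
    have "coord_map e0 W r x \<in> TC ?T" using x
    proof (cases rule: H.rels_cases)
      case (add xs i a b)
      have t: "xs[i := z] \<in> tuples A r" if "z \<in> carrier A" for z using H.tuples_update[OF add(1) that] .
      obtain p q s where pqs: "p \<in> carrier K" "q \<in> carrier K"
        "\<And>Y. Y \<in> carrier A \<Longrightarrow> coef_prod (e0 # W) (xs[i := Y]) = p \<otimes> (\<alpha> ^^ s) (coef ((e0 # W) ! i) Y) \<otimes> q"
        using coef_prod_update[OF admissible_tuples[OF W add(1)], of i] add(2) len by (auto simp del: coef_prod.simps)
      have wi: "(e0 # W) ! i < n"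
        using admissible_tuples[OF W add(1)] nth_mem[of i "e0 # W"] add(2) len by (auto simp: admissible_def)
      note tc = H.tn_closed[OF t]
      have "coord_map e0 W r x = coef_prod (e0 # W) (xs[i := a \<oplus>\<^bsub>A\<^esub> b]) \<ominus> (coef_prod (e0 # W) (xs[i := a]) \<oplus> coef_prod (e0 # W) (xs[i := b]))"
        using add(3,4) t tc unfolding add(5) by (simp add: e.diff e.add coord_map_tn[OF W] del: coef_prod.simps)
      also have "\<dots> = \<zero>" using add(3,4) pqs wi
        by (simp add: coef_add pow_add M.l_distr M.r_distr a_minus_def M.r_neg del: coef_prod.simps)
      finally have "coord_map e0 W r x = \<zero>" .
      then show ?thesis by (simp add: TC_zero)
    next
      case (smult xs i a y)
      have t: "xs[i := z] \<in> tuples A r" if "z \<in> carrier A" for z using H.tuples_update[OF smult(1) that] .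
      obtain p q s where pqs: "p \<in> carrier K" "q \<in> carrier K"
        "\<And>Y. Y \<in> carrier A \<Longrightarrow> coef_prod (e0 # W) (xs[i := Y]) = p \<otimes> (\<alpha> ^^ s) (coef ((e0 # W) ! i) Y) \<otimes> q"
        using coef_prod_update[OF admissible_tuples[OF W smult(1)], of i] smult(2) len by (auto simp del: coef_prod.simps)
      have wi: "(e0 # W) ! i < n"
        using admissible_tuples[OF W smult(1)] nth_mem[of i "e0 # W"] smult(2) len by (auto simp: admissible_def)
      note tc = H.tn_closed[OF t]
      have "coord_map e0 W r x = coef_prod (e0 # W) (xs[i := y \<odot>\<^bsub>A\<^esub> a]) \<ominus> y \<odot> coef_prod (e0 # W) (xs[i := a])"
        using smult(3,4) t tc unfolding smult(5) by (simp add: e.diff e.smult coord_map_tn[OF W] del: coef_prod.simps)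
      also have "\<dots> = \<zero>" using smult(3,4) pqs wi
        by (simp add: coef_smult pow_smult smult_mult_left smult_mult_right a_minus_def M.r_neg del: coef_prod.simps)
      finally have "coord_map e0 W r x = \<zero>" .
      then show ?thesis by (simp add: TC_zero)
    next
      case (balance xs i j y)
      have j: "j \<le> r" using balance(3) by (simp add: less_Suc_eq_le[symmetric])
      have t: "xs[i := xs ! i \<otimes>\<^bsub>A\<^esub> emb y] \<in> tuples A r" "xs[j := emb y \<otimes>\<^bsub>A\<^esub> xs ! j] \<in> tuples A r"
        using balance j by (auto intro!: H.tuples_update A.m_closed H.tuples_nth)
      have admissible: "admissible (e0 # W) xs" by (rule admissible_tuples[OF W balance(1)])
      have cc: "coef_prod (e0 # W) xs \<in> carrier K" using admissible by (rule coef_prod_closed)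
      have coord_map: "coord_map e0 W r x = coef_prod (e0 # W) (xs[i := xs ! i \<otimes>\<^bsub>A\<^esub> emb y]) \<ominus> coef_prod (e0 # W) (xs[j := emb y \<otimes>\<^bsub>A\<^esub> xs ! j])"
        unfolding balance(5) using t by (simp add: e.diff H.tn_closed coord_map_tn[OF W] del: coef_prod.simps)
      show ?thesis
      proof (cases "i = r")
        case True
        have 1: "coef_prod (e0 # W) (xs[i := xs ! i \<otimes>\<^bsub>A\<^esub> emb y]) = coef_prod (e0 # W) xs \<otimes> (\<alpha> ^^ ?T) y"
          using coef_prod_last[OF admissible _ balance(4)] True len by (simp del: coef_prod.simps)
        have 2: "coef_prod (e0 # W) (xs[j := emb y \<otimes>\<^bsub>A\<^esub> xs ! j]) = y \<otimes> coef_prod (e0 # W) xs"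
          using coef_prod_first[OF admissible _ balance(4)] True balance(3) by (simp del: coef_prod.simps)
        show ?thesis unfolding coord_map 1 2 using cc balance(4) by (intro TC_gen)
      next
        case False
        then have "j = Suc i" "Suc i < length (e0 # W)" using balance(2,3) len by auto
        then have "coef_prod (e0 # W) (xs[i := xs ! i \<otimes>\<^bsub>A\<^esub> emb y]) = coef_prod (e0 # W) (xs[j := emb y \<otimes>\<^bsub>A\<^esub> xs ! j])"
          using coef_prod_balance[OF admissible _ balance(4), of i] by (simp del: coef_prod.simps)
        moreover have "coef_prod (e0 # W) (xs[j := emb y \<otimes>\<^bsub>A\<^esub> xs ! j]) \<in> carrier K"
          by (rule coef_prod_closed[OF admissible_tuples[OF W t(2)]])
        ultimately show ?thesis unfolding coord_map by (simp add: a_minus_def M.r_neg TC_zero del: coef_prod.simps)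
      qed
    qed
    then show "x \<in> ?S" using xc by simp
  qed
  moreover have "submodule ?S k (H.Fr r)" by (rule e.vimage_submodule[OF TC_submodule])
  ultimately have "H.Nul r \<subseteq> ?S" unfolding hoch_null_def by (intro span_mod_least)
  then show ?thesis using v by blast
qed

lemma mc_pow: "a \<in> carrier K \<Longrightarrow> (mc ^^ j) a = a \<otimes> c [^] j"
  by (induction j) (auto simp: mc_def M.m_assoc)
lemma mc_pow_other: "a \<notin> carrier K \<Longrightarrow> (mc ^^ j) a = a"
  by (induction j) (auto simp: mc_def)

lemma coef_prod_powers:
  assumes "set ws \<subseteq> {..<n}" "length W = length ws"
  shows "coef_prod ws (map xp W) = (if map (\<lambda>w. w mod n) W = ws then c [^] (\<Sum>w\<leftarrow>W. w div n) else \<zero>)"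
  using assms
proof (induction ws arbitrary: W)
  case (Cons w ws)
  then obtain v V where W: "W = v # V" "length V = length ws" by (auto simp: length_Suc_conv)
  then show ?case using Cons.IH[of V] Cons.prems
    by (auto simp: coef_X_pow M.nat_pow_mult)
qed simp

lemma coef_prod_pt:
  assumes W0: "(e0, W0) \<in> cyc.reduced_symbols r" and a: "a \<in> carrier K" and W: "length W = r"
  shows "coef_prod (e0 # W0) (pt a e W) = val (cyc.coord e0 W0 (frag_of (a, e, W)))"
proof -
  have e0: "e0 < n" "set W0 \<subseteq> {..<n}" "length W = length W0" using W0 W by (auto simp: cyc.reduced_symbols_def)
  have "coef_prod (e0 # W0) (pt a e W) = coef e0 (emb a \<otimes>\<^bsub>A\<^esub> xp e) \<otimes> (\<alpha> ^^ e0) (coef_prod W0 (map xp W))"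
    by (simp add: pt_def)
  also have "\<dots> = (if e mod n = e0 \<and> map (\<lambda>w. w mod n) W = W0
      then a \<otimes> c [^] (e div n + (\<Sum>w\<leftarrow>W. w div n)) else \<zero>)"
    using e0 a by (auto simp: coef_mono coef_prod_powers M.m_assoc M.nat_pow_mult)
  also have "\<dots> = val (cyc.coord e0 W0 (frag_of (a, e, W)))"
    using a by (simp add: cyc.coord_of mc_pow)
  finally show ?thesis .
qed

text \<open>A lift of \<open>phi r z\<close> to the free module has, as Hochschild chain, the coordinates of \<open>z\<close>.\<close>

lemma phi_lift:
  assumes "z \<in> cyc.len r"
  shows "\<exists>v\<in>carrier (H.Fr r). phi r z = H.Nr.cl r v \<and>
    (\<forall>e0 W0. (e0, W0) \<in> cyc.reduced_symbols r \<longrightarrow> coord_map e0 W0 r v = val (cyc.coord e0 W0 z))"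
  using assms
proof (induction z rule: cyc.len_induct)
  case zero
  have "coord_map e0 W0 r \<zero>\<^bsub>H.Fr r\<^esub> = \<zero>" if W: "(e0, W0) \<in> cyc.reduced_symbols r" for e0 W0
  proof -
    interpret e: linear k "H.Fr r" K "coord_map e0 W0 r" by (rule coord_map_linear[OF W])
    show ?thesis by (rule e.zero)
  qed
  then show ?case
    by (intro bexI[of _ "\<zero>\<^bsub>H.Fr r\<^esub>"]) (auto simp: phi_simps cyc.coord_def)
next
  case (of a e W)
  show ?case
  proof (cases "a \<in> carrier K")
    case True
    have t: "pt a e W \<in> tuples A r" using pt_tuples[OF True, of e W] of by simp
    then show ?thesis using True of
      by (intro bexI[of _ "H.tn (pt a e W)"]) (auto simp: phi_simps coord_map_tn coef_prod_pt H.tn_closed simp del: coef_prod.simps)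
  next
    case False
    have "coord_map e0 W0 r \<zero>\<^bsub>H.Fr r\<^esub> = \<zero>" if W: "(e0, W0) \<in> cyc.reduced_symbols r" for e0 W0
    proof -
      interpret e: linear k "H.Fr r" K "coord_map e0 W0 r" by (rule coord_map_linear[OF W])
      show ?thesis by (rule e.zero)
    qed
    then show ?thesis using False
      by (intro bexI[of _ "\<zero>\<^bsub>H.Fr r\<^esub>"]) (auto simp: phi_simps cyc.coord_of mc_pow_other)
  qed
next
  case (diff x y)
  then obtain u' v where u: "u' \<in> carrier (H.Fr r)" "phi r x = H.Nr.cl r u'"
      "\<And>e0 W0. (e0, W0) \<in> cyc.reduced_symbols r \<Longrightarrow> coord_map e0 W0 r u' = val (cyc.coord e0 W0 x)"
    and v: "v \<in> carrier (H.Fr r)" "phi r y = H.Nr.cl r v"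
      "\<And>e0 W0. (e0, W0) \<in> cyc.reduced_symbols r \<Longrightarrow> coord_map e0 W0 r v = val (cyc.coord e0 W0 y)" by auto
  have "coord_map e0 W0 r (u' \<ominus>\<^bsub>H.Fr r\<^esub> v) = val (cyc.coord e0 W0 (x - y))" if W: "(e0, W0) \<in> cyc.reduced_symbols r" for e0 W0
  proof -
    interpret e: linear k "H.Fr r" K "coord_map e0 W0 r" by (rule coord_map_linear[OF W])
    show ?thesis using u v W by (simp add: e.diff cyc.coord_def frag_extend_diff)
  qed
  then show ?case using u v
    by (intro bexI[of _ "u' \<ominus>\<^bsub>H.Fr r\<^esub> v"]) (auto simp: phi_simps H.cl.diff)
qed

text \<open>If \<open>phi r z\<close> vanishes, its lift is a Hochschild relation, so all coordinates are twisted
  commutators (\<open>coord_map_Nul\<close>); but a chain of symbols with such coordinates is a relation.\<close>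

theorem phi_eq_zero_iff:
  assumes "z \<in> cyc.len r" shows "phi r z = \<zero>\<^bsub>H.Ch r\<^esub> \<longleftrightarrow> z \<in> cyc.R 0"
proof
  assume z: "phi r z = \<zero>\<^bsub>H.Ch r\<^esub>"
  obtain v where u: "v \<in> carrier (H.Fr r)" "phi r z = H.Nr.cl r v"
    "\<And>e0 W0. (e0, W0) \<in> cyc.reduced_symbols r \<Longrightarrow> coord_map e0 W0 r v = val (cyc.coord e0 W0 z)" using phi_lift[OF assms] by blast
  have v: "v \<in> H.Nul r"
    using H.Nr.cl_eq_N_iff[OF u(1)] u(2) z by (simp add: H.Ch_eq H.Nr.subquot_simps(2))
  have "val (cyc.coord e0 W0 z) \<in> TC (e0 + sum_list W0 + 0)" if "(e0, W0) \<in> cyc.reduced_symbols r" for e0 W0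
    using coord_map_Nul[OF that v] u(3)[OF that] by simp
  then show "z \<in> cyc.R 0" by (intro cyc.R_if_coords[OF assms]) (simp add: Q_def)
qed (rule phi_R)

end


section \<open>The Hochschild homology of the monogenic extension\<close>

(* The numeral 1 stays intact again, as in the statements about the complex of symbols. *)
declare One_nat_def [simp del]

lemma (in Module.module) set_add_submodule:
  assumes H: "submodule H R M" and I: "submodule I R M"
  shows "submodule (H <+>\<^bsub>M\<^esub> I) R M"
proof (rule submoduleI)
  note H' = submoduleE[OF H] and I' = submoduleE[OF I]
  have cl: "x \<in> carrier M" if "x \<in> H \<or> x \<in> I" for x using that H'(1) I'(1) by blast
  show "H <+>\<^bsub>M\<^esub> I \<subseteq> carrier M" by (auto simp: set_add_def' cl)
  show "\<zero>\<^bsub>M\<^esub> \<in> H <+>\<^bsub>M\<^esub> I"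
    using submodule_zero[OF H] submodule_zero[OF I] unfolding set_add_def' by force
  fix a assume "a \<in> H <+>\<^bsub>M\<^esub> I"
  then obtain h i where hi: "h \<in> H" "i \<in> I" "a = h \<oplus>\<^bsub>M\<^esub> i" by (auto simp: set_add_def')
  then have "\<ominus>\<^bsub>M\<^esub> a = \<ominus>\<^bsub>M\<^esub> h \<oplus>\<^bsub>M\<^esub> \<ominus>\<^bsub>M\<^esub> i" by (simp add: M.minus_add cl)
  then show "\<ominus>\<^bsub>M\<^esub> a \<in> H <+>\<^bsub>M\<^esub> I" using H'(3)[OF hi(1)] I'(3)[OF hi(2)] unfolding set_add_def' by blast
  { fix b assume "b \<in> H <+>\<^bsub>M\<^esub> I"
    then obtain h' i' where hi': "h' \<in> H" "i' \<in> I" "b = h' \<oplus>\<^bsub>M\<^esub> i'" by (auto simp: set_add_def')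
    then have "a \<oplus>\<^bsub>M\<^esub> b = (h \<oplus>\<^bsub>M\<^esub> h') \<oplus>\<^bsub>M\<^esub> (i \<oplus>\<^bsub>M\<^esub> i')" using hi by (simp add: M.a_ac cl)
    then show "a \<oplus>\<^bsub>M\<^esub> b \<in> H <+>\<^bsub>M\<^esub> I"
      using H'(5)[OF hi(1) hi'(1)] I'(5)[OF hi(2) hi'(2)] unfolding set_add_def' by blast }
next
  have cl: "y \<in> carrier M" if "y \<in> H \<or> y \<in> I" for y using that submoduleE(1)[OF H] submoduleE(1)[OF I] by blast
  fix x a assume x: "x \<in> carrier R" and "a \<in> H <+>\<^bsub>M\<^esub> I"
  then obtain h i where hi: "h \<in> H" "i \<in> I" "a = h \<oplus>\<^bsub>M\<^esub> i" by (auto simp: set_add_def')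
  then have "x \<odot>\<^bsub>M\<^esub> a = x \<odot>\<^bsub>M\<^esub> h \<oplus>\<^bsub>M\<^esub> x \<odot>\<^bsub>M\<^esub> i" using x by (simp add: smult_r_distr cl)
  then show "x \<odot>\<^bsub>M\<^esub> a \<in> H <+>\<^bsub>M\<^esub> I"
    using submoduleE(4)[OF H x hi(1)] submoduleE(4)[OF I x hi(2)] unfolding set_add_def' by blast
qed

context monogenic
begin

abbreviation dm where "dm \<equiv> diff_mult K \<alpha> (l n)"
abbreviation nm where "nm \<equiv> norm_sum K \<alpha> n"

lemma dm_linear: "linear k K K dm"
  unfolding diff_mult_def
  by (rule linearI[OF K_module])
    (use ln in \<open>auto simp: ring_hom_add[OF alpha_hom] alpha_smult a_minus_def M.minus_add M.l_distr M.a_ac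
      smult_mult_left[symmetric] smult_r_distr smult_r_minus\<close>)

lemma nm_linear: "linear k K K nm"
  unfolding norm_sum_def
proof (rule linearI[OF K_module])
  fix x y assume "x \<in> carrier K" "y \<in> carrier K"
  then show "(\<Oplus>j\<in>{..<n}. (\<alpha> ^^ j) (x \<oplus> y)) = (\<Oplus>j\<in>{..<n}. (\<alpha> ^^ j) x) \<oplus> (\<Oplus>j\<in>{..<n}. (\<alpha> ^^ j) y)"
    by (simp add: pow_add M.finsum_addf)
next
  fix x y assume "x \<in> carrier k" "y \<in> carrier K"
  then show "(\<Oplus>j\<in>{..<n}. (\<alpha> ^^ j) (x \<odot> y)) = x \<odot> (\<Oplus>j\<in>{..<n}. (\<alpha> ^^ j) y)"
    by (simp add: pow_smult finsum_smult_ldistr)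
qed auto

lemma val_norm: "val (cyc.norm_push m q) = (\<Oplus>j\<in>{..<m}. (\<alpha> ^^ j) (val q))"
  unfolding cyc.norm_push_def val_def by (simp add: val.sum) (simp add: val_def[symmetric] val_push_tw)

lemma val_dm: "val (push mc q - push (\<lambda>a. mc (tw 1 a)) q) = dm (val q)"
proof -
  have "push (\<lambda>a. mc (tw 1 a)) q = push mc (push (tw 1) q)" by (simp add: push_push)
  then have "val (push mc q - push (\<lambda>a. mc (tw 1 a)) q) = val q \<otimes> c \<ominus> \<alpha> (val q) \<otimes> c"
    using val_push_tw[of 1 q] by (simp add: val_push_mc One_nat_def)
  then show ?thesis using ln
    by (simp add: diff_mult_def c_def a_minus_def M.r_minus M.l_minus M.l_distr M.a_comm)
qed

lemma val_ex: "a \<in> carrier K \<Longrightarrow> \<exists>q. val q = a"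
  by (intro exI[of _ "frag_of a"]) simp

abbreviation Hcyc where "Hcyc r \<equiv> hoch_cycles k K A emb r"
abbreviation Hbd where "Hbd r \<equiv> H.bd (Suc r) ` carrier (H.Ch (Suc r))"

lemma Hbd_submodule: "module_with_submodule k (H.Ch r) (Hbd r)"
proof -
  interpret b: linear k "H.Ch (Suc r)" "H.Ch r" "H.bd (Suc r)" using H.bd_linear[of "Suc r"] by simp
  show ?thesis
    by (intro module_with_submodule.intro module_with_submodule_axioms.intro H.Ch_module
        b.image_submodule H.Ch.carrier_is_submodule)
qed

lemma Hcyc_sub: "Hcyc r \<subseteq> carrier (H.Ch r)"
  by (auto simp: hoch_cycles_def)

lemma Hcyc_iff:
  assumes "z \<in> cyc.len r" shows "phi r z \<in> Hcyc r \<longleftrightarrow> z \<in> cyc.Cyc 0 r"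
proof (cases r)
  case 0
  then show ?thesis using assms cyc.D_len_0[of z] by (simp add: hoch_cycles_def cyc.Cyc_def cyc.R.zero)
next
  case (Suc s)
  have "phi r z \<in> Hcyc r \<longleftrightarrow> phi s (cyc.D z) = \<zero>\<^bsub>H.Ch s\<^esub>"
    using assms phi_D[of z s] Suc by (simp add: hoch_cycles_def)
  then show ?thesis using assms phi_eq_zero_iff[OF cyc.len_D, of z s] Suc by (simp add: cyc.Cyc_def)
qed

lemma Ch_eq_iff: "x \<in> carrier (H.Ch r) \<Longrightarrow> y \<in> carrier (H.Ch r) \<Longrightarrow> x \<ominus>\<^bsub>H.Ch r\<^esub> y = \<zero>\<^bsub>H.Ch r\<^esub> \<longleftrightarrow> x = y"
  by (metis a_minus_def H.Ch.M.minus_equality H.Ch.M.minus_minus H.Ch.M.r_neg H.Ch.M.a_inv_closed H.Ch.M.a_comm)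

lemma Hbd_iff:
  assumes "z \<in> cyc.len r" shows "phi r z \<in> Hbd r \<longleftrightarrow> z \<in> cyc.Bd 0 r"
proof -
  have 1: "phi r z = H.bd (Suc r) (phi (Suc r) y) \<longleftrightarrow> z - cyc.D y \<in> cyc.R 0" if "y \<in> cyc.len (Suc r)" for y
  proof -
    have "z - cyc.D y \<in> cyc.len r" using assms that by (intro cyc.len_diff cyc.len_D)
    then have "z - cyc.D y \<in> cyc.R 0 \<longleftrightarrow> phi r z \<ominus>\<^bsub>H.Ch r\<^esub> phi r (cyc.D y) = \<zero>\<^bsub>H.Ch r\<^esub>"
      using phi_eq_zero_iff[of "z - cyc.D y" r] by (simp add: phi_simps)
    then show ?thesis using Ch_eq_iff[of "phi r z" r "phi r (cyc.D y)"] phi_D[OF that] by (metis phi_closed)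
  qed
  show ?thesis
  proof
    assume "phi r z \<in> Hbd r"
    then obtain Y where "Y \<in> carrier (H.Ch (Suc r))" "phi r z = H.bd (Suc r) Y" by blast
    then obtain y where "y \<in> cyc.len (Suc r)" "phi r z = H.bd (Suc r) (phi (Suc r) y)"
      using phi_surj by blast
    then show "z \<in> cyc.Bd 0 r" using 1 assms by (auto simp: cyc.Bd_def)
  next
    assume "z \<in> cyc.Bd 0 r"
    then obtain y where "y \<in> cyc.len (Suc r)" "z - cyc.D y \<in> cyc.R 0" by (auto simp: cyc.Bd_def)
    then show "phi r z \<in> Hbd r" using 1 by (auto intro!: image_eqI)
  qed
qed

text \<open>The Hochschild chain obtained by \<open>m\<close>-fold periodicity from the symbol \<open>\<langle>a; e; W\<rangle>\<close>. For
  \<open>\<langle>a; 0\<rangle>\<close> and \<open>\<langle>a; n-1; 1\<rangle>\<close> it represents the homology in even and odd degrees.\<close>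

definition hclass where "hclass r m e W a = phi r ((cyc.F ^^ m) (place e W (frag_of a)))"

lemma F_pow_add: "(cyc.F ^^ m) (x + y) = (cyc.F ^^ m) x + (cyc.F ^^ m) y"
  by (induction m) (simp_all add: cyc.F_def cyc.split_chain_def sum.distrib)
lemma F_pow_diff: "(cyc.F ^^ m) (x - y) = (cyc.F ^^ m) x - (cyc.F ^^ m) y"
  using F_pow_add[of m "x - y" y] by simp
lemma F_pow_map_coef: "(cyc.F ^^ m) (map_coef g x) = map_coef g ((cyc.F ^^ m) x)"
  by (induction m) (simp_all add: cyc.F_def cyc.split_chain_def map_coef_shift map_coef_insert_pow)
lemma F_pow_R: "x \<in> cyc.R (m * n) \<Longrightarrow> (cyc.F ^^ m) x \<in> cyc.R 0"
proof -
  have "x \<in> cyc.R (t + m * n) \<Longrightarrow> (cyc.F ^^ m) x \<in> cyc.R t" for t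
  proof (induction m arbitrary: t)
    case (Suc m)
    then have "x \<in> cyc.R ((t + n) + m * n)" by (simp add: ac_simps)
    from cyc.R_F[OF Suc.IH[OF this]] show ?case by simp
  qed simp
  from this[of 0] show "x \<in> cyc.R (m * n) \<Longrightarrow> (cyc.F ^^ m) x \<in> cyc.R 0" by simp
qed

lemma phi_F_val_zero:
  assumes "val q = \<zero>" shows "phi r ((cyc.F ^^ m) (place e W q)) = \<zero>\<^bsub>H.Ch r\<^esub>"
  by (intro phi_R F_pow_R cyc.R.coef) (simp add: Q_def assms TC_zero)

text \<open>Two formal sums of scalars with the same value differ by an element of every \<open>Q T\<close>; hence \<open>hclass\<close>
  is additive in \<open>a\<close>.\<close>

lemma hclass_val: "phi r ((cyc.F ^^ m) (place e W q)) = hclass r m e W (val q)"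
proof -
  have "phi r ((cyc.F ^^ m) (place e W (q - frag_of (val q)))) = \<zero>\<^bsub>H.Ch r\<^esub>"
    by (rule phi_F_val_zero) (simp add: a_minus_def M.r_neg)
  then have "phi r ((cyc.F ^^ m) (place e W q)) \<ominus>\<^bsub>H.Ch r\<^esub> hclass r m e W (val q) = \<zero>\<^bsub>H.Ch r\<^esub>"
    by (simp add: F_pow_diff phi_simps hclass_def)
  then show ?thesis using Ch_eq_iff by (simp add: hclass_def)
qed

lemma hclass_add: "a \<in> carrier K \<Longrightarrow> b \<in> carrier K \<Longrightarrow> hclass r m e W (a \<oplus> b) = hclass r m e W a \<oplus>\<^bsub>H.Ch r\<^esub> hclass r m e W b"
  using hclass_val[of r m e W "frag_of a + frag_of b"] by (simp add: F_pow_add phi_simps hclass_def)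

lemma hclass_smult: "x \<in> carrier k \<Longrightarrow> a \<in> carrier K \<Longrightarrow> hclass r m e W (x \<odot> a) = x \<odot>\<^bsub>H.Ch r\<^esub> hclass r m e W a"
proof -
  assume x: "x \<in> carrier k" and a: "a \<in> carrier K"
  let ?g = "\<lambda>a. if a \<in> carrier K then x \<odot> a else a"
  have "place e W (frag_of (x \<odot> a)) = map_coef ?g (place e W (frag_of a))" using a by simp
  then show ?thesis unfolding hclass_def F_pow_map_coef using phi_smult[OF x] by (metis F_pow_map_coef)
qed

lemma in_sum_iff:
  "a \<in> (TC T <+>\<^bsub>K\<^esub> f ` carrier K) \<longleftrightarrow> (\<exists>b\<in>carrier K. a \<ominus> f b \<in> TC T)"
  if "a \<in> carrier K" "\<And>b. b \<in> carrier K \<Longrightarrow> f b \<in> carrier K" for a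
proof
  assume "a \<in> (TC T <+>\<^bsub>K\<^esub> f ` carrier K)"
  then obtain t b where "t \<in> TC T" "b \<in> carrier K" "a = t \<oplus> f b" by (auto simp: set_add_def')
  then show "\<exists>b\<in>carrier K. a \<ominus> f b \<in> TC T"
    using that TC_closed by (intro bexI[of _ b]) (auto simp: a_minus_def M.a_assoc M.r_neg)
next
  assume "\<exists>b\<in>carrier K. a \<ominus> f b \<in> TC T"
  then obtain b where b: "b \<in> carrier K" "a \<ominus> f b \<in> TC T" by blast
  then have "a = (a \<ominus> f b) \<oplus> f b" using that by (simp add: a_minus_def M.a_assoc M.l_neg)
  then show "a \<in> (TC T <+>\<^bsub>K\<^esub> f ` carrier K)" using b unfolding set_add_def' by blast
qed

lemma ex_val: "(\<exists>q. R (val q)) \<longleftrightarrow> (\<exists>b\<in>carrier K. R b)"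
  using val_ex val_simps(4) by metis

lemma nm_val: "val (cyc.norm_push n q) = nm (val q)"
  by (simp add: val_norm norm_sum_def)

lemma len_even: "(cyc.F ^^ m) (place 0 [] q) \<in> cyc.len (2 * m)"
  using cyc.len_F_pow[OF cyc.len_place[of "[]" 0 0 q], of m] by simp
lemma len_odd: "(cyc.F ^^ m) (place (n - 1) [1] q) \<in> cyc.len (2 * m + 1)"
  using cyc.len_F_pow[OF cyc.len_place[of "[1]" 1 "n - 1" q], of m] by (simp add: One_nat_def)

lemma even_boundary:
  assumes "a \<in> carrier K"
  shows "hclass (2 * m) m 0 [] a \<in> Hbd (2 * m) \<longleftrightarrow> a \<in> TC (m * n) <+>\<^bsub>K\<^esub> dm ` carrier K"
proof -
  interpret d: linear k K K dm by (rule dm_linear)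
  have "hclass (2 * m) m 0 [] a \<in> Hbd (2 * m) \<longleftrightarrow>
     (\<exists>q. frag_of a - (push mc q - push (\<lambda>a. mc (tw 1 a)) q) \<in> Q (m * n))"
    using Hbd_iff[OF len_even[of m "frag_of a"]] cyc.even_boundary_iff[of 0 m "frag_of a"]
    unfolding hclass_def by (simp only: add_0 dvd_0_right simp_thms True_implies_equals)
  also have "\<dots> \<longleftrightarrow> (\<exists>q. a \<ominus> dm (val q) \<in> TC (m * n))"
    unfolding Q_def mem_Collect_eq val_simps(3)[of "frag_of a"] val_dm using assms by simp
  also have "\<dots> \<longleftrightarrow> a \<in> TC (m * n) <+>\<^bsub>K\<^esub> dm ` carrier K"
    using in_sum_iff[OF assms, of dm "m * n"] ex_val[of "\<lambda>b. a \<ominus> dm b \<in> TC (m * n)"] by auto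
  finally show ?thesis .
qed

lemma even_cycle_pos:
  assumes "a \<in> carrier K"
  shows "hclass (2 * m + 2) (Suc m) 0 [] a \<in> Hcyc (2 * m + 2) \<longleftrightarrow> nm a \<in> TC ((m + 1) * n)"
proof -
  have "hclass (2 * m + 2) (Suc m) 0 [] a \<in> Hcyc (2 * m + 2) \<longleftrightarrow> cyc.norm_push n (frag_of a) \<in> Q ((m + 1) * n)"
    using Hcyc_iff[OF len_even[of "Suc m" "frag_of a"]] cyc.even_cycle_iff[of m "frag_of a" 0]
    unfolding hclass_def by (simp only: add_0 mult_Suc_right add.commute[of 2])
  then show ?thesis unfolding Q_def mem_Collect_eq nm_val using assms by simp
qed

lemma cyc_D_additive: "Modules.additive cyc.D" unfolding cyc.D_def by (rule additive_frag_extend)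

lemma Cyc_of_Bd: "z \<in> cyc.Cyc 0 r \<Longrightarrow> z - y \<in> cyc.Bd 0 r \<Longrightarrow> y \<in> cyc.len r \<Longrightarrow> y \<in> cyc.Cyc 0 r"
  using cyc.D_Bd[of "z - y" 0 r] cyc.R.diff[of "cyc.D z" 0 "cyc.D (z - y)"]
  by (simp add: cyc.Cyc_def Modules.additive.diff[OF cyc_D_additive])

lemma even_class_ex:
  assumes "Y \<in> Hcyc (2 * m)"
  shows "\<exists>a\<in>carrier K. hclass (2 * m) m 0 [] a \<in> Hcyc (2 * m) \<and> Y \<ominus>\<^bsub>H.Ch (2 * m)\<^esub> hclass (2 * m) m 0 [] a \<in> Hbd (2 * m)"
proof -
  obtain z where z: "z \<in> cyc.len (2 * m)" "phi (2 * m) z = Y"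
    using phi_surj assms Hcyc_sub by blast
  then have zc: "z \<in> cyc.Cyc 0 (2 * m)" using Hcyc_iff assms by blast
  then obtain q where q: "z - (cyc.F ^^ m) (place 0 [] q) \<in> cyc.Bd 0 (2 * m)"
    using cyc.even_cycle_ex[of 0 z m] by auto
  have "phi (2 * m) (z - (cyc.F ^^ m) (place 0 [] q)) \<in> Hbd (2 * m)"
    using q Hbd_iff[OF cyc.len_diff[OF z(1) len_even]] by blast
  then have "Y \<ominus>\<^bsub>H.Ch (2 * m)\<^esub> hclass (2 * m) m 0 [] (val q) \<in> Hbd (2 * m)"
    using z(2) by (simp add: phi_simps hclass_val)
  moreover have "hclass (2 * m) m 0 [] (val q) \<in> Hcyc (2 * m)"
    unfolding hclass_val[symmetric] using Hcyc_iff[OF len_even] Cyc_of_Bd[OF zc q len_even] by blast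
  ultimately show ?thesis by (intro bexI[of _ "val q"]) simp_all
qed

lemma odd_boundary:
  assumes "a \<in> carrier K"
  shows "hclass (2 * m + 1) m (n - 1) [1] a \<in> Hbd (2 * m + 1) \<longleftrightarrow> a \<in> TC ((m + 1) * n) <+>\<^bsub>K\<^esub> nm ` carrier K"
proof -
  interpret d: linear k K K nm by (rule nm_linear)
  have "hclass (2 * m + 1) m (n - 1) [1] a \<in> Hbd (2 * m + 1) \<longleftrightarrow>
     (\<exists>q. frag_of a - cyc.norm_push n q \<in> Q ((m + 1) * n))"
    using Hbd_iff[OF len_odd[of m "frag_of a"]] cyc.odd_boundary_iff[of 0 m "frag_of a"]
    unfolding hclass_def by (simp only: add_0 dvd_0_right simp_thms True_implies_equals)
  also have "\<dots> \<longleftrightarrow> (\<exists>q. a \<ominus> nm (val q) \<in> TC ((m + 1) * n))"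
    unfolding Q_def mem_Collect_eq val_simps(3) nm_val using assms by simp
  also have "\<dots> \<longleftrightarrow> a \<in> TC ((m + 1) * n) <+>\<^bsub>K\<^esub> nm ` carrier K"
    using in_sum_iff[OF assms, of nm "(m + 1) * n"] ex_val[of "\<lambda>b. a \<ominus> nm b \<in> TC ((m + 1) * n)"] by auto
  finally show ?thesis .
qed

lemma odd_cycle:
  assumes "a \<in> carrier K"
  shows "hclass (2 * m + 1) m (n - 1) [1] a \<in> Hcyc (2 * m + 1) \<longleftrightarrow> dm a \<in> TC (m * n)"
proof -
  have "hclass (2 * m + 1) m (n - 1) [1] a \<in> Hcyc (2 * m + 1) \<longleftrightarrow>
    push mc (frag_of a) - push (\<lambda>a. mc (tw 1 a)) (frag_of a) \<in> Q (m * n)"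
    using Hcyc_iff[OF len_odd[of m "frag_of a"]] cyc.odd_cycle_iff[of m "frag_of a" 0]
    unfolding hclass_def by (simp only: add_0)
  then show ?thesis unfolding Q_def mem_Collect_eq val_dm using assms by simp
qed

lemma odd_class_ex:
  assumes "Y \<in> Hcyc (2 * m + 1)"
  shows "\<exists>a\<in>carrier K. hclass (2 * m + 1) m (n - 1) [1] a \<in> Hcyc (2 * m + 1) \<and> Y \<ominus>\<^bsub>H.Ch (2 * m + 1)\<^esub> hclass (2 * m + 1) m (n - 1) [1] a \<in> Hbd (2 * m + 1)"
proof -
  obtain z where z: "z \<in> cyc.len (2 * m + 1)" "phi (2 * m + 1) z = Y"
    using phi_surj assms Hcyc_sub by blast
  then have zc: "z \<in> cyc.Cyc 0 (2 * m + 1)" using Hcyc_iff assms by blast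
  then obtain q where q: "z - (cyc.F ^^ m) (place (n - 1) [1] q) \<in> cyc.Bd 0 (2 * m + 1)"
    using cyc.odd_cycle_ex[of 0 z m] by auto
  have "phi (2 * m + 1) (z - (cyc.F ^^ m) (place (n - 1) [1] q)) \<in> Hbd (2 * m + 1)"
    using q Hbd_iff[OF cyc.len_diff[OF z(1) len_odd]] by blast
  then have "Y \<ominus>\<^bsub>H.Ch (2 * m + 1)\<^esub> hclass (2 * m + 1) m (n - 1) [1] (val q) \<in> Hbd (2 * m + 1)"
    using z(2) by (simp add: phi_simps hclass_val)
  moreover have "hclass (2 * m + 1) m (n - 1) [1] (val q) \<in> Hcyc (2 * m + 1)"
    unfolding hclass_val[symmetric] using Hcyc_iff[OF len_odd] Cyc_of_Bd[OF zc q len_odd] by blast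
  ultimately show ?thesis by (intro bexI[of _ "val q"]) simp_all
qed

lemma HH_eq: "HH_monogenic k K \<alpha> n l r = subquot (H.Ch r) (Hcyc r) (Hbd r)"
proof -
  have "monogenic_const K \<alpha> n l = emb" by (rule ext) (simp add: emb_def)
  then show ?thesis by (simp add: hoch_homology_def)
qed

lemma hclass_in: "hclass r m e W a \<in> carrier (H.Ch r)" by (simp add: hclass_def)

lemma dm_sum_submodule: "module_with_submodule k K (TC T <+>\<^bsub>K\<^esub> dm ` carrier K)"
proof -
  interpret d: linear k K K dm by (rule dm_linear)
  show ?thesis by (intro module_with_submodule.intro module_with_submodule_axioms.intro K_module
    set_add_submodule TC_submodule d.image_submodule carrier_is_submodule)
qed

theorem HH_0: "module_iso k (HH_monogenic k K \<alpha> n l 0)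
    (subquot K (carrier K) (TC 0 <+>\<^bsub>K\<^esub> dm ` carrier K))"
  unfolding HH_eq
proof (rule module_iso_subquot[where \<phi> = "hclass 0 0 0 []", OF Hbd_submodule dm_sum_submodule Hcyc_sub carrier_is_submodule])
  fix a assume a: "a \<in> carrier K"
  show "hclass 0 0 0 [] a \<in> Hcyc 0" using hclass_in by (simp add: hoch_cycles_def)
  show "hclass 0 0 0 [] a \<in> Hbd 0 \<longleftrightarrow> a \<in> TC 0 <+>\<^bsub>K\<^esub> dm ` carrier K"
    using even_boundary[OF a, of 0] by simp
next
  fix Y assume "Y \<in> Hcyc 0"
  then show "\<exists>a\<in>carrier K. Y \<ominus>\<^bsub>H.Ch 0\<^esub> hclass 0 0 0 [] a \<in> Hbd 0" using even_class_ex[of Y 0] by auto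
qed (auto simp: hclass_add hclass_smult)

theorem HH_even: "module_iso k (HH_monogenic k K \<alpha> n l (2 * m + 2))
    (subquot K {a \<in> carrier K. nm a \<in> TC ((m + 1) * n)} (TC ((m + 1) * n) <+>\<^bsub>K\<^esub> dm ` carrier K))"
proof -
  interpret d: linear k K K nm by (rule nm_linear)
  let ?r = "2 * m + 2" and ?S = "{a \<in> carrier K. nm a \<in> TC ((m + 1) * n)}"
  let ?h = "hclass ?r (Suc m) 0 []"
  have e: "2 * Suc m = ?r" "Suc m * n = (m + 1) * n" by (simp_all add: algebra_simps)
  have S: "submodule ?S k K" by (rule d.vimage_submodule[OF TC_submodule])
  show ?thesis unfolding HH_eq
  proof (rule module_iso_subquot[where \<phi> = ?h, OF Hbd_submodule dm_sum_submodule Hcyc_sub S])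
    fix a assume a: "a \<in> ?S"
    then show "?h a \<in> Hcyc ?r" using even_cycle_pos by blast
    show "?h a \<in> Hbd ?r \<longleftrightarrow> a \<in> TC ((m + 1) * n) <+>\<^bsub>K\<^esub> dm ` carrier K"
      using even_boundary[of a "Suc m", unfolded e] a by blast
  next
    fix Y assume Y: "Y \<in> Hcyc ?r"
    then obtain a where a: "a \<in> carrier K" "?h a \<in> Hcyc ?r" "Y \<ominus>\<^bsub>H.Ch ?r\<^esub> ?h a \<in> Hbd ?r"
      using even_class_ex[of Y "Suc m"] by auto
    then show "\<exists>a\<in>?S. Y \<ominus>\<^bsub>H.Ch ?r\<^esub> ?h a \<in> Hbd ?r" using a even_cycle_pos[OF a(1)] by blast
  qed (auto simp: hclass_add hclass_smult)
qed

abbreviation top where "top \<equiv> monogenic_top K \<alpha> n l"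

lemma top_linear: "linear k K A top"
proof (rule linearI[OF H.module_axioms])
  fix x y assume "x \<in> carrier K" "y \<in> carrier K"
  then show "top (x \<oplus> y) = top x \<oplus>\<^bsub>A\<^esub> top y" by (simp add: top_eq ring_hom_add[OF emb_hom] A.l_distr)
next
  fix x y assume "x \<in> carrier k" "y \<in> carrier K"
  then show "top (x \<odot> y) = x \<odot>\<^bsub>A\<^esub> top y" by (simp add: top_eq emb_smult H.smult_mult_left)
qed (simp add: top_eq)

lemma coef_top: "a \<in> carrier K \<Longrightarrow> coef (n - 1) (top a) = a"
  using n_ge_2 by (simp add: top_eq coef_mono)

lemma inj_top: "inj_on top (carrier K)"
  using coef_top by (rule inj_on_inverseI)

lemma top_image_iff: "a \<in> carrier K \<Longrightarrow> N \<subseteq> carrier K \<Longrightarrow> top a \<in> top ` N \<longleftrightarrow> a \<in> N"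
  by (rule inj_on_image_mem_iff[OF inj_top])

text \<open>The target lives inside \<open>A\<close>, on the elements \<open>a x\<^sup>n\<^sup>-\<^sup>1\<close>; the isomorphism reads off \<open>a\<close> with
  \<open>coef (n - 1)\<close>.\<close>

theorem HH_odd: "module_iso k (HH_monogenic k K \<alpha> n l (2 * m + 1))
    (subquot A (top ` {a \<in> carrier K. dm a \<in> TC (m * n)})
      (top ` (TC ((m + 1) * n) <+>\<^bsub>K\<^esub> nm ` carrier K)))"
proof -
  interpret d: linear k K K dm by (rule dm_linear)
  interpret e: linear k K K nm by (rule nm_linear)
  interpret t: linear k K A top by (rule top_linear)
  let ?r = "2 * m + 1" and ?S = "{a \<in> carrier K. dm a \<in> TC (m * n)}"
    and ?N = "TC ((m + 1) * n) <+>\<^bsub>K\<^esub> nm ` carrier K"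
  define h where "h Y = hclass ?r m (n - 1) [1] (coef (n - 1) Y)" for Y
  have h_top: "h (top a) = hclass ?r m (n - 1) [1] a" if "a \<in> carrier K" for a
    unfolding h_def coef_top[OF that] ..
  have S: "submodule (top ` ?S) k A" by (intro t.image_submodule d.vimage_submodule[OF TC_submodule])
  have SA: "top ` ?S \<subseteq> carrier A" using Module.module.submoduleE(1)[OF H.module_axioms S] .
  have N: "submodule ?N k K"
    by (intro set_add_submodule TC_submodule e.image_submodule carrier_is_submodule)
  have Nc: "?N \<subseteq> carrier K" using submoduleE(1)[OF N] .
  have mN: "module_with_submodule k A (top ` ?N)"
    by (intro module_with_submodule.intro module_with_submodule_axioms.intro H.module_axioms t.image_submodule N)
  have lt: "n - 1 < n" using n_ge_2 by simp
  have h_cyc: "h Y \<in> Hcyc ?r" if YS: "Y \<in> top ` ?S" for Y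
  proof -
    obtain a where aS: "a \<in> ?S" and Y: "Y = top a" using YS by blast
    then have a: "a \<in> carrier K" "dm a \<in> TC (m * n)" by simp_all
    have "h (top a) \<in> Hcyc ?r" unfolding h_top[OF a(1)] odd_cycle[OF a(1), of m] by (rule a(2))
    then show ?thesis unfolding Y .
  qed
  have h_bd: "h Y \<in> Hbd ?r \<longleftrightarrow> Y \<in> top ` ?N" if YS: "Y \<in> top ` ?S" for Y
  proof -
    obtain a where aS: "a \<in> ?S" and Y: "Y = top a" using YS by blast
    then have a: "a \<in> carrier K" by simp
    have "h (top a) \<in> Hbd ?r \<longleftrightarrow> a \<in> ?N" unfolding h_top[OF a] by (rule odd_boundary[OF a])
    also have "\<dots> \<longleftrightarrow> top a \<in> top ` ?N" by (rule top_image_iff[OF a Nc, symmetric])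
    finally show ?thesis unfolding Y .
  qed
  have h_add: "h (Y \<oplus>\<^bsub>A\<^esub> Z) = h Y \<oplus>\<^bsub>H.Ch ?r\<^esub> h Z" if "Y \<in> top ` ?S" "Z \<in> top ` ?S" for Y Z
    unfolding h_def using lt subsetD[OF SA that(1)] subsetD[OF SA that(2)]
    by (simp add: coef_add hclass_add coef_closed)
  have h_smult: "h (x \<odot>\<^bsub>A\<^esub> Y) = x \<odot>\<^bsub>H.Ch ?r\<^esub> h Y" if "x \<in> carrier k" "Y \<in> top ` ?S" for x Y
    unfolding h_def using lt that(1) subsetD[OF SA that(2)]
    by (simp add: coef_smult hclass_smult coef_closed)
  have h_ex: "\<exists>Z\<in>top ` ?S. Y \<ominus>\<^bsub>H.Ch ?r\<^esub> h Z \<in> Hbd ?r" if Y: "Y \<in> Hcyc ?r" for Y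
  proof -
    obtain a where a: "a \<in> carrier K" "hclass ?r m (n - 1) [1] a \<in> Hcyc ?r" "Y \<ominus>\<^bsub>H.Ch ?r\<^esub> hclass ?r m (n - 1) [1] a \<in> Hbd ?r"
      using odd_class_ex[OF Y] by blast
    then have aS: "a \<in> ?S" using odd_cycle[OF a(1), of m] by simp
    have "Y \<ominus>\<^bsub>H.Ch ?r\<^esub> h (top a) \<in> Hbd ?r" unfolding h_top[OF a(1)] by (rule a(3))
    moreover have "top a \<in> top ` ?S" using aS by (rule imageI)
    ultimately show ?thesis by (rule rev_bexI[rotated])
  qed
  have "module_iso k (subquot (H.Ch ?r) (Hcyc ?r) (Hbd ?r)) (subquot A (top ` ?S) (top ` ?N))"
  proof (rule module_iso_subquot[where \<phi> = h])
    show "module_with_submodule k (H.Ch ?r) (Hbd ?r)" by (rule Hbd_submodule)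
    show "module_with_submodule k A (top ` ?N)" by (rule mN)
    show "Hcyc ?r \<subseteq> carrier (H.Ch ?r)" by (rule Hcyc_sub)
    show "submodule (top ` ?S) k A" by (rule S)
  qed (fact h_cyc h_add h_smult h_bd h_ex)+
  then show ?thesis unfolding HH_eq .
qed

end

theorem corollary2p4:
  fixes k :: "('k, 'r) ring_scheme"
    and K :: "('k, 'a, 'm) module_scheme"
    and \<alpha> :: "'a \<Rightarrow> 'a" and n :: nat and l :: "nat \<Rightarrow> 'a" and u :: 'a
  assumes "cring k" and "assoc_algebra k K" and "algebra_endo k K \<alpha>"
    and "n \<ge> 2"
    and "l 0 = \<one>\<^bsub>K\<^esub>"
    and "\<And>i. 1 \<le> i \<Longrightarrow> i \<le> n \<Longrightarrow> l i \<in> carrier K"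
    and "\<And>i. 1 \<le> i \<Longrightarrow> i \<le> n \<Longrightarrow> \<alpha> (l i) = l i"
    and "\<And>i a. 1 \<le> i \<Longrightarrow> i \<le> n \<Longrightarrow> a \<in> carrier K \<Longrightarrow> l i \<otimes>\<^bsub>K\<^esub> a = (\<alpha> ^^ i) a \<otimes>\<^bsub>K\<^esub> l i"
    and "u \<in> center K" and "(\<alpha> ^^ n) u = u"
    and "\<And>i. 1 \<le> i \<Longrightarrow> i < n \<Longrightarrow> u \<ominus>\<^bsub>K\<^esub> (\<alpha> ^^ i) u \<in> Units K"
  shows "module_iso k (HH_monogenic k K \<alpha> n l 0)
           (subquot K (carrier K)
             (twisted_comm k K \<alpha> 0 <+>\<^bsub>K\<^esub> diff_mult K \<alpha> (l n) ` carrier K))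
    \<and> (\<forall>m. module_iso k (HH_monogenic k K \<alpha> n l (2 * m + 1))
           (subquot (monogenic_ext K \<alpha> n l)
             (monogenic_top K \<alpha> n l `
                {a \<in> carrier K. diff_mult K \<alpha> (l n) a \<in> twisted_comm k K \<alpha> (m * n)})
             (monogenic_top K \<alpha> n l `
                (twisted_comm k K \<alpha> ((m + 1) * n) <+>\<^bsub>K\<^esub> norm_sum K \<alpha> n ` carrier K)))
         \<and> module_iso k (HH_monogenic k K \<alpha> n l (2 * m + 2))
           (subquot K
             {a \<in> carrier K. norm_sum K \<alpha> n a \<in> twisted_comm k K \<alpha> ((m + 1) * n)}
             (twisted_comm k K \<alpha> ((m + 1) * n) <+>\<^bsub>K\<^esub> diff_mult K \<alpha> (l n) ` carrier K)))"
proof -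
  interpret monogenic k K \<alpha> n l u
    using assms by (intro monogenic.intro twisted_algebra.intro twisted_algebra_axioms.intro monogenic_axioms.intro) simp_all
  show ?thesis using HH_0 HH_odd HH_even by blast
qed

end
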